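(* Let $R$ be a local Noetherian super-ring containing a field, with maximal superideal $\mathfrak{M}=\mathfrak{m}\oplus R_1$, and let $\mathfrak{N}=\mathfrak{n}\oplus\mathfrak{N}_1$ be an $\mathfrak{M}$-primary superideal of $R$. Let $x_1,\dots,x_d\in R_0$ be elements whose residue classes form a system of parameters of the local ring $\overline{R}=R_0/R_1^2$. If $\mathfrak{n}$ is generated by these elements modulo $R_1^2$ (i.e. the ideal $(\mathfrak{n}+R_1^2)/R_1^2$ of $\overline{R}$ is generated by the residue classes of $x_1,\dots,x_d$), then $$d=\mathrm{Ksdim}_0(R)=\mathrm{Ksdim}_0(\mathsf{bgr}_{\mathfrak{N}}(R)).$$
   Context: A super-ring is a unital associative $\mathbb{Z}_2$-graded ring $R=R_0\oplus R_1$; all super-rings are super-commutative ($ab=(-1)^{|a||b|}ba$ for homogeneous $a,b$, and $a^2=0$ for odd $a$). Superideals are $\mathbb{Z}_2$-graded ideals $I=I_0\oplus I_1$. Noetherian means the ascending chain condition on superideals. $R$ is local if $R_0$ is local with maximal ideal $\mathfrak{m}$; then $\mathfrak{M}=\mathfrak{m}\oplus R_1$ is its maximal superideal. A superideal $\mathfrak{N}$ is $\mathfrak{M}$-primary if $\mathfrak{n}:=\mathfrak{N}_0$ is an $\mathfrak{m}$-primary ideal of $R_0$. $\mathrm{Ksdim}_0(S)=\mathrm{Kdim}(S_0)$ (Krull dimension) for a super-ring $S$. For a superideal $I$, put $I_{k,l}=I_0^kI_1^lR$ ($k,l\ge0$, $I_{0,0}=R$); $\mathsf{bgr}_I(R)=\bigoplus_{k,l\ge0}I_{k,l}/(I_{k+1,l}+I_{k,l+1})$,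 a super-ring with multiplication induced from $R$. *)

theory Defs
  imports "HOL-Algebra.Algebra" "HOL-Library.Extended_Nat"
begin

section \<open>Commutative algebra\<close>

text \<open>
  The supremum over the lengths of chains \<open>P\<^sub>0 \<subset> P\<^sub>1 \<subset> ... \<subset> P\<^sub>n\<close> of prime ideals. As it is valued in
  \<^typ>\<open>enat\<close>, the zero ring gets the value \<open>0\<close> and not \<open>-1\<close> or \<open>-\<infinity>\<close>.
\<close>
definition krull_dim :: "('a, 'b) ring_scheme \<Rightarrow> enat"
  where "krull_dim A =
    (SUP Ps \<in> {Ps. Ps \<noteq> [] \<and> (\<forall>P \<in> set Ps. primeideal P A) \<and> sorted_wrt (\<subset>) Ps}.
       enat (length Ps - 1))"

definition local_ring :: "('a, 'b) ring_scheme \<Rightarrow> 'a set \<Rightarrow> bool"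
  where "local_ring A \<mm> \<longleftrightarrow>
    cring A \<and> maximalideal \<mm> A \<and> (\<forall>J. maximalideal J A \<longrightarrow> J = \<mm>)"

definition ideal_radical :: "('a, 'b) ring_scheme \<Rightarrow> 'a set \<Rightarrow> 'a set"
  where "ideal_radical A Q = {a \<in> carrier A. \<exists>n::nat. a [^]\<^bsub>A\<^esub> n \<in> Q}"

definition primary_ideal :: "('a, 'b) ring_scheme \<Rightarrow> 'a set \<Rightarrow> bool"
  where "primary_ideal A Q \<longleftrightarrow>
    cring A \<and> ideal Q A \<and> Q \<noteq> carrier A \<and>
    (\<forall>a \<in> carrier A. \<forall>b \<in> carrier A.
       a \<otimes>\<^bsub>A\<^esub> b \<in> Q \<longrightarrow> a \<in> Q \<or> (\<exists>n::nat. b [^]\<^bsub>A\<^esub> n \<in> Q))"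

definition primary_to :: "('a, 'b) ring_scheme \<Rightarrow> 'a set \<Rightarrow> 'a set \<Rightarrow> bool"
  where "primary_to A P Q \<longleftrightarrow> primary_ideal A Q \<and> ideal_radical A Q = P"

definition system_of_parameters :: "('a, 'b) ring_scheme \<Rightarrow> nat \<Rightarrow> (nat \<Rightarrow> 'a) \<Rightarrow> bool"
  where "system_of_parameters A d y \<longleftrightarrow>
    (\<exists>\<mm>. local_ring A \<mm> \<and> y ` {1..d} \<subseteq> carrier A \<and>
         enat d = krull_dim A \<and> primary_to A \<mm> (Idl\<^bsub>A\<^esub> (y ` {1..d})))"


section \<open>Super-rings\<close>

record 'a superring = "'a ring" +
  even_part :: "'a set"
  odd_part :: "'a set"

locale superring = ring R for R :: "('a, 'b) superring_scheme" (structure) +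
  assumes even_additive: "additive_subgroup (even_part R) R"
    and odd_additive: "additive_subgroup (odd_part R) R"
    and even_Int_odd: "even_part R \<inter> odd_part R = {\<zero>}"
    and even_plus_odd: "even_part R <+> odd_part R = carrier R"
    and even_even: "\<lbrakk>a \<in> even_part R; b \<in> even_part R\<rbrakk> \<Longrightarrow> a \<otimes> b \<in> even_part R"
    and even_odd: "\<lbrakk>a \<in> even_part R; b \<in> odd_part R\<rbrakk> \<Longrightarrow> a \<otimes> b \<in> odd_part R"
    and odd_even: "\<lbrakk>a \<in> odd_part R; b \<in> even_part R\<rbrakk> \<Longrightarrow> a \<otimes> b \<in> odd_part R"
    and odd_odd: "\<lbrakk>a \<in> odd_part R; b \<in> odd_part R\<rbrakk> \<Longrightarrow> a \<otimes> b \<in> even_part R"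
    and comm_even_even: "\<lbrakk>a \<in> even_part R; b \<in> even_part R\<rbrakk> \<Longrightarrow> a \<otimes> b = b \<otimes> a"
    and comm_even_odd: "\<lbrakk>a \<in> even_part R; b \<in> odd_part R\<rbrakk> \<Longrightarrow> a \<otimes> b = b \<otimes> a"
    and anticomm_odd_odd: "\<lbrakk>a \<in> odd_part R; b \<in> odd_part R\<rbrakk> \<Longrightarrow> a \<otimes> b = \<ominus> (b \<otimes> a)"
    and odd_square: "a \<in> odd_part R \<Longrightarrow> a \<otimes> a = \<zero>"

definition even_ring :: "('a, 'b) superring_scheme \<Rightarrow> ('a, 'b) superring_scheme"
  where "even_ring R = R\<lparr>carrier := even_part R\<rparr>"

definition Ksdim0 :: "('a, 'b) superring_scheme \<Rightarrow> enat"
  where "Ksdim0 R = krull_dim (even_ring R)"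

definition superideal :: "'a set \<Rightarrow> ('a, 'b) superring_scheme \<Rightarrow> bool"
  where "superideal I R \<longleftrightarrow>
    ideal I R \<and> I = (I \<inter> even_part R) <+>\<^bsub>R\<^esub> (I \<inter> odd_part R)"

definition noetherian_superring :: "('a, 'b) superring_scheme \<Rightarrow> bool"
  where "noetherian_superring R \<longleftrightarrow>
    superring R \<and>
    (\<forall>I :: nat \<Rightarrow> 'a set. (\<forall>n. superideal (I n) R) \<and> (\<forall>n. I n \<subseteq> I (Suc n)) \<longrightarrow>
       (\<exists>n. \<forall>m \<ge> n. I m = I n))"

definition local_superring :: "('a, 'b) superring_scheme \<Rightarrow> 'a set \<Rightarrow> bool"
  where "local_superring R \<MM> \<longleftrightarrow>
    superring R \<and> (\<exists>\<mm>. local_ring (even_ring R) \<mm> \<and> \<MM> = \<mm> <+>\<^bsub>R\<^esub> odd_part R)"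

definition primary_superideal :: "('a, 'b) superring_scheme \<Rightarrow> 'a set \<Rightarrow> 'a set \<Rightarrow> bool"
  where "primary_superideal R \<MM> \<NN> \<longleftrightarrow>
    superideal \<NN> R \<and> primary_to (even_ring R) (\<MM> \<inter> even_part R) (\<NN> \<inter> even_part R)"

text \<open>
  \<^const>\<open>ideal_prod\<close> forms all finite sums of products, for arbitrary subsets and not only for
  ideals. Thus the next definition is the \<open>R\<^sub>0\<close>-submodule \<open>R\<^sub>1\<^sup>2\<close> of \<open>R\<^sub>0\<close>.
\<close>
definition odd_square_ideal :: "('a, 'b) superring_scheme \<Rightarrow> 'a set"
  where "odd_square_ideal R = odd_part R \<cdot>\<^bsub>R\<^esub> odd_part R"

definition bar_ring :: "('a, 'b) superring_scheme \<Rightarrow> 'a set ring"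
  where "bar_ring R = even_ring R Quot odd_square_ideal R"

definition bar_class :: "('a, 'b) superring_scheme \<Rightarrow> 'a \<Rightarrow> 'a set"
  where "bar_class R a = odd_square_ideal R +>\<^bsub>even_ring R\<^esub> a"


section \<open>The bigraded super-ring of a superideal\<close>

text \<open>Powers of an \<open>R\<^sub>0\<close>-submodule of \<open>R\<close>, with zeroth power \<open>R\<^sub>0\<close>.\<close>
primrec submod_power :: "('a, 'b) superring_scheme \<Rightarrow> 'a set \<Rightarrow> nat \<Rightarrow> 'a set"
  where
    "submod_power R S 0 = even_part R"
  | "submod_power R S (Suc n) = submod_power R S n \<cdot>\<^bsub>R\<^esub> S"

definition bigr_ideal :: "('a, 'b) superring_scheme \<Rightarrow> 'a set \<Rightarrow> nat \<times> nat \<Rightarrow> 'a set"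
  where "bigr_ideal R I = (\<lambda>(k, l).
    submod_power R (I \<inter> even_part R) k \<cdot>\<^bsub>R\<^esub> submod_power R (I \<inter> odd_part R) l \<cdot>\<^bsub>R\<^esub> carrier R)"

definition bigr_next :: "('a, 'b) superring_scheme \<Rightarrow> 'a set \<Rightarrow> nat \<times> nat \<Rightarrow> 'a set"
  where "bigr_next R I = (\<lambda>(k, l).
    bigr_ideal R I (k + 1, l) <+>\<^bsub>R\<^esub> bigr_ideal R I (k, l + 1))"

text \<open>
  The additive group \<open>I\<^bsub>k,l\<^esub> / (I\<^bsub>k+1,l\<^esub> + I\<^bsub>k,l+1\<^esub>)\<close>; as always with \<^const>\<open>A_FactGroup\<close>, its group
  operation \<^const>\<open>monoid.mult\<close> is the addition of cosets.
\<close>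
definition bigr_piece :: "('a, 'b) superring_scheme \<Rightarrow> 'a set \<Rightarrow> nat \<times> nat \<Rightarrow> 'a set monoid"
  where "bigr_piece R I p = R\<lparr>carrier := bigr_ideal R I p\<rparr> A_Mod bigr_next R I p"

text \<open>
  Elements are the finitely supported families of cosets indexed by the bidegree. In the product,
  \<^const>\<open>finprod\<close> is a finite sum in the additive group \<^const>\<open>bigr_piece\<close>. Every \<open>I\<^bsub>k,l\<^esub>\<close> is a
  superideal, and the parity on the direct sum is the one that its summands inherit from \<open>R\<close>
  (it is not the parity of \<open>l\<close>).
\<close>
definition bgr :: "('a, 'b) superring_scheme \<Rightarrow> 'a set \<Rightarrow> (nat \<times> nat \<Rightarrow> 'a set) superring"
  where "bgr R I =
    \<lparr>carrier = carrier (sum_group UNIV (bigr_piece R I)),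
     monoid.mult = (\<lambda>f g (k, l).
       finprod (bigr_piece R I (k, l))
         (\<lambda>(i, j). rcoset_mult R (bigr_next R I (k, l)) (f (i, j)) (g (k - i, l - j)))
         ({..k} \<times> {..l})),
     monoid.one = (\<lambda>p. if p = (0, 0) then bigr_next R I p +>\<^bsub>R\<^esub> \<one>\<^bsub>R\<^esub> else bigr_next R I p),
     ring.zero = monoid.one (sum_group UNIV (bigr_piece R I)),
     ring.add = monoid.mult (sum_group UNIV (bigr_piece R I)),
     even_part = {f \<in> carrier (sum_group UNIV (bigr_piece R I)).
       \<forall>p. \<exists>a \<in> bigr_ideal R I p \<inter> even_part R. f p = bigr_next R I p +>\<^bsub>R\<^esub> a},
     odd_part = {f \<in> carrier (sum_group UNIV (bigr_piece R I)).
       \<forall>p. \<exists>a \<in> bigr_ideal R I p \<inter> odd_part R. f p = bigr_next R I p +>\<^bsub>R\<^esub> a}\<rparr>"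

end

theory Submission
  imports Defs "HOL-Library.Product_Plus"
begin

text \<open>
  The odd part generates a nil ideal, and so do all bidegrees \<open>(k, l)\<close> with \<open>l > 0\<close>. So up to
  nilpotents \<open>R\<^sub>0\<close> is \<open>R\<^sub>0/R\<^sub>1\<^sup>2\<close>, and the even part of the bigraded ring is the associated graded ring of
  \<open>\<nn>\<close>, which is \<open>W/T\<^sup>-\<^sup>1W\<close> for the extended Rees algebra \<open>W\<close>, a Noetherian subring of \<open>R\<^sub>0[T, T\<^sup>-\<^sup>1]\<close>.

  A chain of primes \<open>P\<^sub>0 \<subset> \<dots> \<subset> P\<^sub>d\<close> of \<open>R\<^sub>0\<close> lifts to \<open>W\<close> and can be extended there by a maximal ideal
  containing \<open>T\<^sup>-\<^sup>1\<close>. By Krull's principal ideal theorem there is then a chain of length \<open>d\<close> all of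
  whose members contain \<open>T\<^sup>-\<^sup>1\<close>, so the dimension of the bigraded ring is at least \<open>d\<close>.

  Conversely, up to nilpotents the graded ring is an algebra over the residue field that is
  generated by the \<open>d\<close> elements \<open>x\<^sub>iT\<close>, so a chain of its primes has length at most \<open>d\<close>.
\<close>
section \<open>Saturation and chains of prime ideals in Noetherian rings\<close>

text \<open>The even part of the bigraded ring and the extended Rees algebra are compared through a
  common cover, a ring \<open>WR\<close> of finitely supported families of even coefficients indexed
  by pairs of integers. Primes are pulled back along one surjection and pushed forward along the
  other. Pushing forward needs primes that contain the kernel: its nilpotent elements lie in every
  prime, and the rest are multiples of T^-1. This is why a chain entirely above T^-1 has to be
  produced. The principal ideal theorem is proved without fractions, with Q-saturated ideals in
  place of ideals of the localization at Q. The upper bound rests on counting: a chain of length n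
  gives N^n independent monomials in a space spanned by at most a constant times N^d vectors. The
  base field is the image of R_0 in a quotient domain, where the maximal ideal of R_0 vanishes
  because its elements are nilpotent modulo n. Since x_i is tied to n only modulo R_1^2, it is first
  replaced by an element of n in the same class.\<close>

context cring
begin

lemma ideal_of_closed:
  assumes "I \<subseteq> carrier R" "\<zero> \<in> I" "\<And>a b. a \<in> I \<Longrightarrow> b \<in> I \<Longrightarrow> a \<oplus> b \<in> I"
    and "\<And>r a. r \<in> carrier R \<Longrightarrow> a \<in> I \<Longrightarrow> r \<otimes> a \<in> I"
  shows "ideal I R"
proof (rule idealI)
  have neg: "\<ominus> a \<in> I" if "a \<in> I" for a
  proof -
    have "\<ominus> a = (\<ominus> \<one>) \<otimes> a" using that assms(1) by (metis a_inv_closed l_minus l_one one_closed subsetD)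
    then show ?thesis using assms(4) that by simp
  qed
  show "subgroup I (add_monoid R)"
    using assms neg by (auto intro!: add.subgroupI simp: a_inv_def)
next
  fix a x assume *: "a \<in> I" "x \<in> carrier R"
  then have "a \<otimes> x = x \<otimes> a" using assms(1) m_comm by auto
  then show "a \<otimes> x \<in> I" using assms(4) * by simp
qed (use assms ring_axioms in auto)

lemma ideal_minus: "ideal I R \<Longrightarrow> a \<in> I \<Longrightarrow> b \<in> I \<Longrightarrow> a \<ominus> b \<in> I"
  by (simp add: a_minus_def additive_subgroup.a_closed additive_subgroup.a_inv_closed ideal.axioms(1))

lemma ideal_add: "ideal I R \<Longrightarrow> a \<in> I \<Longrightarrow> b \<in> I \<Longrightarrow> a \<oplus> b \<in> I"
  by (simp add: additive_subgroup.a_closed ideal.axioms(1))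

lemma ideal_mult: "ideal I R \<Longrightarrow> a \<in> I \<Longrightarrow> r \<in> carrier R \<Longrightarrow> r \<otimes> a \<in> I"
  by (simp add: ideal.I_l_closed)

lemma ideal_zero: "ideal I R \<Longrightarrow> \<zero> \<in> I"
  by (simp add: additive_subgroup.zero_closed ideal.axioms(1))

lemma ideal_sub: "ideal I R \<Longrightarrow> I \<subseteq> carrier R"
  by (simp add: additive_subgroup.a_subset ideal.axioms(1))

lemma set_addI: "a \<in> A \<Longrightarrow> b \<in> B \<Longrightarrow> a \<oplus> b \<in> A <+>\<^bsub>R\<^esub> B"
  by (auto simp: set_add_def')

lemma set_addE:
  assumes "c \<in> A <+>\<^bsub>R\<^esub> B" obtains a b where "a \<in> A" "b \<in> B" "c = a \<oplus> b"
  using assms by (auto simp: set_add_def')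

lemma ideal_sum_upper:
  assumes "ideal I R" "ideal J R" shows "I \<subseteq> I <+>\<^bsub>R\<^esub> J" "J \<subseteq> I <+>\<^bsub>R\<^esub> J"
proof -
  show "I \<subseteq> I <+>\<^bsub>R\<^esub> J"
    using set_addI[OF _ ideal_zero[OF assms(2)]] ideal_sub[OF assms(1)] by (metis r_zero subset_iff)
  show "J \<subseteq> I <+>\<^bsub>R\<^esub> J"
    using set_addI[OF ideal_zero[OF assms(1)]] ideal_sub[OF assms(2)] by (metis l_zero subset_iff)
qed

lemma prime_ideal: "primeideal P R \<Longrightarrow> ideal P R"
  by (simp add: primeideal.axioms(1))

lemma prime_mult:
  "\<lbrakk>primeideal P R; a \<in> carrier R; b \<in> carrier R; a \<otimes> b \<in> P; a \<notin> P\<rbrakk> \<Longrightarrow> b \<in> P"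
  by (drule (3) primeideal.I_prime) simp

lemma prime_notin:
  "\<lbrakk>primeideal P R; a \<in> carrier R; b \<in> carrier R; a \<notin> P; b \<notin> P\<rbrakk> \<Longrightarrow> a \<otimes> b \<notin> P"
  using prime_mult by metis

lemma prime_one: "primeideal P R \<Longrightarrow> \<one> \<notin> P"
  by (metis ideal.one_imp_carrier prime_ideal primeideal.I_notcarr)

lemma prime_pow:
  assumes "primeideal P R" "a \<in> carrier R" "a [^] (n::nat) \<in> P" shows "a \<in> P"
  using assms(3)
proof (induction n)
  case 0 then show ?case using prime_one[OF assms(1)] by simp
next
  case (Suc n) then show ?case using primeideal.I_prime[OF assms(1), of "a [^] n" a] assms(2) by auto
qed

lemma primeideal_of:
  assumes "ideal P R" "\<one> \<notin> P"
    "\<And>a b. \<lbrakk>a \<in> carrier R; b \<in> carrier R; a \<otimes> b \<in> P\<rbrakk> \<Longrightarrow> a \<in> P \<or> b \<in> P"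
  shows "primeideal P R"
  using assms by (intro primeidealI is_cring) auto

text \<open>The contraction to the ring of the localization of \<open>J\<close> at the prime \<open>Q\<close>.\<close>
definition sat :: "'a set \<Rightarrow> 'a set \<Rightarrow> 'a set"
  where "sat Q J = {a \<in> carrier R. \<exists>s \<in> carrier R - Q. s \<otimes> a \<in> J}"

lemma satI: "\<lbrakk>s \<in> carrier R; s \<notin> Q; a \<in> carrier R; s \<otimes> a \<in> J\<rbrakk> \<Longrightarrow> a \<in> sat Q J"
  by (auto simp: sat_def)

lemma satE:
  assumes "a \<in> sat Q J" obtains s where "s \<in> carrier R" "s \<notin> Q" "a \<in> carrier R" "s \<otimes> a \<in> J"
  using assms by (auto simp: sat_def)

lemma sat_ideal:
  assumes Q: "primeideal Q R" and J: "ideal J R"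
  shows "ideal (sat Q J) R"
proof (rule ideal_of_closed)
  show "\<zero> \<in> sat Q J"
    using prime_one[OF Q] ideal_zero[OF J] by (auto simp: sat_def intro!: bexI[of _ \<one>])
next
  fix a b assume "a \<in> sat Q J" "b \<in> sat Q J"
  then obtain s t where st: "s \<in> carrier R" "s \<notin> Q" "t \<in> carrier R" "t \<notin> Q" "s \<otimes> a \<in> J" "t \<otimes> b \<in> J"
    and ab: "a \<in> carrier R" "b \<in> carrier R" by (auto simp: sat_def)
  have "(s \<otimes> t) \<otimes> (a \<oplus> b) = t \<otimes> (s \<otimes> a) \<oplus> s \<otimes> (t \<otimes> b)"
    using st(1,3) ab by algebra
  moreover have "\<dots> \<in> J" using st by (simp add: ideal_add[OF J] ideal_mult[OF J])
  moreover have "s \<otimes> t \<in> carrier R - Q" using st prime_notin[OF Q, of s t] by auto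
  ultimately show "a \<oplus> b \<in> sat Q J" using ab satI[of "s \<otimes> t" Q "a \<oplus> b" J] by auto
next
  fix r a assume r: "r \<in> carrier R" and "a \<in> sat Q J"
  from this(2) obtain s where s: "s \<in> carrier R" "s \<notin> Q" "a \<in> carrier R" "s \<otimes> a \<in> J" by (rule satE)
  have "s \<otimes> (r \<otimes> a) = r \<otimes> (s \<otimes> a)" using s(1,3) r by algebra
  then show "r \<otimes> a \<in> sat Q J" using s r ideal_mult[OF J s(4) r] by (auto intro: satI)
qed (auto simp: sat_def)

lemma sat_incl: "primeideal Q R \<Longrightarrow> ideal J R \<Longrightarrow> J \<subseteq> sat Q J"
  using prime_one ideal_sub by (auto intro!: satI[of \<one>] simp: subset_iff)

lemma sat_mono: "J \<subseteq> J' \<Longrightarrow> sat Q J \<subseteq> sat Q J'" by (auto simp: sat_def)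

lemma sat_sat: assumes "primeideal Q R" "ideal J R" shows "sat Q (sat Q J) = sat Q J"
proof
  show "sat Q (sat Q J) \<subseteq> sat Q J"
  proof
    fix a assume "a \<in> sat Q (sat Q J)"
    then obtain s where s: "s \<in> carrier R" "s \<notin> Q" "a \<in> carrier R" "s \<otimes> a \<in> sat Q J" by (rule satE)
    then obtain t where t: "t \<in> carrier R" "t \<notin> Q" "t \<otimes> (s \<otimes> a) \<in> J" by (elim satE) 
    show "a \<in> sat Q J"
      using s t prime_notin[OF assms(1), of t s] by (intro satI[of "t \<otimes> s"]) (auto simp: m_assoc)
  qed
qed (rule sat_incl[OF assms(1) sat_ideal[OF assms]])

lemma sat_prime: assumes "primeideal P R" shows "sat P P = P"
proof
  show "sat P P \<subseteq> P" by (auto elim!: satE dest: prime_mult[OF assms])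
qed (rule sat_incl[OF assms prime_ideal[OF assms]])

lemma sat_mem: "sat Q K = K \<Longrightarrow> s \<in> carrier R \<Longrightarrow> s \<notin> Q \<Longrightarrow> a \<in> carrier R \<Longrightarrow> s \<otimes> a \<in> K \<Longrightarrow> a \<in> K"
  by (metis satI)

text \<open>For an ideal \<open>Q\<close> this is the product of \<open>Q\<close> with the ideal
  generated by the list. Keeping the generators in a list lets \<open>nakayama_sat\<close> eliminate
  them one by one.\<close>

fun comb :: "'a set \<Rightarrow> 'a list \<Rightarrow> 'a set" where
  "comb Q [] = {\<zero>}"
| "comb Q (g # gs) = {q \<otimes> g \<oplus> v | q v. q \<in> Q \<and> v \<in> comb Q gs}"

lemma combI: "q \<in> Q \<Longrightarrow> v \<in> comb Q gs \<Longrightarrow> q \<otimes> g \<oplus> v \<in> comb Q (g # gs)"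
  by auto

declare comb.simps(2) [simp del]

lemma combE:
  assumes "a \<in> comb Q (g # gs)" obtains q v where "a = q \<otimes> g \<oplus> v" "q \<in> Q" "v \<in> comb Q gs"
  using assms by (auto simp: comb.simps(2))

lemma comb_ideal:
  assumes "ideal Q R" "set gs \<subseteq> carrier R" shows "ideal (comb Q gs) R"
  using assms(2)
proof (induction gs)
  case Nil then show ?case using zeroideal by simp
next
  case (Cons g gs)
  note Qc = ideal.Icarr[OF assms(1)]
  have I: "ideal (comb Q gs) R" and g: "g \<in> carrier R" using Cons by auto
  note Ic = ideal.Icarr[OF I]
  show ?case
  proof (rule ideal_of_closed)
    show "comb Q (g # gs) \<subseteq> carrier R" using g Qc Ic by (auto elim!: combE)
    show "\<zero> \<in> comb Q (g # gs)" using ideal_zero[OF assms(1)] ideal_zero[OF I] g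
      by (metis combI l_null l_zero zero_closed)
  next
    fix a b assume "a \<in> comb Q (g # gs)" "b \<in> comb Q (g # gs)"
    then obtain q v q' v' where *: "a = q \<otimes> g \<oplus> v" "b = q' \<otimes> g \<oplus> v'" "q \<in> Q" "q' \<in> Q" "v \<in> comb Q gs" "v' \<in> comb Q gs"
      by (metis combE)
    have "a \<oplus> b = (q \<oplus> q') \<otimes> g \<oplus> (v \<oplus> v')" unfolding * using Qc[OF *(3)] Qc[OF *(4)] Ic[OF *(5)] Ic[OF *(6)] g by algebra
    then show "a \<oplus> b \<in> comb Q (g # gs)" using * ideal_add[OF I] ideal_add[OF assms(1)] by (simp add: combI)
  next
    fix r a assume r: "r \<in> carrier R" "a \<in> comb Q (g # gs)"
    then obtain q v where *: "a = q \<otimes> g \<oplus> v" "q \<in> Q" "v \<in> comb Q gs" by (metis combE)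
    have "r \<otimes> a = (r \<otimes> q) \<otimes> g \<oplus> (r \<otimes> v)" unfolding * using Qc[OF *(2)] Ic[OF *(3)] g r(1) by algebra
    then show "r \<otimes> a \<in> comb Q (g # gs)" using * r ideal.I_l_closed[OF I] ideal.I_l_closed[OF assms(1)] by (simp add: combI)
  qed
qed

lemma comb_self:
  assumes "set gs \<subseteq> carrier R" "g \<in> set gs" shows "g \<in> comb (carrier R) gs"
  using assms
proof (induction gs)
  case (Cons h gs)
  then have h: "h \<in> carrier R" "g \<in> carrier R" by auto
  show ?case
  proof (cases "g = h")
    case True
    have "\<zero> \<in> comb (carrier R) gs" using Cons ideal_zero[OF comb_ideal[OF oneideal, of gs]] by auto
    then have "\<one> \<otimes> h \<oplus> \<zero> \<in> comb (carrier R) (h # gs)" by (intro combI) auto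
    then show ?thesis using h True by simp
  next
    case False
    then have "\<zero> \<otimes> h \<oplus> g \<in> comb (carrier R) (h # gs)" using Cons by (intro combI) auto
    then show ?thesis using h by simp
  qed
qed simp

lemma comb_Idl: assumes "set gs \<subseteq> carrier R" shows "Idl (set gs) \<subseteq> comb (carrier R) gs"
  using comb_self comb_ideal[OF oneideal] assms by (intro genideal_minimal) auto

lemma comb_prod:
  assumes "ideal Q R" "set gs \<subseteq> carrier R" "q \<in> Q" "v \<in> comb (carrier R) gs"
  shows "q \<otimes> v \<in> comb Q gs"
  using assms(2,4)
proof (induction gs arbitrary: v)
  case Nil then show ?case using assms ideal.Icarr by fastforce
next
  case (Cons g gs)
  then obtain r w where *: "v = r \<otimes> g \<oplus> w" "r \<in> carrier R" "w \<in> comb (carrier R) gs" by (metis combE)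
  have w: "w \<in> carrier R" using comb_ideal[OF oneideal, of gs] Cons(2) * ideal.Icarr by fastforce
  have "q \<otimes> v = (q \<otimes> r) \<otimes> g \<oplus> q \<otimes> w"
    unfolding * using * Cons(2) w assms(1,3) ideal.Icarr[OF assms(1)] by (auto simp: r_distr m_assoc)
  then show ?case using * Cons assms(1,3) ideal.I_r_closed[OF assms(1)] by (simp add: combI)
qed

lemma comb_subset:
  assumes "ideal K R" "Q \<subseteq> carrier R" "set gs \<subseteq> K" shows "comb Q gs \<subseteq> K"
  using assms(3)
proof (induction gs)
  case Nil then show ?case using ideal_zero[OF assms(1)] by auto
next
  case (Cons g gs)
  show ?case
  proof
    fix a assume "a \<in> comb Q (g # gs)"
    then obtain q v where "a = q \<otimes> g \<oplus> v" "q \<in> Q" "v \<in> comb Q gs" by (rule combE)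
    moreover have "comb Q gs \<subseteq> K" "g \<in> K" using Cons by auto
    ultimately show "a \<in> K" using ideal_add[OF assms(1)] ideal_mult[OF assms(1)] assms(2) by (simp add: subset_iff)
  qed
qed

text \<open>Elements outside \<open>Q\<close> act as units, so the relation of the first generator
  can be solved for it and substituted into the others; induction on the list replaces the usual
  determinant. This is Nakayama's lemma in the localization at \<open>Q\<close>, modulo
  \<open>J\<close>.\<close>

lemma nakayama_sat:
  assumes Q: "primeideal Q R" and J: "ideal J R"
  shows "\<lbrakk>set gs \<subseteq> carrier R;
     \<And>g. g \<in> set gs \<Longrightarrow> \<exists>s \<in> carrier R. s \<notin> Q \<and> (\<exists>j \<in> J. \<exists>v \<in> comb Q gs. s \<otimes> g = j \<oplus> v)\<rbrakk>
   \<Longrightarrow> set gs \<subseteq> sat Q J"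
proof (induction gs)
  case (Cons g gs)
  have Qi: "ideal Q R" using Q prime_ideal by blast
  note Qc = ideal.Icarr[OF Qi] and Jc = ideal.Icarr[OF J]
  have I: "ideal (comb Q gs) R" and g: "g \<in> carrier R" using Cons comb_ideal[OF Qi] by auto
  note Ic = ideal.Icarr[OF I]
  obtain s j q v where s: "s \<in> carrier R" "j \<in> J" "q \<in> Q" "v \<in> comb Q gs" "s \<otimes> g = j \<oplus> (q \<otimes> g \<oplus> v)" "s \<notin> Q"
    using Cons(3)[of g] by (auto elim!: combE)
  have subring_carrier: "s \<in> carrier R" "q \<in> carrier R" using s Qc by auto
  \<comment> \<open>Moving \<open>q \<otimes> g\<close> to the left of the relation leaves the
    coefficient \<open>u\<close>, which is outside \<open>Q\<close> because \<open>s\<close> is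
    outside and \<open>q\<close> is inside.\<close>
  define u where "u = s \<ominus> q"
  have uc: "u \<in> carrier R" using s Qc u_def by auto
  have uQ: "u \<notin> Q"
  proof
    assume "u \<in> Q"
    then have "u \<oplus> q \<in> Q" using s ideal_add[OF Qi] by auto
    moreover have "u \<oplus> q = s" unfolding u_def using subring_carrier by algebra
    ultimately show False using s by auto
  qed
  have "u \<otimes> g = s \<otimes> g \<ominus> q \<otimes> g" unfolding u_def using subring_carrier g by algebra
  also have "\<dots> = (j \<oplus> (q \<otimes> g \<oplus> v)) \<ominus> q \<otimes> g" using s by simp
  also have "\<dots> = j \<oplus> v" using subring_carrier Jc[OF s(2)] Ic[OF s(4)] g by algebra
  finally have ug: "u \<otimes> g = j \<oplus> v" .
  have gs: "set gs \<subseteq> sat Q J"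
  proof (rule Cons.IH)
    show "set gs \<subseteq> carrier R" using Cons by auto
    fix h assume h: "h \<in> set gs"
    then have hc: "h \<in> carrier R" using Cons by auto
    obtain t j' q' v' where t: "t \<in> carrier R" "j' \<in> J" "q' \<in> Q" "v' \<in> comb Q gs" "t \<otimes> h = j' \<oplus> (q' \<otimes> g \<oplus> v')" "t \<notin> Q"
      using Cons(3)[of h] h by (auto elim!: combE)
    \<comment> \<open>After multiplication by \<open>u\<close>, the generator \<open>g\<close>
      occurs only through \<open>u \<otimes> g\<close> and can be replaced by
      \<open>j \<oplus> v\<close>, in which it no longer appears.\<close>
    have "(u \<otimes> t) \<otimes> h = u \<otimes> (j' \<oplus> (q' \<otimes> g \<oplus> v'))" using t uc hc by (simp add: m_assoc)
    also have "\<dots> = u \<otimes> j' \<oplus> q' \<otimes> (u \<otimes> g) \<oplus> u \<otimes> v'"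
      using uc Jc[OF t(2)] Qc[OF t(3)] Ic[OF t(4)] g by algebra
    also have "\<dots> = (u \<otimes> j' \<oplus> q' \<otimes> j) \<oplus> (q' \<otimes> v \<oplus> u \<otimes> v')"
      unfolding ug using uc Jc[OF t(2)] Jc[OF s(2)] Qc[OF t(3)] Ic[OF t(4)] Ic[OF s(4)] by algebra
    finally have "(u \<otimes> t) \<otimes> h = (u \<otimes> j' \<oplus> q' \<otimes> j) \<oplus> (q' \<otimes> v \<oplus> u \<otimes> v')" .
    moreover have "u \<otimes> j' \<oplus> q' \<otimes> j \<in> J" using t s uc Qc by (simp add: ideal_add[OF J] ideal_mult[OF J])
    moreover have "q' \<otimes> v \<oplus> u \<otimes> v' \<in> comb Q gs" using t s uc Qc by (simp add: ideal_add[OF I] ideal_mult[OF I])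
    moreover have "u \<otimes> t \<in> carrier R" "u \<otimes> t \<notin> Q" using t uc uQ prime_notin[OF Q, of u t] by auto
    ultimately show "\<exists>s \<in> carrier R. s \<notin> Q \<and> (\<exists>j \<in> J. \<exists>v \<in> comb Q gs. s \<otimes> h = j \<oplus> v)" by blast
  qed
  have S: "ideal (sat Q J) R" using sat_ideal Q J by blast
  have "v \<in> sat Q J" using comb_subset[OF S _ gs, of Q] s Qc by auto
  then have "u \<otimes> g \<in> sat Q J" using ug s sat_incl[OF Q J] ideal_add[OF S] by auto
  then have "g \<in> sat Q J" using sat_mem[OF sat_sat[OF Q J] uc uQ g] by simp
  then show ?case using gs by auto
qed auto

end

text \<open>If an ideal has no finite generating set, adjoining again and again an element outside
  the ideal generated so far gives a strictly ascending chain.\<close>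

lemma (in ring) noetherian_ring_of_acc:
  assumes acc: "\<And>I::nat \<Rightarrow> 'a set. (\<And>n. ideal (I n) R) \<Longrightarrow> (\<And>n. I n \<subseteq> I (Suc n)) \<Longrightarrow> \<exists>n. \<forall>m\<ge>n. I m = I n"
  shows "noetherian_ring R"
proof (rule noetherian_ringI)
  fix I assume I: "ideal I R"
  show "\<exists>A\<subseteq>carrier R. finite A \<and> I = Idl A"
  proof (rule ccontr)
    assume neg: "\<not> ?thesis"
    have ex: "\<exists>a \<in> I. a \<notin> Idl A" if "finite A" "A \<subseteq> I" for A
    proof (rule ccontr)
      assume "\<not> ?thesis"
      then have "I = Idl A" using genideal_minimal[OF I that(2)] by auto
      moreover have "A \<subseteq> carrier R" using that ideal.Icarr[OF I] by blast
      ultimately show False using neg that by blast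
    qed
    define c where "c A = (SOME a. a \<in> I \<and> a \<notin> Idl A)" for A
    have c: "c A \<in> I \<and> c A \<notin> Idl A" if "finite A" "A \<subseteq> I" for A
      using someI_ex[of "\<lambda>a. a \<in> I \<and> a \<notin> Idl A"] ex[OF that] unfolding c_def by blast
    define F where "F = rec_nat {} (\<lambda>_ A. insert (c A) A)"
    have F: "F 0 = {}" "F (Suc n) = insert (c (F n)) (F n)" for n by (auto simp: F_def)
    have fin: "finite (F n) \<and> F n \<subseteq> I" for n by (induction n) (auto simp: F c)
    then have fc: "F n \<subseteq> carrier R" for n using ideal.Icarr[OF I] by blast
    have "Idl (F n) \<subseteq> Idl (F (Suc n))" for n
      by (rule subset_Idl_subset[OF fc]) (auto simp: F)
    then have "\<exists>n. \<forall>m\<ge>n. Idl (F m) = Idl (F n)"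
      using acc[of "\<lambda>n. Idl (F n)"] genideal_ideal[OF fc] by simp
    then obtain n where *: "\<forall>m\<ge>n. Idl (F m) = Idl (F n)" ..
    have n: "Idl (F (Suc n)) = Idl (F n)" by (rule *[rule_format]) simp
    then have "c (F n) \<in> Idl (F n)"
      using genideal_self[OF fc[of "Suc n"]] F(2)[of n] n by (metis insertI1 subsetD)
    then show False using c[of "F n"] fin[of n] by simp
  qed
qed

section \<open>Chain and maximum conditions on ideals\<close>

context noetherian_ring
begin

lemma acc:
  assumes "\<And>n::nat. ideal (I n) R" "\<And>n. I n \<subseteq> I (Suc n)"
  shows "\<exists>n. \<forall>m\<ge>n. I m = I n"
proof -
  have mono: "I n \<subseteq> I m" if "n \<le> m" for n m using that assms(2) by (rule lift_Suc_mono_le[of I, rotated])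
  have "subset.chain {I. ideal I R} (range I)"
    unfolding subset_chain_def using assms mono by (auto) (meson in_mono linear)
  then have "\<Union> (range I) \<in> range I" by (intro ideal_chain_is_trivial) auto
  then obtain n where "\<Union> (range I) = I n" by auto
  then have "\<forall>m\<ge>n. I m = I n" using mono by blast
  then show ?thesis by blast
qed

lemma maximal_ideal_in_family:
  assumes "F \<noteq> {}" "\<And>I. I \<in> F \<Longrightarrow> ideal I R"
  obtains M where "M \<in> F" "\<And>I. I \<in> F \<Longrightarrow> M \<subseteq> I \<Longrightarrow> I = M"
proof -
  have "\<exists>M\<in>F. \<forall>Y\<in>F. M \<subseteq> Y \<longrightarrow> Y = M"
  proof (rule subset_Zorn_nonempty[OF assms(1)])
    fix C assume C: "C \<noteq> {}" "subset.chain F C"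
    then have "subset.chain {I. ideal I R} C" using assms(2) by (auto simp: subset_chain_def)
    then show "\<Union>C \<in> F" using ideal_chain_is_trivial[OF C(1)] C(2) by (auto simp: subset_chain_def)
  qed
  then show ?thesis using that by blast
qed

end

section \<open>Krull's principal ideal theorem in terms of saturated ideals\<close>

locale noetherian_cring = noetherian_ring + cring

context noetherian_cring
begin

lemma set_add_left_mono: "A \<subseteq> B \<Longrightarrow> A <+>\<^bsub>R\<^esub> C \<subseteq> B <+>\<^bsub>R\<^esub> C"
  by (auto simp: set_add_def')

text \<open>An ideal \<open>P\<close> that is maximal among those containing \<open>I\<close> and
  missing \<open>S\<close> is prime: for \<open>a\<close> and \<open>b\<close> outside
  \<open>P\<close>, both \<open>P + (a)\<close> and \<open>P + (b)\<close> meet \<open>S\<close>,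
  and the product of the two elements found there would be in \<open>P\<close> if
  \<open>a \<otimes> b\<close> were.\<close>

lemma prime_avoiding:
  assumes I: "ideal I R" and S: "S \<subseteq> carrier R" "\<one> \<in> S"
    and mult: "\<And>a b. a \<in> S \<Longrightarrow> b \<in> S \<Longrightarrow> a \<otimes> b \<in> S" and disj: "I \<inter> S = {}"
  obtains P where "primeideal P R" "I \<subseteq> P" "P \<inter> S = {}"
proof -
  obtain P where P: "P \<in> {J. ideal J R \<and> I \<subseteq> J \<and> J \<inter> S = {}}"
      and max: "\<And>J. J \<in> {J. ideal J R \<and> I \<subseteq> J \<and> J \<inter> S = {}} \<Longrightarrow> P \<subseteq> J \<Longrightarrow> J = P"
    by (rule maximal_ideal_in_family[of "{J. ideal J R \<and> I \<subseteq> J \<and> J \<inter> S = {}}"]) (use I disj in auto)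
  have Pi: "ideal P R" using P by simp
  have meets: "\<exists>s \<in> S. \<exists>p \<in> P. \<exists>r \<in> carrier R. s = p \<oplus> r \<otimes> a" if a: "a \<in> carrier R" "a \<notin> P" for a
  proof (rule ccontr)
    assume neg: "\<not> ?thesis"
    let ?J = "P <+>\<^bsub>R\<^esub> PIdl a"
    have J: "ideal ?J R" using add_ideals[OF Pi cgenideal_ideal[OF a(1)]] .
    have "P \<subseteq> ?J" "a \<in> ?J"
      using ideal_sum_upper[OF Pi cgenideal_ideal[OF a(1)]] cgenideal_self[OF a(1)] by auto
    moreover have "?J \<inter> S = {}" using neg by (force simp: set_add_def' cgenideal_def)
    moreover have "I \<subseteq> ?J" using P calculation(1) by auto
    ultimately have "?J = P" by (intro max) (use J in auto)
    then show False using \<open>a \<in> ?J\<close> a by simp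
  qed
  have "primeideal P R"
  proof (rule primeideal_of[OF Pi])
    show "\<one> \<notin> P" using P S by auto
    fix a b assume ab: "a \<in> carrier R" "b \<in> carrier R" "a \<otimes> b \<in> P"
    show "a \<in> P \<or> b \<in> P"
    proof (rule ccontr)
      assume "\<not> ?thesis"
      then obtain p r p' r' where *: "p \<oplus> r \<otimes> a \<in> S" "p' \<oplus> r' \<otimes> b \<in> S" "p \<in> P" "p' \<in> P"
          "r \<in> carrier R" "r' \<in> carrier R"
        using meets[of a] meets[of b] ab by metis
      have pc: "p \<in> carrier R" "p' \<in> carrier R" using * ideal.Icarr[OF Pi] by auto
      have "(p \<oplus> r \<otimes> a) \<otimes> (p' \<oplus> r' \<otimes> b) = (p' \<oplus> r' \<otimes> b) \<otimes> p \<oplus> (r \<otimes> a) \<otimes> p' \<oplus> (r \<otimes> r') \<otimes> (a \<otimes> b)"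
        using pc *(5,6) ab(1,2) by algebra
      also have "\<dots> \<in> P" using * ab pc by (simp add: ideal_add[OF Pi] ideal_mult[OF Pi])
      finally show False using mult[OF *(1,2)] P by auto
    qed
  qed
  then show ?thesis using that P by auto
qed

text \<open>
  A substitute for the statement that \<open>A\<^sub>Q/I\<close> is Artinian if the maximal ideal of \<open>A\<^sub>Q\<close> is nilpotent
  modulo \<open>I\<close>, in which ideals of \<open>A\<^sub>Q\<close> are replaced by \<open>Q\<close>-saturated ideals of \<open>A\<close>.
\<close>
lemma saturated_dcc:
  assumes Q: "primeideal Q R" and I: "ideal I R"
    and nil: "\<And>q. q \<in> Q \<Longrightarrow> \<exists>s \<in> carrier R. s \<notin> Q \<and> (\<exists>N::nat. s \<otimes> q [^] N \<in> I)"
    and K: "\<And>n::nat. ideal (K n) R" "\<And>n. sat Q (K n) = K n" "\<And>n. I \<subseteq> K n" "\<And>n. K (Suc n) \<subseteq> K n"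
  shows "\<exists>n. \<forall>m\<ge>n. K m = K n"
proof (rule ccontr)
  assume contr: "\<not> ?thesis"
  \<comment> \<open>Noetherian induction from above: among the saturated ideals over which some
    descending chain of saturated ideals is not stationary, a maximal one is taken.\<close>
  define bad where "bad M \<longleftrightarrow> (\<exists>K. (\<forall>n::nat. ideal (K n) R \<and> sat Q (K n) = K n \<and> M \<subseteq> K n \<and> K (Suc n) \<subseteq> K n) \<and>
     \<not> (\<exists>n. \<forall>m\<ge>n. K m = K n))" for M
  define F where "F = {M. ideal M R \<and> sat Q M = M \<and> I \<subseteq> M \<and> bad M}"
  have satI': "sat Q I \<subseteq> K n" for n using sat_mono[OF K(3)] K(2) by metis
  have "bad (sat Q I)"
    unfolding bad_def using K(1,2,4) satI' contr by (intro exI[of _ K]) auto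
  then have "sat Q I \<in> F" using sat_ideal[OF Q I] sat_sat[OF Q I] sat_incl[OF Q I] by (simp add: F_def)
  then obtain M where M: "M \<in> F" and max: "\<And>J. J \<in> F \<Longrightarrow> M \<subseteq> J \<Longrightarrow> J = M"
    using maximal_ideal_in_family[of F] by (metis (no_types, lifting) F_def empty_iff mem_Collect_eq)
  have Mi: "ideal M R" and Ms: "sat Q M = M" and IM: "I \<subseteq> M" using M by (auto simp: F_def)
  obtain K where K': "\<And>n::nat. ideal (K n) R" "\<And>n. sat Q (K n) = K n" "\<And>n. M \<subseteq> K n" "\<And>n. K (Suc n) \<subseteq> K n"
    and nK: "\<not> (\<exists>n. \<forall>m\<ge>n. K m = K n)"
    using M unfolding F_def bad_def by blast
  have anti: "K m \<subseteq> K n" if "n \<le> m" for m n using that K'(4) by (rule lift_Suc_antimono_le[of K, rotated])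
  have Qi: "ideal Q R" using prime_ideal[OF Q] .
  have one: "\<one> \<notin> M"
  proof
    assume "\<one> \<in> M"
    then have "K n = carrier R" for n using ideal.one_imp_carrier[OF K'(1)] K'(3) by blast
    then show False using nK by auto
  qed
  obtain A where A: "A \<subseteq> carrier R" "finite A" "Q = Idl A" using finetely_gen[OF Qi] by auto
  have AQ: "A \<subseteq> Q" using A genideal_self by auto
  \<comment> \<open>Search for a socle element modulo \<open>M\<close>. The generators of
    \<open>Q\<close> are treated in turn, each time multiplying \<open>g\<close> by the highest
    power of the generator that keeps it outside \<open>M\<close>.\<close>
  have "\<exists>g \<in> carrier R. g \<notin> M \<and> (\<forall>q\<in>A. q \<otimes> g \<in> M)"
    using A(2) AQ
  proof (induction A)
    case empty then show ?case using one by auto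
  next
    case (insert q A)
    then obtain g where g: "g \<in> carrier R" "g \<notin> M" "\<forall>q\<in>A. q \<otimes> g \<in> M" by auto
    have qQ: "q \<in> Q" and qc: "q \<in> carrier R" using insert ideal.Icarr[OF Qi] by auto
    obtain s N where s: "s \<in> carrier R" "s \<notin> Q" "s \<otimes> q [^] (N::nat) \<in> I" using nil[OF qQ] by auto
    have "q [^] N \<in> M" using sat_mem[OF Ms s(1,2)] s(3) IM qc by auto
    then have ex: "q [^] N \<otimes> g \<in> M" using ideal.I_r_closed[OF Mi] g by auto
    define e where "e = (LEAST e::nat. q [^] e \<otimes> g \<in> M)"
    have e: "q [^] e \<otimes> g \<in> M" unfolding e_def by (rule LeastI[of "\<lambda>e. q [^] e \<otimes> g \<in> M", OF ex])
    have e0: "e \<noteq> 0" using e g by (auto intro: ccontr)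
    then obtain f where f: "e = Suc f" using not0_implies_Suc by auto
    have f': "q [^] f \<otimes> g \<notin> M" using not_less_Least[of f "\<lambda>e. q [^] e \<otimes> g \<in> M"] f unfolding e_def by simp
    have "q \<otimes> (q [^] f \<otimes> g) \<in> M" using e f qc g by (simp add: m_assoc m_comm m_lcomm)
    moreover have "q' \<otimes> (q [^] f \<otimes> g) \<in> M" if "q' \<in> A" for q'
    proof -
      have "q' \<in> carrier R" using insert that ideal.Icarr[OF Qi] by auto
      then have "q' \<otimes> (q [^] f \<otimes> g) = q [^] f \<otimes> (q' \<otimes> g)" using g qc by (simp add: m_lcomm)
      then show ?thesis using g(3) that ideal_mult[OF Mi] qc by auto
    qed
    ultimately show ?case using f' g(1) qc by (intro bexI[of _ "q [^] f \<otimes> g"]) auto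
  qed
  then obtain g where g: "g \<in> carrier R" "g \<notin> M" "\<And>q. q\<in>A \<Longrightarrow> q \<otimes> g \<in> M" by auto
  have Qg: "q \<otimes> g \<in> M" if "q \<in> Q" for q
  proof -
    have "ideal {q \<in> carrier R. q \<otimes> g \<in> M} R"
      using g(1) ideal_zero[OF Mi] ideal_add[OF Mi] ideal_mult[OF Mi]
      by (intro ideal_of_closed) (auto simp: l_distr m_assoc)
    then have "Q \<subseteq> {q \<in> carrier R. q \<otimes> g \<in> M}" unfolding A(3) using A(1) g(3)
      by (intro genideal_minimal) auto
    then show ?thesis using that by auto
  qed
  have Gi: "ideal (PIdl g) R" using cgenideal_ideal[OF g(1)] .
  \<comment> \<open>At \<open>Q\<close> the element \<open>g\<close> spans a one-dimensional space
    over the residue field modulo \<open>M\<close>, so passing from an ideal above \<open>M\<close>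
    to its \<open>L\<close> adds at most one dimension. The chain of the \<open>L (K n)\<close> lies
    over \<open>L M\<close>, which is larger than \<open>M\<close> and hence not bad.\<close>
  define L where "L J = sat Q (J <+>\<^bsub>R\<^esub> PIdl g)" for J
  have Lsum: "ideal (J <+>\<^bsub>R\<^esub> PIdl g) R" if "ideal J R" for J using add_ideals[OF that Gi] .
  have L: "ideal (L J) R" "sat Q (L J) = L J" "J \<subseteq> L J" "g \<in> L J" if J: "ideal J R" for J
  proof -
    note S = sat_incl[OF Q Lsum[OF J]]
    show "ideal (L J) R" "sat Q (L J) = L J" unfolding L_def using sat_ideal[OF Q Lsum[OF J]] sat_sat[OF Q Lsum[OF J]] .
    show "J \<subseteq> L J" "g \<in> L J"
      unfolding L_def using S ideal_sum_upper[OF J Gi] cgenideal_self[OF g(1)] by auto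
  qed
  have LMF: "L M \<notin> F" 
  proof
    assume "L M \<in> F"
    then have "L M = M" using max[OF _ L(3)[OF Mi]] by iprover
    then show False using L(4)[OF Mi] g(2) by simp
  qed
  have nbad: "\<not> bad (L M)"
  proof
    assume "bad (L M)"
    then have "L M \<in> F" unfolding F_def mem_Collect_eq
      by (intro conjI L(1)[OF Mi] L(2)[OF Mi] subset_trans[OF IM L(3)[OF Mi]])
    then show False using LMF by contradiction
  qed
  have LL: "L M \<subseteq> L (K n)" "L (K (Suc n)) \<subseteq> L (K n)" for n
    unfolding L_def by (intro sat_mono set_add_left_mono K'(3,4))+
  have "\<exists>n. \<forall>m\<ge>n. L (K m) = L (K n)"
  proof (rule ccontr)
    assume "\<not> ?thesis"
    then have "bad (L M)" unfolding bad_def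
      using L(1)[OF K'(1)] L(2)[OF K'(1)] LL by (intro exI[of _ "\<lambda>n. L (K n)"] conjI allI)
    then show False using nbad by simp
  qed
  then obtain n0 where n0: "\<And>m. m \<ge> n0 \<Longrightarrow> L (K m) = L (K n0)" by blast
  \<comment> \<open>If \<open>g\<close> were in every \<open>K n\<close>, then
    \<open>L (K n) = K n\<close>, and the chain \<open>K\<close> would become stationary together
    with its image under \<open>L\<close>.\<close>
  have "\<exists>n1. \<forall>n \<ge> n1. g \<notin> K n"
  proof (rule ccontr)
    assume "\<not> ?thesis"
    then have gK: "g \<in> K n" for n using anti by (meson in_mono)
    have "L (K n) = K n" for n
    proof
      have "K n <+>\<^bsub>R\<^esub> PIdl g \<subseteq> K n"
        using subsetD[OF cgenideal_minimal[OF K'(1) gK]] ideal_add[OF K'(1)] by (metis set_addE subsetI)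
      then have "L (K n) \<subseteq> sat Q (K n)" unfolding L_def by (rule sat_mono)
      then show "L (K n) \<subseteq> K n" using K'(2) by simp
    qed (use L K' in auto)
    then show False using nK n0 by metis
  qed
  then obtain n1 where n1: "\<And>n. n \<ge> n1 \<Longrightarrow> g \<notin> K n" by auto
  have "K m = K (max n0 n1)" if m: "m \<ge> max n0 n1" for m
  proof
    show "K m \<subseteq> K (max n0 n1)" using anti m .
    show "K (max n0 n1) \<subseteq> K m"
    proof
      fix a assume a: "a \<in> K (max n0 n1)"
      then have "a \<in> L (K m)" using L(3)[OF K'(1)] n0[of m] n0[of "max n0 n1"] m by auto
      then obtain s where s: "s \<in> carrier R" "s \<notin> Q" "a \<in> carrier R" "s \<otimes> a \<in> K m <+>\<^bsub>R\<^esub> PIdl g"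
        unfolding L_def by (rule satE)
      then obtain b c where b: "b \<in> K m" "c \<in> carrier R" "s \<otimes> a = b \<oplus> c \<otimes> g"
        by (auto simp: set_add_def' cgenideal_def)
      have bc: "b \<in> carrier R" using b ideal.Icarr[OF K'(1)] by auto
      have "c \<otimes> g = s \<otimes> a \<ominus> b" unfolding b(3) using b(2) bc g(1) by algebra
      also have "\<dots> \<in> K (max n0 n1)"
        using b(1) a s(1) anti[OF m] ideal_minus[OF K'(1)] ideal_mult[OF K'(1)] by blast
      finally have cg: "c \<otimes> g \<in> K (max n0 n1)" .
      \<comment> \<open>A coefficient outside \<open>Q\<close> could be cancelled by saturation,
        which would put \<open>g\<close> into \<open>K (max n0 n1)\<close>. A coefficient in
        \<open>Q\<close> sends \<open>g\<close> into \<open>M\<close>, and every \<open>K m\<close>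
        contains \<open>M\<close>.\<close>
      then have "c \<in> Q" using sat_mem[OF K'(2) b(2) _ g(1)] n1 by (meson max.cobounded2)
      then have "c \<otimes> g \<in> K m" using Qg K'(3) by auto
      then have "s \<otimes> a \<in> K m" using b ideal_add[OF K'(1)] by auto
      then show "a \<in> K m" using sat_mem[OF K'(2) s(1,2,3)] by auto
    qed
  qed
  then show False using nK by blast
qed


text \<open>If there is no such prime, \<open>Q\<close> is minimal over \<open>P0 + (x)\<close>, so
  descending chains of \<open>Q\<close>-saturated ideals over \<open>P0 + (x)\<close> become
  stationary. Applied to the symbolic powers of \<open>P1\<close> modulo \<open>P0\<close>, enlarged
  by \<open>x\<close>, this makes two consecutive powers agree by Nakayama at \<open>Q\<close>.
  Nakayama at \<open>P1\<close> then puts such a power into \<open>P0\<close>, against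
  \<open>P0 \<subset> P1\<close>.\<close>

theorem prime_through_element:
  assumes P0: "primeideal P0 R" and P1: "primeideal P1 R" and Q: "primeideal Q R"
    and P01: "P0 \<subset> P1" and PQ: "P1 \<subset> Q" and x: "x \<in> Q"
  obtains P' where "primeideal P' R" "P0 \<subseteq> P'" "x \<in> P'" "P' \<subset> Q"
proof (rule ccontr)
  note concl = that
  assume contr: "\<not> thesis"
  have no: False if "primeideal P' R" "P0 \<subseteq> P'" "x \<in> P'" "P' \<subset> Q" for P'
    using concl[OF that] contr by simp
  have xP1: "x \<notin> P1" using no[OF P1 _ _ PQ] P01 by auto
  note P0i = prime_ideal[OF P0] and P1i = prime_ideal[OF P1] and Qi = prime_ideal[OF Q]
  have xc: "x \<in> carrier R" using ideal.Icarr[OF Qi x] .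
  have Xi: "ideal (PIdl x) R" using cgenideal_ideal[OF xc] .
  define I where "I = P0 <+>\<^bsub>R\<^esub> PIdl x"
  have Ii: "ideal I R" unfolding I_def by (rule add_ideals[OF P0i Xi])
  have PI: "P0 \<subseteq> I" "x \<in> I" unfolding I_def using ideal_sum_upper[OF P0i Xi] cgenideal_self[OF xc] by auto
  \<comment> \<open>Minimality of \<open>Q\<close> over \<open>I\<close>, in the form that
    \<open>Q\<close> is the radical of \<open>I\<close> after localization. Otherwise a prime over
    \<open>I\<close> that misses all \<open>s \<otimes> q [^] N\<close> would be strictly below
    \<open>Q\<close>.\<close>
  have nil: "\<exists>s \<in> carrier R. s \<notin> Q \<and> (\<exists>N::nat. s \<otimes> q [^] N \<in> I)" if q: "q \<in> Q" for q
  proof (rule ccontr)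
    assume neg: "\<not> ?thesis"
    have qc: "q \<in> carrier R" using ideal.Icarr[OF Qi q] .
    define S where "S = {s \<otimes> q [^] N | s N. s \<in> carrier R \<and> s \<notin> Q \<and> (N::nat) = N}"
    have S: "s \<otimes> q [^] N \<in> S" if "s \<in> carrier R" "s \<notin> Q" for s and N :: nat
      using that unfolding S_def by blast
    have "\<one> \<in> S" using S[of \<one> 0] prime_one[OF Q] by simp
    moreover have "a \<otimes> b \<in> S" if "a \<in> S" "b \<in> S" for a b
    proof -
      obtain s N t M where *: "a = s \<otimes> q [^] (N::nat)" "b = t \<otimes> q [^] (M::nat)" "s \<in> carrier R" "s \<notin> Q" "t \<in> carrier R" "t \<notin> Q"
        using \<open>a \<in> S\<close> \<open>b \<in> S\<close> unfolding S_def by blast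
      have "a \<otimes> b = (s \<otimes> t) \<otimes> q [^] (N + M)"
        unfolding *(1,2) nat_pow_mult[OF qc, symmetric] using *(3,5) nat_pow_closed[OF qc, of N] nat_pow_closed[OF qc, of M] by algebra
      then show ?thesis using S[of "s \<otimes> t"] * prime_notin[OF Q, of s t] by simp
    qed
    moreover have "I \<inter> S = {}" using neg unfolding S_def by blast
    moreover have "S \<subseteq> carrier R" using qc unfolding S_def by auto
    ultimately obtain P' where P': "primeideal P' R" "I \<subseteq> P'" "P' \<inter> S = {}"
      using prime_avoiding[OF Ii] by metis
    have "P' \<subseteq> Q"
    proof
      fix s assume s: "s \<in> P'"
      then have subring_carrier: "s \<in> carrier R" using ideal.Icarr[OF prime_ideal[OF P'(1)]] by auto
      show "s \<in> Q" 
      proof (rule ccontr)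
        assume "s \<notin> Q"
        then have "s \<in> S" using S[of s 0] subring_carrier by simp
        then show False using s P' by auto
      qed
    qed
    moreover have "q \<in> S" using S[of \<one> 1] prime_one[OF Q] qc by simp
    then have "q \<notin> P'" using P' by auto
    ultimately have "P' \<subset> Q" using q by auto
    then show False using no[OF P'(1)] P' PI by auto
  qed
  \<comment> \<open>\<open>J n\<close> becomes the n-th symbolic power of \<open>P1\<close> modulo
    \<open>P0\<close>, that is, the contraction of \<open>P1^n + P0\<close> from the localization at
    \<open>P1\<close>.\<close>
  define step where "step J = sat P1 (P1 \<cdot>\<^bsub>R\<^esub> J <+>\<^bsub>R\<^esub> P0)" for J
  define J where "J = rec_nat (carrier R) (\<lambda>_. step)"
  have J0: "J 0 = carrier R" and JS: "J (Suc n) = step (J n)" for n by (auto simp: J_def)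
  have pre: "ideal (P1 \<cdot>\<^bsub>R\<^esub> A <+>\<^bsub>R\<^esub> P0) R" if "ideal A R" for A
    using add_ideals[OF ideal_prod_is_ideal[OF P1i that] P0i] .
  have J: "ideal (J n) R \<and> sat P1 (J n) = J n \<and> P0 \<subseteq> J n" for n
  proof (induction n)
    case 0
    show ?case unfolding J0 using oneideal ideal_sub[OF P0i] prime_one[OF P1] by (auto simp: sat_def)
  next
    case (Suc n)
    then have Ji: "ideal (J n) R" by simp
    have "P0 \<subseteq> J (Suc n)" unfolding JS step_def
      using ideal_sum_upper(2)[OF ideal_prod_is_ideal[OF P1i Ji] P0i] sat_incl[OF P1 pre[OF Ji]] by (rule subset_trans)
    then show ?case unfolding JS step_def using sat_ideal[OF P1 pre[OF Ji]] sat_sat[OF P1 pre[OF Ji]] by simp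
  qed
  have Ji: "ideal (J n) R" and Js: "sat P1 (J n) = J n" and PJ: "P0 \<subseteq> J n" for n using J by auto
  have prod_mono: "P1 \<cdot>\<^bsub>R\<^esub> A \<subseteq> P1 \<cdot>\<^bsub>R\<^esub> B" if "A \<subseteq> B" for A B
  proof
    fix w assume "w \<in> P1 \<cdot>\<^bsub>R\<^esub> A"
    then show "w \<in> P1 \<cdot>\<^bsub>R\<^esub> B" by induction (use that in \<open>auto intro: ideal_prod.intros\<close>)
  qed
  have Jdec: "J (Suc n) \<subseteq> J n" for n
  proof (induction n)
    case 0 show ?case unfolding J0 using ideal_sub[OF Ji] .
  next
    case (Suc n)
    have "P1 \<cdot>\<^bsub>R\<^esub> J (Suc n) <+>\<^bsub>R\<^esub> P0 \<subseteq> P1 \<cdot>\<^bsub>R\<^esub> J n <+>\<^bsub>R\<^esub> P0"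
      by (rule set_add_left_mono[OF prod_mono[OF Suc]])
    then show ?case unfolding JS[of "Suc n"] JS[of n] step_def
      using sat_mono JS[of n] step_def by metis
  qed
  define K where "K n = sat Q (J n <+>\<^bsub>R\<^esub> PIdl x)" for n
  have K: "ideal (K n) R" "sat Q (K n) = K n" "I \<subseteq> K n" "K (Suc n) \<subseteq> K n" "J n \<subseteq> K n" for n
  proof -
    have S: "ideal (J n <+>\<^bsub>R\<^esub> PIdl x) R" using add_ideals[OF Ji Xi] .
    show "ideal (K n) R" "sat Q (K n) = K n" unfolding K_def using sat_ideal[OF Q S] sat_sat[OF Q S] .
    have "I \<subseteq> J n <+>\<^bsub>R\<^esub> PIdl x" unfolding I_def by (rule set_add_left_mono[OF PJ])
    then show "I \<subseteq> K n" unfolding K_def using sat_incl[OF Q S] by auto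
    show "K (Suc n) \<subseteq> K n" unfolding K_def by (intro sat_mono set_add_left_mono Jdec)
    show "J n \<subseteq> K n" unfolding K_def using sat_incl[OF Q S] ideal_sum_upper(1)[OF Ji Xi] by auto
  qed
  have "\<exists>n. \<forall>m\<ge>n. K m = K n" by (rule saturated_dcc[of Q I K]; fact Q Ii nil K)
  then obtain n where "\<forall>m\<ge>n. K m = K n" ..
  from this[rule_format, of "Suc n"] have n: "K (Suc n) = K n" by simp
  obtain A where A: "A \<subseteq> carrier R" "finite A" "J n = Idl A" using finetely_gen[OF Ji[of n]] by blast
  obtain gs where gs: "set gs = A" using finite_list[OF A(2)] by auto
  have gc: "set gs \<subseteq> carrier R" using A gs by simp
  have gJ: "set gs \<subseteq> J n" using A gs genideal_self by simp
  have Jc: "J n \<subseteq> comb (carrier R) gs" using comb_Idl[OF gc] A gs by simp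
  \<comment> \<open>Up to a factor outside \<open>Q\<close>, an element of \<open>J n\<close> is
    some \<open>b\<close> in \<open>J (Suc n)\<close> plus \<open>c \<otimes> x\<close>. As
    \<open>J n\<close> is saturated at \<open>P1\<close> and \<open>x\<close> is outside
    \<open>P1\<close>, also \<open>c\<close> is in \<open>J n\<close>. So \<open>J n\<close> agrees
    at \<open>Q\<close> with \<open>J (Suc n) + x J n\<close>, and Nakayama applies because
    \<open>x\<close> is in \<open>Q\<close>.\<close>
  have "set gs \<subseteq> sat Q (J (Suc n))"
  proof (rule nakayama_sat[OF Q Ji gc])
    fix g assume g: "g \<in> set gs"
    then have "g \<in> K (Suc n)" using gJ K(5) n by auto
    then obtain s where s: "s \<in> carrier R" "s \<notin> Q" "g \<in> carrier R" "s \<otimes> g \<in> J (Suc n) <+>\<^bsub>R\<^esub> PIdl x"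
      unfolding K_def by (rule satE)
    from s(4) obtain b c where b: "b \<in> J (Suc n)" "c \<in> carrier R" "s \<otimes> g = b \<oplus> c \<otimes> x"
      by (auto simp: set_add_def' cgenideal_def)
    have bc: "b \<in> carrier R" using b ideal.Icarr[OF Ji] by auto
    have "x \<otimes> c = s \<otimes> g \<ominus> b" unfolding b(3) using b(2) bc xc by algebra
    also have "\<dots> \<in> J n"
      using b(1) g gJ s(1) Jdec[of n] by (intro ideal_minus[OF Ji] ideal_mult[OF Ji]) auto
    finally have "c \<in> J n" using sat_mem[OF Js xc xP1 b(2)] by simp
    then have "x \<otimes> c \<in> comb Q gs" using comb_prod[OF Qi gc x] Jc by auto
    then have "c \<otimes> x \<in> comb Q gs" using m_comm[OF xc b(2)] by simp
    then show "\<exists>s \<in> carrier R. s \<notin> Q \<and> (\<exists>j \<in> J (Suc n). \<exists>v \<in> comb Q gs. s \<otimes> g = j \<oplus> v)"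
      using s(1,2) b(1,3) by blast
  qed
  also have "sat Q (J (Suc n)) \<subseteq> sat P1 (J (Suc n))" using PQ by (auto simp: sat_def)
  finally have gJS: "set gs \<subseteq> J (Suc n)" using Js by simp
  have cp: "w \<in> comb P1 gs" if "w \<in> P1 \<cdot>\<^bsub>R\<^esub> J n" for w
    using that
  proof induction
    case (prod i j)
    then show ?case using comb_prod[OF P1i gc] Jc by auto
  next
    case (sum a b)
    then show ?case using ideal_add[OF comb_ideal[OF P1i gc]] by simp
  qed
  \<comment> \<open>Now \<open>J n\<close> equals \<open>J (Suc n)\<close>, which at
    \<open>P1\<close> is \<open>P1 J n + P0\<close>; this is the situation of Nakayama at
    \<open>P1\<close>.\<close>
  have "set gs \<subseteq> sat P1 P0"
  proof (rule nakayama_sat[OF P1 P0i gc])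
    fix g assume "g \<in> set gs"
    then have "g \<in> step (J n)" using gJS JS by auto
    then obtain s where s: "s \<in> carrier R" "s \<notin> P1" "g \<in> carrier R" "s \<otimes> g \<in> P1 \<cdot>\<^bsub>R\<^esub> J n <+>\<^bsub>R\<^esub> P0"
      unfolding step_def by (rule satE)
    from s(4) obtain w p where w: "w \<in> P1 \<cdot>\<^bsub>R\<^esub> J n" "p \<in> P0" "s \<otimes> g = w \<oplus> p"
      by (rule set_addE)
    have "w \<in> carrier R" "p \<in> carrier R"
      using w ideal.Icarr[OF P0i] ideal.Icarr[OF ideal_prod_is_ideal[OF P1i Ji]] by auto
    then have "s \<otimes> g = p \<oplus> w" using w(3) a_comm by simp
    then show "\<exists>s \<in> carrier R. s \<notin> P1 \<and> (\<exists>j \<in> P0. \<exists>v \<in> comb P1 gs. s \<otimes> g = j \<oplus> v)"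
      using s(1,2) w(2) cp[OF w(1)] by blast
  qed
  also have "\<dots> \<subseteq> sat P0 P0" using P01 by (auto simp: sat_def)
  finally have "set gs \<subseteq> P0" using sat_prime[OF P0] by simp
  then have JP0: "J n \<subseteq> P0" using A gs genideal_minimal[OF P0i] by simp
  \<comment> \<open>Ordinary powers lie in symbolic ones; with \<open>J n \<subseteq> P0\<close>,
    every element of \<open>P1\<close> has a power in \<open>P0\<close>.\<close>
  have pw: "p [^] k \<in> J k" if p: "p \<in> P1" for p and k :: nat
  proof (induction k)
    case 0 show ?case unfolding J0 using p ideal.Icarr[OF P1i] by simp
  next
    case (Suc k)
    have pc: "p \<in> carrier R" using p ideal.Icarr[OF P1i] by simp
    have "p \<otimes> p [^] k \<in> P1 \<cdot>\<^bsub>R\<^esub> J k" using ideal_prod.prod[OF p Suc] .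
    then have "p \<otimes> p [^] k \<in> J (Suc k)" unfolding JS step_def
      using ideal_sum_upper(1)[OF ideal_prod_is_ideal[OF P1i Ji] P0i] sat_incl[OF P1 pre[OF Ji]] by blast
    then show ?case using pc m_comm by simp
  qed
  have "P1 \<subseteq> P0"
  proof
    fix p assume p: "p \<in> P1"
    then show "p \<in> P0" using pw[OF p, of n] JP0 prime_pow[OF P0, of p n] ideal.Icarr[OF P1i] by auto
  qed
  then show False using P01 by auto
qed

text \<open>Each step replaces the top member of the chain by a prime between \<open>P n\<close> and
  \<open>Q\<close> that contains \<open>x\<close>; that prime takes the role of \<open>Q\<close> for
  the shorter chain. The \<open>n + 2\<close> primes ending in \<open>Q\<close> thus turn into
  \<open>n + 1\<close> primes containing \<open>x\<close>.\<close>

lemma prime_chain_through_element: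
  fixes P :: "nat \<Rightarrow> 'a set"
  assumes "\<And>i. i \<le> n \<Longrightarrow> primeideal (P i) R" "\<And>i. i < n \<Longrightarrow> P i \<subset> P (Suc i)"
    and "primeideal Q R" "P n \<subset> Q" "x \<in> Q"
  shows "\<exists>T. (\<forall>i\<le>n. primeideal (T i) R \<and> x \<in> T i) \<and> (\<forall>i<n. T i \<subset> T (Suc i)) \<and> T n = Q"
  using assms
proof (induction n arbitrary: Q)
  case 0
  then show ?case by (intro exI[of _ "\<lambda>_. Q"]) auto
next
  case (Suc n)
  have pr: "primeideal (P n) R" "primeideal (P (Suc n)) R" "P n \<subset> P (Suc n)" using Suc by auto
  have "\<exists>P'. primeideal P' R \<and> P n \<subset> P' \<and> P' \<subset> Q \<and> x \<in> P'"
  proof (cases "x \<in> P (Suc n)")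
    case True then show ?thesis using pr Suc.prems by blast
  next
    case False
    obtain P' where P': "primeideal P' R" "P n \<subseteq> P'" "x \<in> P'" "P' \<subset> Q"
      by (rule prime_through_element[OF pr(1,2) Suc.prems(3) pr(3) Suc.prems(4,5)])
    moreover have "P n \<noteq> P'" using False pr P' by auto
    ultimately show ?thesis by auto
  qed
  then obtain P' where P': "primeideal P' R" "P n \<subset> P'" "P' \<subset> Q" "x \<in> P'" by auto
  obtain T where T: "\<forall>i\<le>n. primeideal (T i) R \<and> x \<in> T i" "\<forall>i<n. T i \<subset> T (Suc i)" "T n = P'"
    using Suc.IH[OF _ _ P'(1,2,4)] Suc.prems(1,2) by auto
  show ?case
    using T P' Suc.prems by (intro exI[of _ "T(Suc n := Q)"]) (auto simp: le_Suc_eq less_Suc_eq)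
qed

end

section \<open>Hilbert's basis theorem for subrings\<close>

context cring
begin

lemma subring_cring: "subring S R \<Longrightarrow> cring (R\<lparr>carrier := S\<rparr>)"
  using subcring_iff[of S] subcringI' subringE(1) by metis

text \<open>Values at \<open>z\<close> of polynomials over \<open>S\<close> of degree less than
  \<open>n\<close>, not formal polynomials: \<open>z\<close> may satisfy relations over
  \<open>S\<close>, so an element may have several expansions.\<close>

primrec polys :: "'a set \<Rightarrow> 'a \<Rightarrow> nat \<Rightarrow> 'a set" where
  "polys S z 0 = {\<zero>}"
| "polys S z (Suc n) = {s \<otimes> z [^] n \<oplus> v | s v. s \<in> S \<and> v \<in> polys S z n}"

definition adjoin :: "'a set \<Rightarrow> 'a \<Rightarrow> 'a set"
  where "adjoin S z = (\<Union>n. polys S z n)"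

context
  fixes S z assumes S: "subring S R" and z: "z \<in> carrier R"
begin

lemma subring_carrier: "s \<in> S \<Longrightarrow> s \<in> carrier R" using subringE(1)[OF S] by auto

lemma polysI: "s \<in> S \<Longrightarrow> v \<in> polys S z n \<Longrightarrow> s \<otimes> z [^] n \<oplus> v \<in> polys S z (Suc n)"
  by auto

lemma polysE:
  assumes "u \<in> polys S z (Suc n)"
  obtains s v where "s \<in> S" "v \<in> polys S z n" "u = s \<otimes> z [^] n \<oplus> v"
  using assms by auto

lemma polys_carrier: "u \<in> polys S z n \<Longrightarrow> u \<in> carrier R"
proof (induction n arbitrary: u)
  case (Suc n)
  from Suc(2) obtain s v where "s \<in> S" "v \<in> polys S z n" "u = s \<otimes> z [^] n \<oplus> v" by (rule polysE)
  then show ?case using Suc.IH[of v] z subring_carrier[of s] by simp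
qed simp

lemma polys_Suc: "u \<in> polys S z n \<Longrightarrow> u \<in> polys S z (Suc n)"
  using polysI[OF subringE(2)[OF S], of u n] polys_carrier[of u n] z by simp

lemma polys_mono: "n \<le> m \<Longrightarrow> u \<in> polys S z n \<Longrightarrow> u \<in> polys S z m"
  by (induction m rule: dec_induct) (auto intro: polys_Suc simp del: polys.simps)

lemma polys_zero: "\<zero> \<in> polys S z n" using polys_mono[of 0 n] by simp

lemma polys_add: "u \<in> polys S z n \<Longrightarrow> w \<in> polys S z n \<Longrightarrow> u \<oplus> w \<in> polys S z n"
proof (induction n arbitrary: u w)
  case (Suc n)
  from Suc(2) obtain s v where 1: "s \<in> S" "v \<in> polys S z n" "u = s \<otimes> z [^] n \<oplus> v" by (rule polysE)
  from Suc(3) obtain s' v' where 2: "s' \<in> S" "v' \<in> polys S z n" "w = s' \<otimes> z [^] n \<oplus> v'" by (rule polysE)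
  have "u \<oplus> w = (s \<oplus> s') \<otimes> z [^] n \<oplus> (v \<oplus> v')"
    unfolding 1(3) 2(3) using subring_carrier[OF 1(1)] subring_carrier[OF 2(1)] polys_carrier[OF 1(2)] polys_carrier[OF 2(2)] nat_pow_closed[OF z, of n]
    by algebra
  then show ?case using polysI[OF subringE(7)[OF S 1(1) 2(1)] Suc.IH[OF 1(2) 2(2)]] by simp
qed simp

lemma polys_smult: "r \<in> S \<Longrightarrow> u \<in> polys S z n \<Longrightarrow> r \<otimes> u \<in> polys S z n"
proof (induction n arbitrary: u)
  case (Suc n)
  from Suc(3) obtain s v where 1: "s \<in> S" "v \<in> polys S z n" "u = s \<otimes> z [^] n \<oplus> v" by (rule polysE)
  have "r \<otimes> u = (r \<otimes> s) \<otimes> z [^] n \<oplus> r \<otimes> v"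
    unfolding 1(3) using subring_carrier[OF 1(1)] subring_carrier[OF Suc(2)] polys_carrier[OF 1(2)] nat_pow_closed[OF z, of n] by algebra
  then show ?case using polysI[OF subringE(6)[OF S Suc(2) 1(1)] Suc.IH[OF Suc(2) 1(2)]] by simp
qed (use subring_carrier in simp)

lemma polys_zmult: "u \<in> polys S z n \<Longrightarrow> z \<otimes> u \<in> polys S z (Suc n)"
proof (induction n arbitrary: u)
  case 0 then show ?case using polys_zero[of 1] z by simp
next
  case (Suc n)
  from Suc(2) obtain s v where 1: "s \<in> S" "v \<in> polys S z n" "u = s \<otimes> z [^] n \<oplus> v" by (rule polysE)
  have "z \<otimes> u = s \<otimes> z [^] Suc n \<oplus> z \<otimes> v"
    unfolding 1(3) nat_pow_Suc using subring_carrier[OF 1(1)] polys_carrier[OF 1(2)] z nat_pow_closed[OF z, of n] by algebra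
  then show ?case using polysI[OF 1(1) Suc.IH[OF 1(2)]] by simp
qed

lemma polys_powmult: "u \<in> polys S z n \<Longrightarrow> z [^] k \<otimes> u \<in> polys S z (k + n)"
proof (induction k)
  case 0 then show ?case using polys_carrier by simp
next
  case (Suc k)
  have "z [^] Suc k \<otimes> u = z \<otimes> (z [^] k \<otimes> u)"
    unfolding nat_pow_Suc using z polys_carrier[OF Suc(2)] nat_pow_closed[OF z, of k] by algebra
  then show ?case using polys_zmult[OF Suc.IH[OF Suc(2)]] by simp
qed

lemma polys_mult: "u \<in> polys S z n \<Longrightarrow> w \<in> polys S z m \<Longrightarrow> u \<otimes> w \<in> polys S z (n + m)"
proof (induction n arbitrary: u)
  case 0 then show ?case using polys_zero polys_carrier[OF 0(2)] by simp
next
  case (Suc n)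
  from Suc(2) obtain s v where 1: "s \<in> S" "v \<in> polys S z n" "u = s \<otimes> z [^] n \<oplus> v" by (rule polysE)
  have "u \<otimes> w = s \<otimes> (z [^] n \<otimes> w) \<oplus> v \<otimes> w"
    unfolding 1(3) using subring_carrier[OF 1(1)] polys_carrier[OF 1(2)] polys_carrier[OF Suc(3)] nat_pow_closed[OF z, of n] by algebra
  moreover have "s \<otimes> (z [^] n \<otimes> w) \<in> polys S z (Suc n + m)" "v \<otimes> w \<in> polys S z (Suc n + m)"
    using polys_Suc[OF polys_smult[OF 1(1) polys_powmult[OF Suc(3)]], of n] polys_Suc[OF Suc.IH[OF 1(2) Suc(3)]]
    by (simp_all del: polys.simps)
  ultimately show ?case using polys_add by (simp del: polys.simps)
qed

lemma adjoinI: "u \<in> polys S z n \<Longrightarrow> u \<in> adjoin S z" by (auto simp: adjoin_def)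

lemma adjoinE: assumes "u \<in> adjoin S z" obtains n where "u \<in> polys S z n"
  using assms by (auto simp: adjoin_def)

lemma adjoin_incl: "s \<in> S \<Longrightarrow> s \<in> adjoin S z"
  using polysI[of s \<zero> 0] subring_carrier[of s] by (intro adjoinI[of _ "Suc 0"]) simp

lemma adjoin_gen: "z \<in> adjoin S z"
proof -
  have "\<one> \<in> polys S z 1" using polysI[OF subringE(3)[OF S], of \<zero> 0] by simp
  then show ?thesis using polys_zmult[of \<one> 1] z adjoinI by (metis r_one)
qed

lemma adjoin_subring: "subring (adjoin S z) R"
proof (rule subringI)
  show "adjoin S z \<subseteq> carrier R" by (auto elim!: adjoinE intro: polys_carrier)
  show "\<one> \<in> adjoin S z" using adjoin_incl subringE(3)[OF S] .
next
  fix u assume "u \<in> adjoin S z"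
  then obtain n where n: "u \<in> polys S z n" by (rule adjoinE)
  have "\<ominus> \<one> \<in> S" using subringE(3,5)[OF S] by blast
  then have "\<ominus> \<one> \<otimes> u \<in> polys S z n" using polys_smult n by simp
  then show "\<ominus> u \<in> adjoin S z" using polys_carrier[OF n] by (metis adjoinI l_minus l_one one_closed)
next
  fix u w assume "u \<in> adjoin S z" "w \<in> adjoin S z"
  then obtain n m where nm: "u \<in> polys S z n" "w \<in> polys S z m" by (metis adjoinE)
  show "u \<otimes> w \<in> adjoin S z" using polys_mult[OF nm] by (rule adjoinI)
  show "u \<oplus> w \<in> adjoin S z"
    using polys_add[of u "max n m" w] polys_mono[OF _ nm(1)] polys_mono[OF _ nm(2)] adjoinI by simp
qed

text \<open>Hilbert's argument works for values of polynomials too: of two nested ideals, the larger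
  equals the smaller if their leading coefficients form the same ideals of \<open>S\<close> in every
  degree. These ideals grow with the given ideal and with the degree, so they stabilize in all
  degrees at once.\<close>

lemma adjoin_noetherian:
  assumes noeth: "noetherian_ring (R\<lparr>carrier := S\<rparr>)"
  shows "noetherian_ring (R\<lparr>carrier := adjoin S z\<rparr>)"
proof -
  let ?T = "adjoin S z"
  interpret SR: noetherian_ring "R\<lparr>carrier := S\<rparr>" by fact
  interpret SC: cring "R\<lparr>carrier := S\<rparr>" using subring_cring[OF S] .
  interpret T: cring "R\<lparr>carrier := ?T\<rparr>" using subring_cring[OF adjoin_subring] .
  have Tc: "u \<in> ?T \<Longrightarrow> u \<in> carrier R" for u using subringE(1)[OF adjoin_subring] by auto
  have Tadd: "a \<oplus> b \<in> I" if "ideal I (R\<lparr>carrier := ?T\<rparr>)" "a \<in> I" "b \<in> I" for I a b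
    using T.ideal_add[OF that] by simp
  have Tmul: "r \<otimes> a \<in> I" if "ideal I (R\<lparr>carrier := ?T\<rparr>)" "a \<in> I" "r \<in> ?T" for I a r
    using T.ideal_mult[OF that(1,2)] that(3) by simp
  have Tzero: "\<zero> \<in> I" if "ideal I (R\<lparr>carrier := ?T\<rparr>)" for I
    using T.ideal_zero[OF that] by simp
  have Tsub: "I \<subseteq> ?T" if "ideal I (R\<lparr>carrier := ?T\<rparr>)" for I
    using T.ideal_sub[OF that] by simp
  have Tmin: "a \<ominus> b \<in> I" if I: "ideal I (R\<lparr>carrier := ?T\<rparr>)" and ab: "a \<in> I" "b \<in> I" for I a b
  proof -
    have m1: "\<ominus> \<one> \<in> ?T" using subringE(3,5)[OF adjoin_subring] by blast
    have "a \<oplus> (\<ominus> \<one>) \<otimes> b \<in> I" by (rule Tadd[OF I ab(1) Tmul[OF I ab(2) m1]])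
    moreover have "a \<in> carrier R" "b \<in> carrier R" using Tc Tsub[OF I] ab by auto
    ultimately show ?thesis by (simp add: l_minus a_minus_def)
  qed
  \<comment> \<open>Leading coefficients are taken over all expansions of elements of
    \<open>I\<close>, since the element alone does not determine its leading term.\<close>
  define lc where "lc I n = {s \<in> S. \<exists>v \<in> polys S z n. s \<otimes> z [^] n \<oplus> v \<in> I}" for I n
  have lcI: "s \<in> lc I n" if "s \<in> S" "v \<in> polys S z n" "s \<otimes> z [^] n \<oplus> v \<in> I" for s v n I
    using that unfolding lc_def by blast
  have lcE: "\<exists>v. s \<in> S \<and> v \<in> polys S z n \<and> s \<otimes> z [^] n \<oplus> v \<in> I" if "s \<in> lc I n" for s n I
    using that unfolding lc_def by blast
  have lc_ideal: "ideal (lc I n) (R\<lparr>carrier := S\<rparr>)" if I: "ideal I (R\<lparr>carrier := ?T\<rparr>)" for I n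
  proof (rule SC.ideal_of_closed)
    show "lc I n \<subseteq> carrier (R\<lparr>carrier := S\<rparr>)" by (auto simp: lc_def)
    show "\<zero>\<^bsub>R\<lparr>carrier := S\<rparr>\<^esub> \<in> lc I n"
      using lcI[OF subringE(2)[OF S] polys_zero, of n I] Tzero[OF I] z by simp
  next
    fix a b assume "a \<in> lc I n" "b \<in> lc I n"
    then obtain v w where *: "a \<in> S" "v \<in> polys S z n" "a \<otimes> z [^] n \<oplus> v \<in> I"
      "b \<in> S" "w \<in> polys S z n" "b \<otimes> z [^] n \<oplus> w \<in> I" using lcE by metis
    have "(a \<otimes> z [^] n \<oplus> v) \<oplus> (b \<otimes> z [^] n \<oplus> w) = (a \<oplus> b) \<otimes> z [^] n \<oplus> (v \<oplus> w)"
      using subring_carrier[OF *(1)] subring_carrier[OF *(4)] polys_carrier[OF *(2)] polys_carrier[OF *(5)] nat_pow_closed[OF z, of n] by algebra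
    then have "(a \<oplus> b) \<otimes> z [^] n \<oplus> (v \<oplus> w) \<in> I" using Tadd[OF I *(3,6)] by simp
    from lcI[OF subringE(7)[OF S *(1,4)] polys_add[OF *(2,5)] this]
    show "a \<oplus>\<^bsub>R\<lparr>carrier := S\<rparr>\<^esub> b \<in> lc I n" by simp
  next
    fix r a assume r: "r \<in> carrier (R\<lparr>carrier := S\<rparr>)" and a: "a \<in> lc I n"
    have rS: "r \<in> S" using r by simp
    obtain v where *: "a \<in> S" "v \<in> polys S z n" "a \<otimes> z [^] n \<oplus> v \<in> I" using lcE[OF a] by auto
    have "r \<otimes> (a \<otimes> z [^] n \<oplus> v) = (r \<otimes> a) \<otimes> z [^] n \<oplus> r \<otimes> v"
      using subring_carrier[OF *(1)] subring_carrier[OF rS] polys_carrier[OF *(2)] nat_pow_closed[OF z, of n] by algebra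
    then have "(r \<otimes> a) \<otimes> z [^] n \<oplus> r \<otimes> v \<in> I" using Tmul[OF I *(3) adjoin_incl[OF rS]] by simp
    from lcI[OF subringE(6)[OF S rS *(1)] polys_smult[OF rS *(2)] this]
    show "r \<otimes>\<^bsub>R\<lparr>carrier := S\<rparr>\<^esub> a \<in> lc I n" by simp
  qed
  have lc_Suc: "lc I n \<subseteq> lc I (Suc n)" if I: "ideal I (R\<lparr>carrier := ?T\<rparr>)" for I n
  proof
    fix a assume a: "a \<in> lc I n"
    obtain v where *: "a \<in> S" "v \<in> polys S z n" "a \<otimes> z [^] n \<oplus> v \<in> I" using lcE[OF a] by auto
    have "z \<otimes> (a \<otimes> z [^] n \<oplus> v) = a \<otimes> z [^] Suc n \<oplus> z \<otimes> v"
      unfolding nat_pow_Suc using subring_carrier[OF *(1)] polys_carrier[OF *(2)] z nat_pow_closed[OF z, of n] by algebra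
    then have "a \<otimes> z [^] Suc n \<oplus> z \<otimes> v \<in> I" using Tmul[OF I *(3) adjoin_gen] by simp
    from lcI[OF *(1) polys_zmult[OF *(2)] this] show "a \<in> lc I (Suc n)" .
  qed
  have lc_le: "lc I n \<subseteq> lc I m" if I: "ideal I (R\<lparr>carrier := ?T\<rparr>)" "n \<le> m" for I n m
    using that(2) by (induction m rule: dec_induct) (use lc_Suc[OF I(1)] in auto)
  have lc_mono: "lc I n \<subseteq> lc J n" if "I \<subseteq> J" for I J n using that by (auto simp: lc_def)
  show ?thesis
  proof (rule T.noetherian_ring_of_acc)
    fix I :: "nat \<Rightarrow> 'a set"
    assume I: "\<And>n. ideal (I n) (R\<lparr>carrier := ?T\<rparr>)" and inc: "\<And>n. I n \<subseteq> I (Suc n)"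
    have Imono: "I n \<subseteq> I m" if "n \<le> m" for n m using that inc by (rule lift_Suc_mono_le[of I, rotated])
    \<comment> \<open>The diagonal takes care of all degrees from \<open>N\<close> on; the finitely
      many lower degrees get bounds \<open>k n\<close> of their own.\<close>
    have "\<exists>n. \<forall>m\<ge>n. lc (I m) m = lc (I n) n"
      using lc_mono[OF inc] lc_Suc[OF I] by (intro SR.acc lc_ideal[OF I]) blast
    then obtain N where N: "\<And>m. m \<ge> N \<Longrightarrow> lc (I m) m = lc (I N) N" by blast
    have "\<exists>k. \<forall>m\<ge>k. lc (I m) n = lc (I k) n" for n
      by (intro SR.acc lc_ideal[OF I] lc_mono[OF inc])
    then obtain k where k: "\<And>n m. m \<ge> k n \<Longrightarrow> lc (I m) n = lc (I (k n)) n" by metis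
    define M where "M = max N (Max (k ` {..N}))"
    have kM: "k n \<le> M" if "n \<le> N" for n
      unfolding M_def using that by (intro max.coboundedI2 Max_ge) auto
    have same: "lc (I m) n = lc (I M) n" if m: "m \<ge> M" for m n
    proof (cases "n \<le> N")
      case True
      then show ?thesis using k[of n m] k[of n M] kM m by (metis le_trans)
    next
      case False
      \<comment> \<open>In degrees above \<open>N\<close> the ideal is squeezed between
        \<open>lc (I N) N\<close> and a later diagonal term, which is the same.\<close>
      have "lc (I j) n = lc (I N) N" if j: "j \<ge> N" for j
      proof
        have "lc (I j) n \<subseteq> lc (I (max j n)) (max j n)"
          using lc_mono[OF Imono[of j "max j n"]] lc_le[OF I, of n "max j n"] by (meson max.cobounded1 max.cobounded2 subset_trans)
        then show "lc (I j) n \<subseteq> lc (I N) N" using N[of "max j n"] j by simp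
        show "lc (I N) N \<subseteq> lc (I j) n"
          using lc_mono[OF Imono[OF j]] lc_le[OF I, of N n] False by (meson nat_le_linear subset_trans)
      qed
      from this[of m] this[of M] show ?thesis using m by (simp add: M_def)
    qed
    have "I m = I M" if m: "m \<ge> M" for m
    proof
      \<comment> \<open>Induction on the degree: subtracting an element of \<open>I M\<close> with
        the same leading coefficient shortens the expansion of \<open>u\<close>.\<close>
      have "u \<in> I M" if "u \<in> polys S z n" "u \<in> I m" for u n
        using that
      proof (induction n arbitrary: u)
        case 0 then show ?case using Tzero[OF I] by simp
      next
        case (Suc n)
        from Suc(2) obtain s v where 1: "s \<in> S" "v \<in> polys S z n" "u = s \<otimes> z [^] n \<oplus> v" by (rule polysE)
        have "s \<in> lc (I m) n" using lcI[OF 1(1,2)] Suc(3) 1(3) by simp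
        then have "s \<in> lc (I M) n" using same[OF m] by simp
        then obtain w where w: "w \<in> polys S z n" "s \<otimes> z [^] n \<oplus> w \<in> I M" using lcE by blast
        have wm: "s \<otimes> z [^] n \<oplus> w \<in> I m" using w Imono[OF m] by auto
        have diff: "u \<ominus> (s \<otimes> z [^] n \<oplus> w) = v \<ominus> w"
          unfolding 1(3) using subring_carrier[OF 1(1)] polys_carrier[OF 1(2)] polys_carrier[OF w(1)] nat_pow_closed[OF z, of n] by algebra
        have "\<ominus> \<one> \<in> S" using subringE(3,5)[OF S] by blast
        then have "v \<oplus> (\<ominus> \<one>) \<otimes> w \<in> polys S z n" using polys_add[OF 1(2) polys_smult[OF _ w(1)]] by simp
        then have "v \<ominus> w \<in> polys S z n" using polys_carrier[OF w(1)] by (simp add: l_minus a_minus_def)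
        moreover have "v \<ominus> w \<in> I m" using Tmin[OF I Suc(3) wm] diff by simp
        ultimately have "v \<ominus> w \<in> I M" using Suc.IH by simp
        then have "(v \<ominus> w) \<oplus> (s \<otimes> z [^] n \<oplus> w) \<in> I M" using Tadd[OF I _ w(2)] by simp
        moreover have "(v \<ominus> w) \<oplus> (s \<otimes> z [^] n \<oplus> w) = u"
          unfolding 1(3) using subring_carrier[OF 1(1)] polys_carrier[OF 1(2)] polys_carrier[OF w(1)] nat_pow_closed[OF z, of n] by algebra
        ultimately show ?case by simp
      qed
      then show "I m \<subseteq> I M" using Tsub[OF I] by (metis adjoinE subset_iff)
      show "I M \<subseteq> I m" using Imono[OF m] .
    qed
    then show "\<exists>n. \<forall>m\<ge>n. I m = I n" by blast
  qed
qed

end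

end

section \<open>Group rings\<close>

text \<open>Since the indices form a group, \<open>k - i\<close> is the only index that completes
  \<open>i\<close> to \<open>k\<close>; the convolution is therefore one sum over the finite support
  of \<open>f\<close>.\<close>

definition group_ring :: "('a, 'b) ring_scheme \<Rightarrow> ('i::ab_group_add \<Rightarrow> 'a) ring"
  where "group_ring A =
    \<lparr>carrier = {f. (\<forall>i. f i \<in> carrier A) \<and> finite {i. f i \<noteq> \<zero>\<^bsub>A\<^esub>}},
     monoid.mult = (\<lambda>f g k. finsum A (\<lambda>i. f i \<otimes>\<^bsub>A\<^esub> g (k - i)) {i. f i \<noteq> \<zero>\<^bsub>A\<^esub>}),
     monoid.one = (\<lambda>i. if i = 0 then \<one>\<^bsub>A\<^esub> else \<zero>\<^bsub>A\<^esub>),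
     ring.zero = (\<lambda>_. \<zero>\<^bsub>A\<^esub>),
     ring.add = (\<lambda>f g i. f i \<oplus>\<^bsub>A\<^esub> g i)\<rparr>"

definition gmon :: "('a, 'b) ring_scheme \<Rightarrow> 'i \<Rightarrow> 'a \<Rightarrow> 'i \<Rightarrow> 'a"
  where "gmon A k a = (\<lambda>i. if i = k then a else \<zero>\<^bsub>A\<^esub>)"

text \<open>Over an infinite \<open>T\<close> the sum is \<zero> by convention and so in
  \<open>S\<close>; finiteness of \<open>T\<close> then does not have to be tracked.\<close>

lemma (in abelian_monoid) finsum_in:
  assumes "\<zero> \<in> S" "\<And>a b. a \<in> S \<Longrightarrow> b \<in> S \<Longrightarrow> a \<oplus> b \<in> S" "S \<subseteq> carrier G" "\<And>i. i \<in> T \<Longrightarrow> f i \<in> S"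
  shows "finsum G f T \<in> S"
proof (cases "finite T")
  case True
  then show ?thesis using assms(4)
  proof (induction T)
    case (insert i T)
    then have "f \<in> T \<rightarrow> carrier G" "f i \<in> carrier G" using assms(3) by auto
    then show ?case using insert assms(2) by (simp add: finsum_insert)
  qed (use assms(1) in simp)
qed (use assms(1) in \<open>simp add: finsum_infinite\<close>)

lemma (in abelian_monoid) finsum_superset:
  assumes "finite T" "S \<subseteq> T" "\<And>i. i \<in> S \<Longrightarrow> f i \<in> carrier G" "\<And>i. i \<in> T - S \<Longrightarrow> f i = \<zero>"
  shows "finsum G f T = finsum G f S"
proof -
  have "i \<in> T \<Longrightarrow> f i \<in> carrier G" for i using assms(3,4)[of i] by (cases "i \<in> S") auto
  then show ?thesis using assms by (intro add.finprod_mono_neutral_cong_right) auto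
qed

lemma (in abelian_monoid) finsum_one_term:
  assumes "finite T" "k \<in> T" "f k \<in> carrier G" "\<And>i. i \<in> T \<Longrightarrow> i \<noteq> k \<Longrightarrow> f i = \<zero>"
  shows "finsum G f T = f k"
  using finsum_superset[of T "{k}" f] assms by (auto simp: finsum_insert)

context cring
begin

abbreviation gring :: "('i::ab_group_add \<Rightarrow> 'a) ring" where "gring \<equiv> group_ring R"

lemma gring_carrier: "f \<in> carrier gring \<longleftrightarrow> (\<forall>i. f i \<in> carrier R) \<and> finite {i. f i \<noteq> \<zero>}"
  and gring_add: "f \<oplus>\<^bsub>gring\<^esub> g = (\<lambda>i. f i \<oplus> g i)"
  and gring_zero: "\<zero>\<^bsub>gring\<^esub> = (\<lambda>_. \<zero>)"
  and gring_one: "\<one>\<^bsub>gring\<^esub> = gmon R 0 \<one>"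
  by (simp_all add: group_ring_def gmon_def)

lemma gring_memD: "f \<in> carrier gring \<Longrightarrow> f i \<in> carrier R" "f \<in> carrier gring \<Longrightarrow> finite {i. f i \<noteq> \<zero>}"
  by (simp_all add: gring_carrier)

text \<open>Terms outside the support of \<open>f\<close> vanish. Products with different left
  factors can thus be summed over one common \<open>T\<close>, which is how distributivity is
  obtained.\<close>

lemma gring_mult:
  assumes "f \<in> carrier gring" "g \<in> carrier gring" "finite T" "{i. f i \<noteq> \<zero>} \<subseteq> T"
  shows "(f \<otimes>\<^bsub>gring\<^esub> g) k = (\<Oplus>i\<in>T. f i \<otimes> g (k - i))"
proof -
  have "(\<Oplus>i\<in>T. f i \<otimes> g (k - i)) = (\<Oplus>i\<in>{i. f i \<noteq> \<zero>}. f i \<otimes> g (k - i))"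
    using assms gring_memD[OF assms(1)] gring_memD[OF assms(2)] by (intro finsum_superset) auto
  then show ?thesis by (simp add: group_ring_def)
qed

lemma gring_mult_closed:
  assumes "f \<in> carrier gring" "g \<in> carrier gring"
  shows "f \<otimes>\<^bsub>gring\<^esub> g \<in> carrier gring"
proof -
  let ?F = "{i. f i \<noteq> \<zero>}" and ?G = "{i. g i \<noteq> \<zero>}"
  note f = gring_memD[OF assms(1)] and g = gring_memD[OF assms(2)]
  have eq: "(f \<otimes>\<^bsub>gring\<^esub> g) k = (\<Oplus>i\<in>?F. f i \<otimes> g (k - i))" for k
    using gring_mult[OF assms f(2) order_refl] .
  have "(f \<otimes>\<^bsub>gring\<^esub> g) k \<in> carrier R" for k unfolding eq using f g by (intro finsum_closed) auto
  moreover have "{k. (f \<otimes>\<^bsub>gring\<^esub> g) k \<noteq> \<zero>} \<subseteq> (\<lambda>(i, j). i + j) ` (?F \<times> ?G)"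
  proof
    fix k assume k: "k \<in> {k. (f \<otimes>\<^bsub>gring\<^esub> g) k \<noteq> \<zero>}"
    show "k \<in> (\<lambda>(i, j). i + j) ` (?F \<times> ?G)"
    proof (rule ccontr)
      assume no: "k \<notin> (\<lambda>(i, j). i + j) ` (?F \<times> ?G)"
      have "f i \<otimes> g (k - i) \<in> {\<zero>}" if "i \<in> ?F" for i
      proof -
        have "k - i \<notin> ?G" using no that by (force simp: image_iff)
        then show ?thesis using f by simp
      qed
      then have "(\<Oplus>i\<in>?F. f i \<otimes> g (k - i)) \<in> {\<zero>}" by (intro finsum_in) auto
      then show False using k eq by simp
    qed
  qed
  then have "finite {k. (f \<otimes>\<^bsub>gring\<^esub> g) k \<noteq> \<zero>}" by (rule finite_subset) (use f g in simp)
  ultimately show ?thesis by (simp add: gring_carrier)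
qed

lemma gring_add_closed:
  assumes "f \<in> carrier gring" "g \<in> carrier gring" shows "f \<oplus>\<^bsub>gring\<^esub> g \<in> carrier gring"
proof -
  have "finite {i. f i \<oplus> g i \<noteq> \<zero>}"
    by (rule finite_subset[of _ "{i. f i \<noteq> \<zero>} \<union> {i. g i \<noteq> \<zero>}"]) (use assms in \<open>auto simp: gring_carrier\<close>)
  then show ?thesis using assms by (simp add: gring_carrier gring_add)
qed

lemma gmon_closed: "a \<in> carrier R \<Longrightarrow> gmon R k a \<in> carrier gring"
proof -
  assume "a \<in> carrier R"
  moreover have "finite {i. gmon R k a i \<noteq> \<zero>}" by (rule finite_subset[of _ "{k}"]) (auto simp: gmon_def)
  ultimately show ?thesis by (simp add: gring_carrier gmon_def)
qed

lemma gring_zero_closed: "\<zero>\<^bsub>gring\<^esub> \<in> carrier gring" by (simp add: gring_carrier gring_zero)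

lemma gring_one_closed: "\<one>\<^bsub>gring\<^esub> \<in> carrier gring" by (simp add: gring_one gmon_closed)

lemma gring_distr:
  assumes "f \<in> carrier gring" "g \<in> carrier gring" "h \<in> carrier gring"
  shows "f \<otimes>\<^bsub>gring\<^esub> (g \<oplus>\<^bsub>gring\<^esub> h) = f \<otimes>\<^bsub>gring\<^esub> g \<oplus>\<^bsub>gring\<^esub> f \<otimes>\<^bsub>gring\<^esub> h" (is ?l)
    and "(f \<oplus>\<^bsub>gring\<^esub> g) \<otimes>\<^bsub>gring\<^esub> h = f \<otimes>\<^bsub>gring\<^esub> h \<oplus>\<^bsub>gring\<^esub> g \<otimes>\<^bsub>gring\<^esub> h" (is ?r)
proof -
  note mem = gring_memD[OF assms(1)] gring_memD[OF assms(2)] gring_memD[OF assms(3)]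
  let ?T = "{i. f i \<noteq> \<zero>} \<union> {i. g i \<noteq> \<zero>}"
  have T: "finite ?T" using mem by simp
  have fT: "{i. f i \<noteq> \<zero>} \<subseteq> ?T" and gT: "{i. g i \<noteq> \<zero>} \<subseteq> ?T" by auto
  have sT: "{i. (f \<oplus>\<^bsub>gring\<^esub> g) i \<noteq> \<zero>} \<subseteq> ?T" by (auto simp: gring_add)
  show ?l
  proof
    fix k
    show "(f \<otimes>\<^bsub>gring\<^esub> (g \<oplus>\<^bsub>gring\<^esub> h)) k = (f \<otimes>\<^bsub>gring\<^esub> g \<oplus>\<^bsub>gring\<^esub> f \<otimes>\<^bsub>gring\<^esub> h) k"
      unfolding gring_mult[OF assms(1) gring_add_closed[OF assms(2,3)] T fT]
        gring_add[of "f \<otimes>\<^bsub>gring\<^esub> g"] gring_mult[OF assms(1,2) T fT] gring_mult[OF assms(1,3) T fT]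
      using mem by (subst finsum_addf[symmetric]) (auto simp: gring_add r_distr intro!: finsum_cong')
  qed
  show ?r
  proof
    fix k
    show "((f \<oplus>\<^bsub>gring\<^esub> g) \<otimes>\<^bsub>gring\<^esub> h) k = (f \<otimes>\<^bsub>gring\<^esub> h \<oplus>\<^bsub>gring\<^esub> g \<otimes>\<^bsub>gring\<^esub> h) k"
      unfolding gring_mult[OF gring_add_closed[OF assms(1,2)] assms(3) T sT]
        gring_add[of "f \<otimes>\<^bsub>gring\<^esub> h"] gring_mult[OF assms(1,3) T fT] gring_mult[OF assms(2,3) T gT]
      using mem by (subst finsum_addf[symmetric]) (auto simp: gring_add l_distr intro!: finsum_cong')
  qed
qed

text \<open>The function is built up from its own monomials: each added coefficient is
  \<open>f k\<close>, so properties of the coefficients of \<open>f\<close> are at hand in the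
  induction step.\<close>

lemma gring_induct [consumes 1, case_names zero add]:
  assumes f: "f \<in> carrier gring" and zero: "P \<zero>\<^bsub>gring\<^esub>"
    and add: "\<And>g k. g \<in> carrier gring \<Longrightarrow> P g \<Longrightarrow> P (gmon R k (f k) \<oplus>\<^bsub>gring\<^esub> g)"
  shows "P f"
proof -
  note mem = gring_memD[OF f]
  have "P (\<lambda>i. if i \<in> T then f i else \<zero>)" if "finite T" for T
    using that
  proof (induction T)
    case empty then show ?case using zero by (simp add: gring_zero)
  next
    case (insert k T)
    let ?g = "\<lambda>i. if i \<in> T then f i else \<zero>"
    have "finite {i. ?g i \<noteq> \<zero>}" by (rule finite_subset[OF _ mem(2)]) auto
    then have "?g \<in> carrier gring" using mem by (simp add: gring_carrier)
    from add[OF this insert.IH, of k] have "P (gmon R k (f k) \<oplus>\<^bsub>gring\<^esub> ?g)" .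
    moreover have "gmon R k (f k) \<oplus>\<^bsub>gring\<^esub> ?g = (\<lambda>i. if i \<in> insert k T then f i else \<zero>)"
      using insert mem by (auto simp: gring_add gmon_def)
    ultimately show ?case by simp
  qed
  note P = this[OF mem(2)]
  have "(\<lambda>i. if i \<in> {i. f i \<noteq> \<zero>} then f i else \<zero>) = f" by (rule ext) auto
  then show ?thesis using P by (simp only:)
qed

lemma gring_induct' [consumes 1, case_names zero add]:
  assumes "f \<in> carrier gring" "P \<zero>\<^bsub>gring\<^esub>"
    "\<And>g k a. g \<in> carrier gring \<Longrightarrow> a \<in> carrier R \<Longrightarrow> P g \<Longrightarrow> P (gmon R k a \<oplus>\<^bsub>gring\<^esub> g)"
  shows "P f"
  using assms(1)
proof (induction rule: gring_induct)
  case zero show ?case by fact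
next
  case (add g k) then show ?case using assms gring_memD(1)[OF assms(1)] by simp
qed

lemma gmon_mult_apply:
  assumes "a \<in> carrier R" "g \<in> carrier gring"
  shows "(gmon R k a \<otimes>\<^bsub>gring\<^esub> g) j = a \<otimes> g (j - k)"
proof -
  have "(gmon R k a \<otimes>\<^bsub>gring\<^esub> g) j = (\<Oplus>i\<in>{k}. gmon R k a i \<otimes> g (j - i))"
    by (rule gring_mult[OF gmon_closed[OF assms(1)] assms(2)]) (auto simp: gmon_def)
  also have "\<dots> = a \<otimes> g (j - k)"
    using assms gring_memD(1)[OF assms(2)] by (subst finsum_one_term[of _ k]) (auto simp: gmon_def)
  finally show ?thesis .
qed

lemma gmon_mult:
  assumes "a \<in> carrier R" "b \<in> carrier R"
  shows "gmon R k a \<otimes>\<^bsub>gring\<^esub> gmon R l b = gmon R (k + l) (a \<otimes> b)"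
proof
  fix j
  show "(gmon R k a \<otimes>\<^bsub>gring\<^esub> gmon R l b) j = gmon R (k + l) (a \<otimes> b) j"
    unfolding gmon_mult_apply[OF assms(1) gmon_closed[OF assms(2)]]
    using assms by (auto simp: gmon_def algebra_simps)
qed

lemma gmon_add:
  "\<lbrakk>a \<in> carrier R; b \<in> carrier R\<rbrakk> \<Longrightarrow> gmon R k a \<oplus>\<^bsub>gring\<^esub> gmon R k b = gmon R k (a \<oplus> b)"
  by (auto simp: gmon_def gring_add)

lemma gring_add_assoc:
  "\<lbrakk>f \<in> carrier gring; g \<in> carrier gring; h \<in> carrier gring\<rbrakk> \<Longrightarrow>
    (f \<oplus>\<^bsub>gring\<^esub> g) \<oplus>\<^bsub>gring\<^esub> h = f \<oplus>\<^bsub>gring\<^esub> (g \<oplus>\<^bsub>gring\<^esub> h)"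
  by (simp add: gring_add gring_carrier a_assoc)

lemma gring_zero_mult:
  assumes "f \<in> carrier gring"
  shows "f \<otimes>\<^bsub>gring\<^esub> \<zero>\<^bsub>gring\<^esub> = \<zero>\<^bsub>gring\<^esub>" "\<zero>\<^bsub>gring\<^esub> \<otimes>\<^bsub>gring\<^esub> f = \<zero>\<^bsub>gring\<^esub>"
proof -
  have "finsum R (\<lambda>i. f i \<otimes> \<zero>) T \<in> {\<zero>}" for T by (rule finsum_in) (use gring_memD[OF assms] in auto)
  then show "f \<otimes>\<^bsub>gring\<^esub> \<zero>\<^bsub>gring\<^esub> = \<zero>\<^bsub>gring\<^esub>" by (simp add: group_ring_def)
  show "\<zero>\<^bsub>gring\<^esub> \<otimes>\<^bsub>gring\<^esub> f = \<zero>\<^bsub>gring\<^esub>" by (simp add: group_ring_def)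
qed

lemma gring_comm:
  assumes "f \<in> carrier gring" "g \<in> carrier gring"
  shows "f \<otimes>\<^bsub>gring\<^esub> g = g \<otimes>\<^bsub>gring\<^esub> f"
  using assms(1)
proof (induction rule: gring_induct')
  case zero show ?case unfolding gring_zero_mult[OF assms(2)] ..
next
  case (add f k a)
  have "gmon R k a \<otimes>\<^bsub>gring\<^esub> g = g \<otimes>\<^bsub>gring\<^esub> gmon R k a"
    using assms(2)
  proof (induction rule: gring_induct')
    case zero show ?case unfolding gring_zero_mult[OF gmon_closed[OF add(2)]] ..
  next
    case (add g l b)
    then show ?case using \<open>a \<in> carrier R\<close>
      by (simp add: gring_distr gmon_closed gmon_mult m_comm add.commute)
  qed
  then show ?case using add assms by (simp add: gring_distr gmon_closed)
qed

text \<open>Both sides are additive in each factor, so \<open>f\<close> and \<open>g\<close> may be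
  taken to be monomials; multiplication by these shifts and scales \<open>h\<close>, and the two
  sides can be compared coefficientwise.\<close>

lemma gring_assoc:
  assumes "f \<in> carrier gring" "g \<in> carrier gring" "h \<in> carrier gring"
  shows "(f \<otimes>\<^bsub>gring\<^esub> g) \<otimes>\<^bsub>gring\<^esub> h = f \<otimes>\<^bsub>gring\<^esub> (g \<otimes>\<^bsub>gring\<^esub> h)"
  using assms(1)
proof (induction rule: gring_induct')
  case zero show ?case unfolding gring_zero_mult[OF assms(2)] gring_zero_mult[OF assms(3)] gring_zero_mult[OF gring_mult_closed[OF assms(2,3)]] ..
next
  case (add f k a)
  have "(gmon R k a \<otimes>\<^bsub>gring\<^esub> g) \<otimes>\<^bsub>gring\<^esub> h = gmon R k a \<otimes>\<^bsub>gring\<^esub> (g \<otimes>\<^bsub>gring\<^esub> h)"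
    using assms(2)
  proof (induction rule: gring_induct')
    case zero show ?case unfolding gring_zero_mult[OF gmon_closed[OF add(2)]] gring_zero_mult[OF assms(3)] ..
  next
    case (add g l b)
    have "(gmon R k a \<otimes>\<^bsub>gring\<^esub> gmon R l b) \<otimes>\<^bsub>gring\<^esub> h = gmon R k a \<otimes>\<^bsub>gring\<^esub> (gmon R l b \<otimes>\<^bsub>gring\<^esub> h)"
      using add(2) \<open>a \<in> carrier R\<close> gring_memD(1)[OF assms(3)]
      by (simp add: gmon_mult fun_eq_iff gmon_mult_apply assms(3) gmon_closed gring_mult_closed m_assoc algebra_simps)
    then show ?case using add \<open>a \<in> carrier R\<close> assms(3)
      by (simp add: gring_distr gmon_closed gring_mult_closed gring_add_closed)
  qed
  then show ?case using add assms
    by (simp add: gring_distr gmon_closed gring_mult_closed gring_add_closed)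
qed

lemma gring_cring: "cring (gring :: ('i::ab_group_add \<Rightarrow> 'a) ring)"
proof (rule cringI)
  show "abelian_group (gring :: ('i \<Rightarrow> 'a) ring)"
  proof (rule abelian_groupI)
    fix f :: "'i \<Rightarrow> 'a" assume f: "f \<in> carrier gring"
    have "{i. \<ominus> f i \<noteq> \<zero>} \<subseteq> {i. f i \<noteq> \<zero>}" by auto
    then have "(\<lambda>i. \<ominus> f i) \<in> carrier gring" using f finite_subset by (auto simp: gring_carrier)
    moreover have "(\<lambda>i. \<ominus> f i) \<oplus>\<^bsub>gring\<^esub> f = \<zero>\<^bsub>gring\<^esub>"
      using f by (auto simp: gring_add gring_zero gring_carrier l_neg)
    ultimately show "\<exists>g\<in>carrier gring. g \<oplus>\<^bsub>gring\<^esub> f = \<zero>\<^bsub>gring\<^esub>" by blast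
  qed (auto simp: gring_add_closed gring_zero_closed gring_add_assoc, auto simp: gring_add gring_zero gring_carrier a_comm)
  show "comm_monoid (gring :: ('i \<Rightarrow> 'a) ring)"
  proof (rule comm_monoidI)
    fix f :: "'i \<Rightarrow> 'a" assume f: "f \<in> carrier gring"
    show "\<one>\<^bsub>gring\<^esub> \<otimes>\<^bsub>gring\<^esub> f = f"
      using f gring_memD(1)[OF f] by (auto simp: gring_one gmon_mult_apply)
  qed (auto simp: gring_mult_closed gring_one_closed gring_assoc, auto intro: gring_comm)
qed (simp add: gring_distr)

lemma gring_gmon_span:
  assumes "f \<in> carrier gring" "\<zero>\<^bsub>gring\<^esub> \<in> Y" "\<And>g h. g \<in> Y \<Longrightarrow> h \<in> Y \<Longrightarrow> g \<oplus>\<^bsub>gring\<^esub> h \<in> Y"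
    and "\<And>k. gmon R k (f k) \<in> Y"
  shows "f \<in> Y"
  using assms(1) by (induction rule: gring_induct) (use assms in auto)

text \<open>For a multiplicative family \<open>F\<close> this is the direct sum of the
  \<open>F i\<close> T^i. It gives the extended Rees algebra \<open>rees\<close> over the integers
  and the bigraded ring \<open>W\<close> over pairs of integers.\<close>

definition graded_subring :: "('i::ab_group_add \<Rightarrow> 'a set) \<Rightarrow> ('i \<Rightarrow> 'a) set"
  where "graded_subring F = {f \<in> carrier gring. \<forall>i. f i \<in> F i}"

lemma graded_subring:
  assumes F: "\<And>i. additive_subgroup (F i) R" "\<one> \<in> F 0"
    and mult: "\<And>i j a b. a \<in> F i \<Longrightarrow> b \<in> F j \<Longrightarrow> a \<otimes> b \<in> F (i + j)"
  shows "subring (graded_subring F) (gring :: ('i::ab_group_add \<Rightarrow> 'a) ring)"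
proof -
  interpret L: cring "gring :: ('i \<Rightarrow> 'a) ring" by (rule gring_cring)
  note z = additive_subgroup.zero_closed[OF F(1)] and p = additive_subgroup.a_closed[OF F(1)]
    and s = additive_subgroup.a_subset[OF F(1)] and m = additive_subgroup.a_inv_closed[OF F(1)]
  have neg: "(\<ominus>\<^bsub>gring\<^esub> f) i = \<ominus> f i" if f: "f \<in> carrier gring" for f :: "'i \<Rightarrow> 'a" and i
  proof -
    have "(\<ominus>\<^bsub>gring\<^esub> f) i \<oplus> f i = \<zero>" using L.l_neg[OF f] by (simp add: gring_add gring_zero fun_eq_iff)
    then show ?thesis using gring_memD(1)[OF f] gring_memD(1)[OF L.a_inv_closed[OF f]] minus_equality by metis
  qed
  show ?thesis
  proof (rule L.subringI)
    show "graded_subring F \<subseteq> carrier gring" by (auto simp: graded_subring_def)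
    show "\<one>\<^bsub>gring\<^esub> \<in> graded_subring F"
      using F(2) z by (auto simp: graded_subring_def gring_one gmon_closed) (auto simp: gmon_def)
    show "\<ominus>\<^bsub>gring\<^esub> f \<in> graded_subring F" if "f \<in> graded_subring F" for f
      using that m by (auto simp: graded_subring_def neg)
  next
    fix f g :: "'i \<Rightarrow> 'a" assume fg: "f \<in> graded_subring F" "g \<in> graded_subring F"
    then have c: "f \<in> carrier gring" "g \<in> carrier gring" by (auto simp: graded_subring_def)
    show "f \<oplus>\<^bsub>gring\<^esub> g \<in> graded_subring F"
      using fg p by (auto simp: graded_subring_def gring_add_closed) (auto simp: gring_add)
    have "(f \<otimes>\<^bsub>gring\<^esub> g) k \<in> F k" for k
      unfolding gring_mult[OF c gring_memD(2)[OF c(1)] order_refl]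
    proof (rule finsum_in[OF z p s])
      fix i
      have "f i \<otimes> g (k - i) \<in> F (i + (k - i))" using fg by (intro mult) (auto simp: graded_subring_def)
      then show "f i \<otimes> g (k - i) \<in> F k" by simp
    qed
    then show "f \<otimes>\<^bsub>gring\<^esub> g \<in> graded_subring F" using gring_mult_closed[OF c] by (auto simp: graded_subring_def)
  qed
qed

text \<open>The order on the indices singles out the lowest coefficients of \<open>f\<close> and
  \<open>g\<close> outside \<open>P\<close>. In the sum of their degrees, every other contribution
  has a factor of lower degree and hence in \<open>P\<close>, so modulo \<open>P\<close> the
  coefficient of the product is the product of these two.\<close>

lemma gring_prime:
  assumes P: "primeideal P R"
  shows "primeideal {f \<in> carrier gring. \<forall>i. f i \<in> P} (gring :: ('i::linordered_ab_group_add \<Rightarrow> 'a) ring)"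
proof -
  interpret L: cring "gring :: ('i \<Rightarrow> 'a) ring" by (rule gring_cring)
  note Pi = prime_ideal[OF P]
  note z = ideal_zero[OF Pi] and p = ideal_add[OF Pi] and s = ideal_sub[OF Pi] and m = ideal_mult[OF Pi]
  let ?P = "{f \<in> carrier gring. \<forall>i. f i \<in> P} :: ('i \<Rightarrow> 'a) set"
  show ?thesis
  proof (rule L.primeideal_of)
    show "ideal ?P gring"
    proof (rule L.ideal_of_closed)
      fix r f :: "'i \<Rightarrow> 'a" assume r: "r \<in> carrier gring" "f \<in> ?P"
      then have c: "f \<in> carrier gring" by auto
      have "(r \<otimes>\<^bsub>gring\<^esub> f) k \<in> P" for k
        unfolding gring_mult[OF r(1) c gring_memD(2)[OF r(1)] order_refl]
        by (rule finsum_in[OF z p s]) (use r gring_memD(1)[OF r(1)] m in auto)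
      then show "r \<otimes>\<^bsub>gring\<^esub> f \<in> ?P" using gring_mult_closed[OF r(1) c] by simp
    qed (auto simp: z p gring_zero_closed gring_add_closed, auto simp: gring_zero gring_add z p)
    show "\<one>\<^bsub>gring\<^esub> \<notin> ?P" using prime_one[OF P] by (auto simp: gring_one gmon_def)
  next
    fix f g :: "'i \<Rightarrow> 'a" assume fg: "f \<in> carrier gring" "g \<in> carrier gring" "f \<otimes>\<^bsub>gring\<^esub> g \<in> ?P"
    show "f \<in> ?P \<or> g \<in> ?P"
    proof (rule ccontr)
      assume no: "\<not> ?thesis"
      let ?F = "{i. f i \<notin> P}" and ?G = "{i. g i \<notin> P}"
      have "?F \<subseteq> {i. f i \<noteq> \<zero>}" "?G \<subseteq> {i. g i \<noteq> \<zero>}" using z by auto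
      from finite_subset[OF this(1) gring_memD(2)[OF fg(1)]] finite_subset[OF this(2) gring_memD(2)[OF fg(2)]]
      have fin: "finite ?F" "finite ?G" .
      have ne: "?F \<noteq> {}" "?G \<noteq> {}" using no fg by auto
      define k l where "k = Min ?F" and "l = Min ?G"
      have k: "f k \<notin> P" "\<And>i. i < k \<Longrightarrow> f i \<in> P" using Min_in[OF fin(1) ne(1)] Min_le[OF fin(1)] unfolding k_def
        by (auto simp: not_less[symmetric])
      have l: "g l \<notin> P" "\<And>i. i < l \<Longrightarrow> g i \<in> P" using Min_in[OF fin(2) ne(2)] Min_le[OF fin(2)] unfolding l_def
        by (auto simp: not_less[symmetric])
      let ?S = "{i. f i \<noteq> \<zero>}"
      note fc = gring_memD[OF fg(1)] and gc = gring_memD[OF fg(2)]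
      let ?t = "\<lambda>i. f i \<otimes> g (k + l - i)"
      have kS: "k \<in> ?S" using k(1) z by auto
      have "(f \<otimes>\<^bsub>gring\<^esub> g) (k + l) = finsum R ?t (insert k (?S - {k}))"
        using gring_mult[OF fg(1,2) fc(2) order_refl, of "k + l"] kS by (simp add: insert_absorb)
      also have "\<dots> = ?t k \<oplus> finsum R ?t (?S - {k})"
        using fc gc by (intro finsum_insert) auto
      finally have eq: "(f \<otimes>\<^bsub>gring\<^esub> g) (k + l) = f k \<otimes> g l \<oplus> finsum R ?t (?S - {k})" by simp
      have "?t i \<in> P" if "i \<noteq> k" for i
      proof (cases "i < k")
        case True
        then show ?thesis using k(2) ideal.I_r_closed[OF Pi] gc by simp
      next
        case False
        then have "k < i" using that by simp
        then have "k + l - i < l" by (simp add: algebra_simps)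
        then show ?thesis using l(2) m fc by simp
      qed
      then have r: "finsum R ?t (?S - {k}) \<in> P" by (intro finsum_in[OF z p s]) auto
      have "f k \<otimes> g l = (f \<otimes>\<^bsub>gring\<^esub> g) (k + l) \<ominus> finsum R ?t (?S - {k})"
        unfolding eq using fc(1)[of k] gc(1)[of l] subsetD[OF s r] by (simp add: a_minus_def a_assoc r_neg)
      also have "\<dots> \<in> P" using fg(3) r ideal_minus[OF Pi] by simp
      finally show False using primeideal.I_prime[OF P fc(1) gc(1)] k(1) l(1) by blast
    qed
  qed
qed

end

section \<open>Prime chains in finitely generated algebras\<close>

context "domain"
begin

text \<open>This is \<open>Y + y Y + ... + y^(a-1) Y\<close> in Horner form, with \<open>a\<close>
  summands.\<close>

primrec hsum :: "'a set \<Rightarrow> 'a \<Rightarrow> nat \<Rightarrow> 'a set" where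
  "hsum Y y 0 = {\<zero>}"
| "hsum Y y (Suc a) = Y <+>\<^bsub>R\<^esub> (\<lambda>e. y \<otimes> e) ` hsum Y y a"

text \<open>Over a field \<open>K\<close> this is the span of the monomials in the listed elements
  with every exponent at most \<open>N\<close>, whence the \<open>Suc N\<close> in the
  recursion.\<close>

primrec box :: "'a set \<Rightarrow> nat \<Rightarrow> 'a list \<Rightarrow> 'a set" where
  "box K N [] = K"
| "box K N (t # ts) = hsum (box K N ts) t (Suc N)"

lemma hsumI: "x \<in> Y \<Longrightarrow> h \<in> hsum Y y a \<Longrightarrow> x \<oplus> y \<otimes> h \<in> hsum Y y (Suc a)"
  by (auto intro!: set_addI)

lemma hsumE:
  assumes "u \<in> hsum Y y (Suc a)" obtains x h where "x \<in> Y" "h \<in> hsum Y y a" "u = x \<oplus> y \<otimes> h"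
  using assms by (auto elim!: set_addE)

declare hsum.simps(2) [simp del]

definition submod :: "'a set \<Rightarrow> 'a set \<Rightarrow> bool"
  where "submod K Y \<longleftrightarrow> Y \<subseteq> carrier R \<and> \<zero> \<in> Y \<and> (\<forall>a\<in>Y. \<forall>b\<in>Y. a \<oplus> b \<in> Y) \<and> (\<forall>k\<in>K. \<forall>a\<in>Y. k \<otimes> a \<in> Y)"

lemma submodD:
  assumes "submod K Y"
  shows "a \<in> Y \<Longrightarrow> a \<in> carrier R" "\<zero> \<in> Y" "a \<in> Y \<Longrightarrow> b \<in> Y \<Longrightarrow> a \<oplus> b \<in> Y" "k \<in> K \<Longrightarrow> a \<in> Y \<Longrightarrow> k \<otimes> a \<in> Y"
  using assms by (auto simp: submod_def)

lemma hsum_carrier: "Y \<subseteq> carrier R \<Longrightarrow> y \<in> carrier R \<Longrightarrow> u \<in> hsum Y y a \<Longrightarrow> u \<in> carrier R"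
  by (induction a arbitrary: u) (auto elim!: hsumE)

lemma hsum_submod:
  assumes Y: "submod K Y" and y: "y \<in> carrier R" and K: "K \<subseteq> carrier R"
  shows "submod K (hsum Y y a)"
proof (induction a)
  case 0 then show ?case using K by (auto simp: submod_def)
next
  case (Suc a)
  note Xd = submodD[OF Y] and Hd = submodD[OF Suc]
  show ?case unfolding submod_def
  proof (intro conjI ballI)
    show "hsum Y y (Suc a) \<subseteq> carrier R" using hsum_carrier[of Y y] Xd(1) y by blast
    show "\<zero> \<in> hsum Y y (Suc a)" using hsumI[OF Xd(2) Hd(2)] y by simp
  next
    fix u w assume "u \<in> hsum Y y (Suc a)" "w \<in> hsum Y y (Suc a)"
    then obtain x h x' h' where *: "x \<in> Y" "h \<in> hsum Y y a" "u = x \<oplus> y \<otimes> h" "x' \<in> Y" "h' \<in> hsum Y y a" "w = x' \<oplus> y \<otimes> h'"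
      by (metis hsumE)
    have "u \<oplus> w = (x \<oplus> x') \<oplus> y \<otimes> (h \<oplus> h')"
      unfolding *(3,6) using Xd(1)[OF *(1)] Xd(1)[OF *(4)] Hd(1)[OF *(2)] Hd(1)[OF *(5)] y by algebra
    then show "u \<oplus> w \<in> hsum Y y (Suc a)" using hsumI[OF Xd(3)[OF *(1,4)] Hd(3)[OF *(2,5)]] by simp
  next
    fix k u assume k: "k \<in> K" and "u \<in> hsum Y y (Suc a)"
    then obtain x h where *: "x \<in> Y" "h \<in> hsum Y y a" "u = x \<oplus> y \<otimes> h" by (metis hsumE)
    have "k \<otimes> u = k \<otimes> x \<oplus> y \<otimes> (k \<otimes> h)"
      unfolding *(3) using Xd(1)[OF *(1)] Hd(1)[OF *(2)] y subsetD[OF K k] by algebra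
    then show "k \<otimes> u \<in> hsum Y y (Suc a)" using hsumI[OF Xd(4)[OF k *(1)] Hd(4)[OF k *(2)]] by simp
  qed
qed

lemma hsum_base: 
  assumes "submod K Y" "y \<in> carrier R" "K \<subseteq> carrier R" "x \<in> Y" shows "x \<in> hsum Y y (Suc a)"
  using hsumI[OF assms(4) submodD(2)[OF hsum_submod[OF assms(1-3)]], of a] submodD(1)[OF assms(1)] assms by simp

lemma hsum_ymult:
  assumes "submod K Y" "y \<in> carrier R" "K \<subseteq> carrier R" "u \<in> hsum Y y a" shows "y \<otimes> u \<in> hsum Y y (Suc a)"
  using hsumI[OF submodD(2)[OF assms(1)] assms(4)] submodD(1)[OF hsum_submod[OF assms(1-3)] assms(4)] assms by simp

lemma hsum_mult:
  assumes "t \<in> carrier R" "y \<in> carrier R" "Y \<subseteq> carrier R" "\<And>x. x \<in> Y \<Longrightarrow> t \<otimes> x \<in> Y'"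
  shows "u \<in> hsum Y y a \<Longrightarrow> t \<otimes> u \<in> hsum Y' y a"
proof (induction a arbitrary: u)
  case 0 then show ?case using assms by simp
next
  case (Suc a)
  from Suc(2) obtain x h where *: "x \<in> Y" "h \<in> hsum Y y a" "u = x \<oplus> y \<otimes> h" by (rule hsumE)
  have "t \<otimes> u = t \<otimes> x \<oplus> y \<otimes> (t \<otimes> h)"
    unfolding *(3) using subsetD[OF assms(3) *(1)] hsum_carrier[OF assms(3,2) *(2)] assms(1,2) by algebra
  then show ?case using hsumI[OF assms(4)[OF *(1)] Suc.IH[OF *(2)]] by simp
qed

lemma hsum_mono: "Y \<subseteq> Y' \<Longrightarrow> u \<in> hsum Y y a \<Longrightarrow> u \<in> hsum Y' y a"
proof (induction a arbitrary: u)
  case (Suc a)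
  from Suc(3) obtain x h where *: "x \<in> Y" "h \<in> hsum Y y a" "u = x \<oplus> y \<otimes> h" by (rule hsumE)
  then show ?case using hsumI[of x Y' h y a] Suc by auto
qed simp

lemma hsum_Suc:
  assumes "submod K Y" "y \<in> carrier R" "K \<subseteq> carrier R"
  shows "u \<in> hsum Y y a \<Longrightarrow> u \<in> hsum Y y (Suc a)"
proof (induction a arbitrary: u)
  case 0 then show ?case using submodD(2)[OF hsum_submod[OF assms]] by simp
next
  case (Suc a)
  from Suc(2) obtain x h where *: "x \<in> Y" "h \<in> hsum Y y a" "u = x \<oplus> y \<otimes> h" by (rule hsumE)
  then show ?case using hsumI[OF *(1) Suc.IH[OF *(2)]] by simp
qed

section \<open>Growth of algebras over a subfield\<close>

context
  fixes K assumes K: "subfield K R"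
begin

lemma subfield_carrier: "K \<subseteq> carrier R" using subfieldE(3)[OF K] .

lemma K_submod: "submod K K"
  unfolding submod_def using subringE[OF subfieldE(1)[OF K]] by auto

lemma box_submod: "set ts \<subseteq> carrier R \<Longrightarrow> submod K (box K N ts)"
  by (induction ts) (auto intro!: K_submod hsum_submod[OF _ _ subfield_carrier])

lemma box_Suc: "set ts \<subseteq> carrier R \<Longrightarrow> u \<in> box K N ts \<Longrightarrow> u \<in> box K (Suc N) ts"
proof (induction ts arbitrary: u)
  case (Cons t ts)
  then have t: "t \<in> carrier R" and ts: "set ts \<subseteq> carrier R" by auto
  have "u \<in> hsum (box K N ts) t (Suc N)" using Cons by simp
  then have "u \<in> hsum (box K (Suc N) ts) t (Suc N)" by (rule hsum_mono[rotated]) (use Cons.IH[OF ts] in auto)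
  then show ?case using hsum_Suc[OF box_submod[OF ts] t subfield_carrier] by simp
qed simp

lemma box_mono:
  assumes "set ts \<subseteq> carrier R" "N \<le> M" "u \<in> box K N ts" shows "u \<in> box K M ts"
  using assms(2,3) by (induction M rule: dec_induct) (auto intro: box_Suc[OF assms(1)])

lemma box_K: "set ts \<subseteq> carrier R \<Longrightarrow> k \<in> K \<Longrightarrow> k \<in> box K N ts"
proof (induction ts)
  case (Cons t ts)
  then have t: "t \<in> carrier R" and ts: "set ts \<subseteq> carrier R" by auto
  then show ?case using hsum_base[OF box_submod[OF ts] t subfield_carrier] Cons by simp
qed simp

lemma box_gen: "set ts \<subseteq> carrier R \<Longrightarrow> s \<in> set ts \<Longrightarrow> u \<in> box K N ts \<Longrightarrow> s \<otimes> u \<in> box K (Suc N) ts"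
proof (induction ts arbitrary: u)
  case (Cons t ts)
  then have t: "t \<in> carrier R" and ts: "set ts \<subseteq> carrier R" and s: "s \<in> carrier R" by auto
  note B = box_submod[OF ts]
  have u: "u \<in> hsum (box K N ts) t (Suc N)" using Cons by simp
  have inc: "box K N ts \<subseteq> box K (Suc N) ts" using box_Suc[OF ts] by auto
  show ?case
  proof (cases "s = t")
    case True
    then show ?thesis using hsum_mono[OF inc hsum_ymult[OF B t subfield_carrier u]] by simp
  next
    case False
    then have "s \<in> set ts" using Cons by simp
    then have "s \<otimes> u \<in> hsum (box K (Suc N) ts) t (Suc N)"
      using Cons.IH[OF ts] submodD(1)[OF B] by (intro hsum_mult[OF s t _ _ u]) auto
    then show ?thesis using hsum_Suc[OF B t subfield_carrier] using hsum_Suc[OF box_submod[OF ts] t subfield_carrier] by simp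
  qed
qed simp

lemma Span_mult: 
  assumes "y \<in> carrier R" "set L \<subseteq> carrier R"
  shows "(\<lambda>e. y \<otimes> e) ` Span K L = Span K (map (\<lambda>e. y \<otimes> e) L)"
  using assms(2)
proof (induction L)
  case Nil then show ?case using assms by simp
next
  case (Cons v L)
  then have v: "v \<in> carrier R" and L: "set L \<subseteq> carrier R" by auto
  have S: "Span K L \<subseteq> carrier R" using Span_subgroup_props(1)[OF K L] .
  have eq: "y \<otimes> (k \<otimes> v \<oplus> w) = k \<otimes> (y \<otimes> v) \<oplus> y \<otimes> w" if "k \<in> K" "w \<in> Span K L" for k w
    using subsetD[OF subfield_carrier that(1)] subsetD[OF S that(2)] v assms(1) by algebra
  have "(\<lambda>e. y \<otimes> e) ` line_extension K v (Span K L) = line_extension K (y \<otimes> v) ((\<lambda>e. y \<otimes> e) ` Span K L)"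
  proof (intro Set.set_eqI iffI)
    fix u assume "u \<in> (\<lambda>e. y \<otimes> e) ` line_extension K v (Span K L)"
    then obtain k w where "k \<in> K" "w \<in> Span K L" "u = y \<otimes> (k \<otimes> v \<oplus> w)"
      by (auto simp: line_extension_mem_iff simp del: Span.simps)
    then show "u \<in> line_extension K (y \<otimes> v) ((\<lambda>e. y \<otimes> e) ` Span K L)"
      unfolding line_extension_mem_iff using eq by blast
  next
    fix u assume "u \<in> line_extension K (y \<otimes> v) ((\<lambda>e. y \<otimes> e) ` Span K L)"
    then obtain k w where "k \<in> K" "w \<in> Span K L" "u = k \<otimes> (y \<otimes> v) \<oplus> y \<otimes> w"
      by (auto simp: line_extension_mem_iff simp del: Span.simps)
    then have "u = y \<otimes> (k \<otimes> v \<oplus> w)" "k \<otimes> v \<oplus> w \<in> line_extension K v (Span K L)"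
      unfolding line_extension_mem_iff using eq by auto
    then show "u \<in> (\<lambda>e. y \<otimes> e) ` line_extension K v (Span K L)" by blast
  qed
  then show ?case using Cons.IH[OF L] by simp
qed

lemma hsum_Span:
  assumes y: "y \<in> carrier R" and L: "set L \<subseteq> carrier R"
  shows "\<exists>L'. set L' \<subseteq> carrier R \<and> length L' = a * length L \<and> Span K L' = hsum (Span K L) y a"
proof (induction a)
  case 0 show ?case by (intro exI[of _ "[]"]) simp
next
  case (Suc a)
  then obtain L' where L': "set L' \<subseteq> carrier R" "length L' = a * length L" "Span K L' = hsum (Span K L) y a" by blast
  have c: "set (map (\<lambda>e. y \<otimes> e) L') \<subseteq> carrier R" using L'(1) y by auto
  have "Span K (L @ map (\<lambda>e. y \<otimes> e) L') = hsum (Span K L) y (Suc a)"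
    unfolding Span_append_eq_set_add[OF K L c] Span_mult[OF y L'(1), symmetric] L'(3) hsum.simps(2) ..
  then show ?case using c L L'(2) by (intro exI[of _ "L @ map (\<lambda>e. y \<otimes> e) L'"]) auto
qed

text \<open>One vector for each monomial. The vectors may be dependent, as their number serves only
  as an upper bound for the dimension.\<close>

lemma box_Span:
  "set ts \<subseteq> carrier R \<Longrightarrow> \<exists>L. set L \<subseteq> carrier R \<and> length L = Suc N ^ length ts \<and> Span K L = box K N ts"
proof (induction ts)
  case Nil
  have "Span K [\<one>] = K"
  proof -
    have "line_extension K \<one> {\<zero>} = K"
    proof (intro Set.set_eqI iffI)
      fix u assume "u \<in> line_extension K \<one> {\<zero>}"
      then obtain k where "k \<in> K" "u = k \<otimes> \<one> \<oplus> \<zero>" by (auto simp: line_extension_mem_iff)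
      then show "u \<in> K" using subfield_carrier by auto
    next
      fix u assume "u \<in> K"
      then show "u \<in> line_extension K \<one> {\<zero>}" using subfield_carrier by (auto simp: line_extension_mem_iff intro!: bexI[of _ u])
    qed
    then show ?thesis by simp
  qed
  then show ?case by (intro exI[of _ "[\<one>]"]) simp
next
  case (Cons t ts)
  then obtain L where L: "set L \<subseteq> carrier R" "length L = Suc N ^ length ts" "Span K L = box K N ts" by auto
  then show ?case using hsum_Span[of t L "Suc N"] Cons(2) by simp
qed

text \<open>Dropping each vector that depends on the later ones turns \<open>Vs\<close> into an
  independent list with the same span, to which the exchange lemma applies.\<close>

lemma dimension_le_length:
  assumes Y: "dimension n K Y" "Y \<subseteq> Span K Vs" and Vs: "set Vs \<subseteq> carrier R"
  shows "n \<le> length Vs"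
proof -
  have "\<exists>Ws. independent K Ws \<and> Span K Ws = Span K Vs \<and> length Ws \<le> length Vs"
    using Vs
  proof (induction Vs)
    case Nil show ?case by (intro exI[of _ "[]"]) auto
  next
    case (Cons u Us)
    then obtain Ws where W: "independent K Ws" "Span K Ws = Span K Us" "length Ws \<le> length Us" by auto
    show ?case
    proof (cases "u \<in> Span K Us")
      case True
      then have "Span K (u # Us) = Span K Us"
        using Span_base_incl[OF K] mono_Span_subset[OF K] by (metis Cons.prems insert_subset list.simps(15) subset_antisym)
      then show ?thesis using W by (intro exI[of _ Ws]) auto
    next
      case False
      then have "Span K (u # Ws) = Span K (u # Us)" "independent K (u # Ws)"
        using li_Cons[of u K Ws] Cons(2) W by auto
      then show ?thesis using W by (intro exI[of _ "u # Ws"]) auto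
    qed
  qed
  then obtain Ws where W: "independent K Ws" "Span K Ws = Span K Vs" "length Ws \<le> length Vs" by blast
  obtain Us where U: "set Us \<subseteq> carrier R" "independent K Us" "length Us = n" "Span K Us = Y"
    using exists_base[OF K Y(1)] by blast
  have "set Us \<subseteq> Span K Ws" using Span_base_incl[OF K U(1)] U(4) Y(2) W(2) by simp
  from independent_length_le[OF K U(2) W(1) this] show ?thesis using U W by simp
qed

lemma dimension_mult:
  assumes y: "y \<in> carrier R" "y \<noteq> \<zero>" and E: "dimension n K E"
  shows "dimension n K ((\<lambda>e. y \<otimes> e) ` E)"
proof -
  obtain Us where U: "set Us \<subseteq> carrier R" "independent K Us" "length Us = n" "Span K Us = E"
    using exists_base[OF K E] by blast
  have "independent K (map (\<lambda>e. y \<otimes> e) Us)"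
    using U(1,2)
  proof (induction Us)
    case (Cons u Us)
    then have u: "u \<in> carrier R" "set Us \<subseteq> carrier R" "u \<notin> Span K Us" "independent K Us"
      using independent_backwards[OF Cons(3)] by auto
    have "y \<otimes> u \<notin> (\<lambda>e. y \<otimes> e) ` Span K Us"
    proof
      assume "y \<otimes> u \<in> (\<lambda>e. y \<otimes> e) ` Span K Us"
      then obtain w where w: "w \<in> Span K Us" "y \<otimes> u = y \<otimes> w" by blast
      have "w \<in> carrier R" using w(1) Span_subgroup_props(1)[OF K u(2)] by blast
      then have "u = w" using w(2) m_lcancel[OF y(2,1) u(1)] by simp
      then show False using w u by simp
    qed
    then have "y \<otimes> u \<notin> Span K (map (\<lambda>e. y \<otimes> e) Us)" unfolding Span_mult[OF y(1) u(2)] .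
    then show ?case using li_Cons[of "y \<otimes> u" K "map (\<lambda>e. y \<otimes> e) Us"] Cons.IH u y(1) by simp
  qed simp
  from dimension_independent[OF this] show ?thesis
    unfolding Span_mult[OF y(1) U(1), symmetric] U(4) using U(3) by simp
qed

text \<open>The sum of the \<open>y^i Y\<close> is direct because multiples of \<open>y\<close> lie
  in \<open>P'\<close>, which meets \<open>Y\<close> only in zero. If an element of the sum lies in
  \<open>P\<close>, its term without \<open>y\<close> lies in \<open>P'\<close> and so vanishes;
  then \<open>y\<close> can be cancelled modulo \<open>P\<close>, and induction applies to what is
  left.\<close>

lemma hsum_dimension:
  assumes P: "primeideal P R" "primeideal P' R" "P \<subseteq> P'" and y: "y \<in> P'" "y \<notin> P"
    and Y: "submod K Y" "dimension m K Y" "Y \<inter> P' = {\<zero>}"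
  shows "dimension (a * m) K (hsum Y y a) \<and> hsum Y y a \<inter> P = {\<zero>}"
proof -
  note Pi = prime_ideal[OF P(1)] and P'i = prime_ideal[OF P(2)]
  have yc: "y \<in> carrier R" using y ideal.Icarr[OF P'i] by simp
  have y0: "y \<noteq> \<zero>" using y ideal_zero[OF Pi] by auto
  show ?thesis
  proof (induction a)
    case 0 then show ?case using zero_dim[of K] ideal_zero[OF Pi] by simp
  next
    case (Suc a)
    let ?H = "hsum Y y a" and ?yH = "(\<lambda>e. y \<otimes> e) ` hsum Y y a"
    note H = hsum_submod[OF Y(1) yc subfield_carrier, of a] and H' = hsum_submod[OF Y(1) yc subfield_carrier, of "Suc a"]
    have yP: "y \<otimes> h \<in> P'" if "h \<in> ?H" for h
      using ideal.I_r_closed[OF P'i y(1)] submodD(1)[OF H that] by simp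
    have "\<zero> \<in> ?yH" using submodD(2)[OF H] yc by (auto intro!: image_eqI[of _ _ \<zero>])
    then have int: "Y \<inter> ?yH = {\<zero>}" using Y(3) yP submodD(2)[OF Y(1)] by blast
    have "dimension (m + a * m) K (Y <+>\<^bsub>R\<^esub> ?yH)"
      using dimension_direct_sum_space[OF K Y(2) dimension_mult[OF yc y0] int] Suc by blast
    then have d: "dimension (Suc a * m) K (hsum Y y (Suc a))" by (simp add: hsum.simps(2))
    have "u = \<zero>" if u: "u \<in> hsum Y y (Suc a)" "u \<in> P" for u
    proof -
      from u(1) obtain x h where *: "x \<in> Y" "h \<in> ?H" "u = x \<oplus> y \<otimes> h" by (rule hsumE)
      have xc: "x \<in> carrier R" and hc: "h \<in> carrier R" using submodD(1)[OF Y(1) *(1)] submodD(1)[OF H *(2)] .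
      have "x = u \<ominus> y \<otimes> h" unfolding *(3) using xc hc yc by algebra
      also have "\<dots> \<in> P'" using ideal_minus[OF P'i] u(2) P(3) yP[OF *(2)] by blast
      finally have "x = \<zero>" using Y(3) *(1) by blast
      then have yh: "y \<otimes> h = u" using * hc yc by simp
      then have "h \<in> P" using prime_mult[OF P(1) yc hc] u(2) y(2) by simp
      then have "h = \<zero>" using Suc *(2) by blast
      then show ?thesis using yh yc by simp
    qed
    then have "hsum Y y (Suc a) \<inter> P = {\<zero>}" using submodD(2)[OF H'] ideal_zero[OF Pi] by blast
    then show ?case using d by blast
  qed
qed

text \<open>Each Horner step costs one multiplication by \<open>y\<close>, which raises the exponent
  bound by \<open>d\<close>.\<close>

lemma hsum_box:
  assumes ts: "set ts \<subseteq> carrier R" and y: "y \<in> carrier R"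
    and d: "\<And>j u. u \<in> box K j ts \<Longrightarrow> y \<otimes> u \<in> box K (j + d) ts" and Y: "Y \<subseteq> box K b ts"
  shows "hsum Y y a \<subseteq> box K (b + a * d) ts"
proof (induction a)
  case 0 show ?case using submodD(2)[OF box_submod[OF ts]] by simp
next
  case (Suc a)
  show ?case
  proof
    fix u assume "u \<in> hsum Y y (Suc a)"
    then obtain x h where *: "x \<in> Y" "h \<in> hsum Y y a" "u = x \<oplus> y \<otimes> h" by (rule hsumE)
    have "x \<in> box K (b + Suc a * d) ts" using box_mono[OF ts, of b] Y *(1) by auto
    moreover have "y \<otimes> h \<in> box K (b + a * d + d) ts" using d Suc *(2) by blast
    then have "y \<otimes> h \<in> box K (b + Suc a * d) ts" by (simp add: algebra_simps)
    ultimately show "u \<in> box K (b + Suc a * d) ts" unfolding *(3) using submodD(3)[OF box_submod[OF ts]] by blast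
  qed
qed

text \<open>
  If \<open>y\<^sub>i \<in> P\<^sub>i\<^sub>+\<^sub>1 - P\<^sub>i\<close>, then the monomials in the \<open>y\<^sub>i\<close> are linearly independent over \<open>K\<close>. As there are
  \<open>N\<^sup>n\<close> of them with exponents below \<open>N\<close>, this bounds \<open>n\<close> by the growth rate of the algebra.
\<close>
theorem prime_chain_le_generators:
  assumes ts: "set ts \<subseteq> carrier R"
    and gen: "\<And>Y. K \<subseteq> Y \<Longrightarrow> (\<And>a b. a \<in> Y \<Longrightarrow> b \<in> Y \<Longrightarrow> a \<oplus> b \<in> Y) \<Longrightarrow> (\<And>t a. t \<in> set ts \<Longrightarrow> a \<in> Y \<Longrightarrow> t \<otimes> a \<in> Y)
      \<Longrightarrow> carrier R \<subseteq> Y"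
    and P: "\<And>i. i \<le> n \<Longrightarrow> primeideal (P i) R" "\<And>i. i < n \<Longrightarrow> P i \<subset> P (Suc i)"
  shows "n \<le> length ts"
proof -
  \<comment> \<open>Elements whose multiplication raises the exponent bound of every box by a fixed
    amount. They include \<open>K\<close> and are closed under sums and under multiplication by
    generators, so by \<open>gen\<close> they are everything.\<close>
  let ?D = "{c \<in> carrier R. \<exists>d. \<forall>j. \<forall>u \<in> box K j ts. c \<otimes> u \<in> box K (j + d) ts}"
  note B = box_submod[OF ts]
  have "carrier R \<subseteq> ?D"
  proof (rule gen)
    have "k \<otimes> u \<in> box K (j + 0) ts" if "k \<in> K" "u \<in> box K j ts" for k u j using submodD(4)[OF B that] by simp
    then show "K \<subseteq> ?D" using subfield_carrier by blast
  next
    fix a b assume a: "a \<in> ?D" and b: "b \<in> ?D"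
    obtain d e where d: "\<forall>j. \<forall>u \<in> box K j ts. a \<otimes> u \<in> box K (j + d) ts"
      and e: "\<forall>j. \<forall>u \<in> box K j ts. b \<otimes> u \<in> box K (j + e) ts" using a b by blast
    have "(a \<oplus> b) \<otimes> u \<in> box K (j + (d + e)) ts" if u: "u \<in> box K j ts" for j u
    proof -
      have "a \<otimes> u \<in> box K (j + (d + e)) ts" using d u box_mono[OF ts, of "j + d"] by simp
      moreover have "b \<otimes> u \<in> box K (j + (d + e)) ts" using e u box_mono[OF ts, of "j + e"] by simp
      moreover have "(a \<oplus> b) \<otimes> u = a \<otimes> u \<oplus> b \<otimes> u" using a b submodD(1)[OF B u] by (simp add: l_distr)
      ultimately show ?thesis using submodD(3)[OF B] by simp
    qed
    then show "a \<oplus> b \<in> ?D" using a b by blast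
  next
    fix t a assume t: "t \<in> set ts" and a: "a \<in> ?D"
    obtain d where d: "\<forall>j. \<forall>u \<in> box K j ts. a \<otimes> u \<in> box K (j + d) ts" using a by blast
    have tc: "t \<in> carrier R" using t ts by auto
    have "(t \<otimes> a) \<otimes> u \<in> box K (j + Suc d) ts" if u: "u \<in> box K j ts" for j u
      using box_gen[OF ts t d[rule_format, OF u]] a tc submodD(1)[OF B u] by (simp add: m_assoc)
    then show "t \<otimes> a \<in> ?D" using a tc by blast
  qed
  then have "\<forall>c \<in> carrier R. \<exists>d. \<forall>j. \<forall>u \<in> box K j ts. c \<otimes> u \<in> box K (j + d) ts" by blast
  then obtain \<delta> where \<delta>: "\<And>c j u. c \<in> carrier R \<Longrightarrow> u \<in> box K j ts \<Longrightarrow> c \<otimes> u \<in> box K (j + \<delta> c) ts" by metis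
  have "\<exists>y. y \<in> P (Suc i) \<and> y \<notin> P i" if "i < n" for i using P(2)[OF that] by blast
  then obtain y where y: "\<And>i. i < n \<Longrightarrow> y i \<in> P (Suc i)" "\<And>i. i < n \<Longrightarrow> y i \<notin> P i" by metis
  have yc: "y i \<in> carrier R" if "i < n" for i using y(1)[OF that] ideal.Icarr[OF prime_ideal[OF P(1)], of "Suc i"] that by simp
  \<comment> \<open>A common increment for all \<open>y i\<close>; the inserted \<open>0\<close>
    keeps the maximum defined for \<open>n = 0\<close>.\<close>
  define d where "d = Max (insert 0 ((\<lambda>i. \<delta> (y i)) ` {..<n}))"
  have d: "y i \<otimes> u \<in> box K (j + d) ts" if "i < n" "u \<in> box K j ts" for i j u
  proof -
    have "\<delta> (y i) \<le> d" unfolding d_def using that by (intro Max_ge) auto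
    then show ?thesis using box_mono[OF ts, of "j + \<delta> (y i)" "j + d"] \<delta>[OF yc[OF that(1)] that(2)] by simp
  qed
  have bound: "N ^ n \<le> Suc (n * (N * d)) ^ length ts" for N
  proof -
    \<comment> \<open>The chain is descended from \<open>P n\<close>: each step multiplies the
      dimension by \<open>N\<close> and passes from a space meeting \<open>P (n - k)\<close>
      trivially to one meeting the next smaller prime trivially. The start is \<open>K\<close>,
      whose nonzero elements are units.\<close>
    have "\<exists>Y. submod K Y \<and> dimension (N ^ k) K Y \<and> Y \<inter> P (n - k) = {\<zero>} \<and> Y \<subseteq> box K (k * (N * d)) ts" if "k \<le> n" for k
      using that
    proof (induction k)
      case 0
      have Pn: "primeideal (P n) R" using P(1) by simp
      have "c = \<zero>" if c: "c \<in> K" "c \<in> P n" for c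
      proof (rule ccontr)
        assume "c \<noteq> \<zero>"
        then have "inv c \<in> K" "inv c \<otimes> c = \<one>" using subfield_m_inv[OF K, of c] c by auto
        then have "\<one> \<in> P n" using ideal_mult[OF prime_ideal[OF Pn] c(2), of "inv c"] subfield_carrier by auto
        then show False using prime_one[OF Pn] by simp
      qed
      then have "K \<inter> P n = {\<zero>}" using submodD(2)[OF K_submod] ideal_zero[OF prime_ideal[OF Pn]] by blast
      moreover have "K \<subseteq> box K 0 ts" using box_K[OF ts] by blast
      moreover have "dimension 1 K K" using dimension_one[OF K] .
      ultimately show ?case using K_submod by (intro exI[of _ K]) simp
    next
      case (Suc k)
      then obtain Y where Y: "submod K Y" "dimension (N ^ k) K Y" "Y \<inter> P (n - k) = {\<zero>}" "Y \<subseteq> box K (k * (N * d)) ts" by auto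
      define i where "i = n - Suc k"
      have i: "i < n" "Suc i = n - k" using Suc by (auto simp: i_def)
      have "dimension (N * N ^ k) K (hsum Y (y i) N) \<and> hsum Y (y i) N \<inter> P i = {\<zero>}"
      proof (rule hsum_dimension[OF _ _ _ _ _ Y(1,2)])
        show "primeideal (P i) R" "primeideal (P (Suc i)) R" "P i \<subseteq> P (Suc i)" using P i(1) by auto
        show "y i \<in> P (Suc i)" "y i \<notin> P i" by (rule y(1)[OF i(1)], rule y(2)[OF i(1)])
        show "Y \<inter> P (Suc i) = {\<zero>}" using Y(3) i by simp
      qed
      moreover have "hsum Y (y i) N \<subseteq> box K (k * (N * d) + N * d) ts"
        using hsum_box[OF ts yc[OF i(1)] d[OF i(1)] Y(4)] by blast
      then have "hsum Y (y i) N \<subseteq> box K (Suc k * (N * d)) ts" by (simp add: algebra_simps)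
      ultimately show ?case using hsum_submod[OF Y(1) yc[OF i(1)] subfield_carrier] unfolding i_def
        by (intro exI[of _ "hsum Y (y (n - Suc k)) N"]) simp
    qed
    from this[of n] obtain Y where Y: "dimension (N ^ n) K Y" "Y \<subseteq> box K (n * (N * d)) ts" by auto
    obtain L where L: "set L \<subseteq> carrier R" "length L = Suc (n * (N * d)) ^ length ts" "Span K L = box K (n * (N * d)) ts"
      using box_Span[OF ts] by blast
    show ?thesis using dimension_le_length[OF Y(1) _ L(1)] Y(2) L(2,3) by simp
  qed
  show ?thesis
  proof (rule ccontr)
    let ?l = "length ts"
    assume "\<not> ?thesis"
    then have l: "Suc ?l \<le> n" by simp
    \<comment> \<open>For \<open>?l < n\<close> the bound gives
      \<open>N * N ^ ?l \<le> (Suc (n * d) * N) ^ ?l\<close>, hence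
      \<open>N \<le> Suc (n * d) ^ ?l\<close>; the chosen \<open>N\<close> is one more than
      that.\<close>
    define N where "N = Suc (Suc (n * d) ^ ?l)"
    have N1: "1 \<le> N" by (simp add: N_def)
    have "N * N ^ ?l \<le> N ^ n" using power_increasing[OF l N1] by simp
    also have "\<dots> \<le> Suc (n * (N * d)) ^ ?l" by (rule bound)
    also have "\<dots> \<le> (Suc (n * d) * N) ^ ?l" using N1 by (intro power_mono) (auto simp: algebra_simps)
    also have "\<dots> = Suc (n * d) ^ ?l * N ^ ?l" by (rule power_mult_distrib)
    finally have "N \<le> Suc (n * d) ^ ?l" using N1 by simp
    then show False by (simp add: N_def)
  qed
qed

end

end

section \<open>Krull dimension\<close>

lemma krull_dim_ge:
  assumes "\<And>i. i \<le> n \<Longrightarrow> primeideal (P i) A" "\<And>i. i < n \<Longrightarrow> P i \<subset> P (Suc i)"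
  shows "enat n \<le> krull_dim A"
proof -
  have lt: "P i \<subset> P j" if "i < j" "j \<le> n" for i j
    using that
  proof (induction j)
    case (Suc j)
    then show ?case using assms(2)[of j] by (cases "i = j") auto
  qed simp
  let ?Ps = "map P [0..<Suc n]"
  have "sorted_wrt (\<subset>) ?Ps"
    unfolding sorted_wrt_iff_nth_less using lt by (simp del: upt_Suc)
  then have "?Ps \<in> {Ps. Ps \<noteq> [] \<and> (\<forall>P \<in> set Ps. primeideal P A) \<and> sorted_wrt (\<subset>) Ps}"
    using assms(1) by (auto simp del: upt_Suc)
  then have "enat (length ?Ps - 1) \<le> krull_dim A" unfolding krull_dim_def by (rule SUP_upper)
  then show ?thesis by simp
qed

lemma krull_dim_le:
  assumes "\<And>P n. (\<And>i. i \<le> n \<Longrightarrow> primeideal (P i) A) \<Longrightarrow> (\<And>i. i < n \<Longrightarrow> P i \<subset> P (Suc i)) \<Longrightarrow> enat n \<le> d"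
  shows "krull_dim A \<le> d"
  unfolding krull_dim_def
proof (rule SUP_least)
  fix Ps assume Ps: "Ps \<in> {Ps. Ps \<noteq> [] \<and> (\<forall>P \<in> set Ps. primeideal P A) \<and> sorted_wrt (\<subset>) Ps}"
  show "enat (length Ps - 1) \<le> d"
  proof (rule assms[of _ "\<lambda>i. Ps ! i"])
    fix i assume i: "i \<le> length Ps - 1"
    moreover have "0 < length Ps" using Ps by simp
    ultimately have "i < length Ps" by linarith
    then show "primeideal (Ps ! i) A" using Ps by simp
  qed (use Ps in \<open>auto simp: sorted_wrt_iff_nth_less\<close>)
qed

text \<open>The supremum is \<open>0\<close> for the zero ring too, so for \<open>n = 0\<close> a
  prime has to be supplied. For \<open>n = Suc k\<close> the number \<open>k\<close> is strictly
  below the supremum, hence below the length of some chain, which is then cut off.\<close>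

lemma krull_dim_chain:
  assumes "enat n \<le> krull_dim A" "\<exists>P. primeideal P A"
  obtains P where "\<And>i. i \<le> n \<Longrightarrow> primeideal (P i) A" "\<And>i. i < n \<Longrightarrow> P i \<subset> P (Suc i)"
proof (cases n)
  case 0
  obtain P where "primeideal P A" using assms(2) by blast
  then show ?thesis using that[of "\<lambda>_. P"] 0 by simp
next
  case (Suc k)
  have "enat k < krull_dim A" using assms(1) Suc by (metis Suc_ile_eq)
  then obtain Ps where Ps: "Ps \<noteq> []" "\<And>P. P \<in> set Ps \<Longrightarrow> primeideal P A" "sorted_wrt (\<subset>) Ps" "enat k < enat (length Ps - 1)"
    unfolding krull_dim_def less_SUP_iff by blast
  then have l: "n < length Ps" using Suc by auto
  show ?thesis
  proof (rule that[of "\<lambda>i. Ps ! i"])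
    show "primeideal (Ps ! i) A" if "i \<le> n" for i using that l Ps(2) by simp
    show "Ps ! i \<subset> Ps ! Suc i" if "i < n" for i using that l Ps(3) by (simp add: sorted_wrt_iff_nth_less)
  qed
qed

section \<open>Prime ideals along surjective homomorphisms\<close>

locale surj_hom = A: cring A + B: cring B for A (structure) and B (structure) +
  fixes h assumes hom: "h \<in> ring_hom A B" and surj: "h ` carrier A = carrier B"
begin

lemma h_simps:
  "a \<in> carrier A \<Longrightarrow> h a \<in> carrier B"
  "a \<in> carrier A \<Longrightarrow> b \<in> carrier A \<Longrightarrow> h (a \<oplus>\<^bsub>A\<^esub> b) = h a \<oplus>\<^bsub>B\<^esub> h b"
  "a \<in> carrier A \<Longrightarrow> b \<in> carrier A \<Longrightarrow> h (a \<otimes>\<^bsub>A\<^esub> b) = h a \<otimes>\<^bsub>B\<^esub> h b"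
  "h \<one>\<^bsub>A\<^esub> = \<one>\<^bsub>B\<^esub>"
  using ring_hom_memE[OF hom] by auto

lemma h_zero: "h \<zero>\<^bsub>A\<^esub> = \<zero>\<^bsub>B\<^esub>" using ring_hom_zero[OF hom A.ring_axioms B.ring_axioms] .

lemma vimage_ideal:
  assumes Q: "ideal Q B" shows "ideal {a \<in> carrier A. h a \<in> Q} A"
  by (rule A.ideal_of_closed)
    (auto simp: h_simps h_zero B.ideal_zero[OF Q] B.ideal_add[OF Q] B.ideal_mult[OF Q])

lemma image_noetherian:
  assumes "noetherian_ring A" shows "noetherian_ring B"
proof (rule B.noetherian_ring_of_acc)
  interpret N: noetherian_ring A by fact
  fix I :: "nat \<Rightarrow> 'c set" assume I: "\<And>n. ideal (I n) B" "\<And>n. I n \<subseteq> I (Suc n)"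
  have img: "I n = h ` {a \<in> carrier A. h a \<in> I n}" for n
  proof (intro equalityI subsetI)
    fix b assume b: "b \<in> I n"
    then have "b \<in> h ` carrier A" using B.ideal_sub[OF I(1)[of n]] surj by auto
    then show "b \<in> h ` {a \<in> carrier A. h a \<in> I n}" using b by auto
  qed auto
  have "\<exists>n. \<forall>m\<ge>n. {a \<in> carrier A. h a \<in> I m} = {a \<in> carrier A. h a \<in> I n}"
    by (rule N.acc, rule vimage_ideal[OF I(1)]) (use I(2) in blast)
  then obtain n where n: "\<And>m. m \<ge> n \<Longrightarrow> {a \<in> carrier A. h a \<in> I m} = {a \<in> carrier A. h a \<in> I n}" by blast
  have "I m = I n" if "m \<ge> n" for m by (subst (1 2) img) (simp only: n[OF that])
  then show "\<exists>n. \<forall>m\<ge>n. I m = I n" by blast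
qed

lemma vimage_prime:
  assumes Q: "primeideal Q B" shows "primeideal {a \<in> carrier A. h a \<in> Q} A"
proof -
  note Qi = B.prime_ideal[OF Q]
  show ?thesis
  proof (rule A.primeideal_of)
    show "ideal {a \<in> carrier A. h a \<in> Q} A" by (rule vimage_ideal[OF Qi])
    show "\<one>\<^bsub>A\<^esub> \<notin> {a \<in> carrier A. h a \<in> Q}" using B.prime_one[OF Q] h_simps by simp
  next
    fix a b assume ab: "a \<in> carrier A" "b \<in> carrier A" "a \<otimes>\<^bsub>A\<^esub> b \<in> {a \<in> carrier A. h a \<in> Q}"
    then have "h a \<otimes>\<^bsub>B\<^esub> h b \<in> Q" using h_simps by simp
    then have "h a \<in> Q \<or> h b \<in> Q" using B.prime_mult[OF Q, of "h a" "h b"] h_simps(1) ab by auto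
    then show "a \<in> {a \<in> carrier A. h a \<in> Q} \<or> b \<in> {a \<in> carrier A. h a \<in> Q}" using ab by simp
  qed
qed

lemma vimage_psubset:
  assumes "Q \<subset> Q'" "Q' \<subseteq> carrier B" shows "{a \<in> carrier A. h a \<in> Q} \<subset> {a \<in> carrier A. h a \<in> Q'}"
proof -
  obtain b where "b \<in> Q'" "b \<notin> Q" using assms by blast
  moreover then obtain a where "a \<in> carrier A" "h a = b" using surj assms by (metis imageE subsetD)
  ultimately show ?thesis using assms by blast
qed

context
  fixes P assumes P: "primeideal P A" and ker: "\<And>a. a \<in> carrier A \<Longrightarrow> h a = \<zero>\<^bsub>B\<^esub> \<Longrightarrow> a \<in> P"
begin

text \<open>Since \<open>P\<close> contains the kernel, it is a union of fibres of
  \<open>h\<close>.\<close>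

lemma image_mem_iff: 
  assumes a: "a \<in> carrier A" shows "h a \<in> h ` P \<longleftrightarrow> a \<in> P"
proof
  assume "h a \<in> h ` P"
  then obtain p where p: "p \<in> P" "h a = h p" by blast
  note Pi = A.prime_ideal[OF P]
  have pc: "p \<in> carrier A" using ideal.Icarr[OF Pi p(1)] .
  have "h (\<ominus>\<^bsub>A\<^esub> p \<oplus>\<^bsub>A\<^esub> a) = h (\<ominus>\<^bsub>A\<^esub> p \<oplus>\<^bsub>A\<^esub> p)" using p(2) a pc h_simps by simp
  then have "h (\<ominus>\<^bsub>A\<^esub> p \<oplus>\<^bsub>A\<^esub> a) = \<zero>\<^bsub>B\<^esub>" using pc h_zero by (simp add: A.l_neg)
  then have "\<ominus>\<^bsub>A\<^esub> p \<oplus>\<^bsub>A\<^esub> a \<in> P" using ker a pc by simp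
  then have "p \<oplus>\<^bsub>A\<^esub> (\<ominus>\<^bsub>A\<^esub> p \<oplus>\<^bsub>A\<^esub> a) \<in> P" using A.ideal_add[OF Pi p(1)] by simp
  then show "a \<in> P" using a pc by (simp add: A.r_neg2)
qed blast

lemma image_prime: "primeideal (h ` P) B"
proof -
  note Pi = A.prime_ideal[OF P]
  note Pc = ideal.Icarr[OF Pi]
  have lift: "\<exists>a \<in> carrier A. b = h a" if "b \<in> carrier B" for b using that surj by blast
  show ?thesis
  proof (rule B.primeideal_of)
    show "ideal (h ` P) B"
    proof (rule B.ideal_of_closed)
      show "h ` P \<subseteq> carrier B" using Pc h_simps by blast
      show "\<zero>\<^bsub>B\<^esub> \<in> h ` P" using A.ideal_zero[OF Pi] h_zero by (metis imageI)
    next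
      fix a b assume "a \<in> h ` P" "b \<in> h ` P"
      then obtain p q where "p \<in> P" "q \<in> P" "a = h p" "b = h q" by blast
      then have "a \<oplus>\<^bsub>B\<^esub> b = h (p \<oplus>\<^bsub>A\<^esub> q)" "p \<oplus>\<^bsub>A\<^esub> q \<in> P"
        using h_simps(2)[of p q] Pc[of p] Pc[of q] A.ideal_add[OF Pi, of p q] by simp_all
      then show "a \<oplus>\<^bsub>B\<^esub> b \<in> h ` P" by blast
    next
      fix r a assume "r \<in> carrier B" "a \<in> h ` P"
      then obtain s p where "s \<in> carrier A" "r = h s" "p \<in> P" "a = h p" using lift by blast
      then have "r \<otimes>\<^bsub>B\<^esub> a = h (s \<otimes>\<^bsub>A\<^esub> p)" "s \<otimes>\<^bsub>A\<^esub> p \<in> P"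
        using h_simps(3)[of s p] Pc[of p] A.ideal_mult[OF Pi, of p s] by simp_all
      then show "r \<otimes>\<^bsub>B\<^esub> a \<in> h ` P" by blast
    qed
    show "\<one>\<^bsub>B\<^esub> \<notin> h ` P" using image_mem_iff[of "\<one>\<^bsub>A\<^esub>"] A.prime_one[OF P] h_simps by simp
  next
    fix a b assume ab: "a \<in> carrier B" "b \<in> carrier B" "a \<otimes>\<^bsub>B\<^esub> b \<in> h ` P"
    then obtain c d where cd: "c \<in> carrier A" "a = h c" "d \<in> carrier A" "b = h d" using lift by blast
    then have "h (c \<otimes>\<^bsub>A\<^esub> d) \<in> h ` P" using ab h_simps by simp
    then have "c \<otimes>\<^bsub>A\<^esub> d \<in> P" using image_mem_iff cd by simp
    then have "c \<in> P \<or> d \<in> P" using A.prime_mult[OF P, of c d] cd by auto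
    then show "a \<in> h ` P \<or> b \<in> h ` P" using cd by blast
  qed
qed

end

lemma image_psubset:
  assumes "primeideal P A" "\<And>a. a \<in> carrier A \<Longrightarrow> h a = \<zero>\<^bsub>B\<^esub> \<Longrightarrow> a \<in> P" "P \<subset> P'" "P' \<subseteq> carrier A"
  shows "h ` P \<subset> h ` P'"
proof -
  obtain a where a: "a \<in> P'" "a \<notin> P" using assms by blast
  then have "a \<in> carrier A" using assms(4) by blast
  from image_mem_iff[OF assms(1,2) this] have "h a \<notin> h ` P" using a(2) by simp
  moreover have "h a \<in> h ` P'" using a(1) by (rule imageI)
  moreover have "h ` P \<subseteq> h ` P'" using assms(3) by (intro image_mono) simp
  ultimately show ?thesis by blast
qed

lemma krull_dim_image: "krull_dim B \<le> krull_dim A"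
proof (rule krull_dim_le)
  fix P n assume P: "\<And>i. i \<le> n \<Longrightarrow> primeideal (P i) B" "\<And>i. i < n \<Longrightarrow> P i \<subset> P (Suc i)"
  show "enat n \<le> krull_dim A"
  proof (rule krull_dim_ge[of n "\<lambda>i. {a \<in> carrier A. h a \<in> P i}"])
    show "primeideal {a \<in> carrier A. h a \<in> P i} A" if "i \<le> n" for i using vimage_prime[OF P(1)[OF that]] .
    show "{a \<in> carrier A. h a \<in> P i} \<subset> {a \<in> carrier A. h a \<in> P (Suc i)}" if "i < n" for i
    proof -
      have "Suc i \<le> n" using that by simp
      from B.ideal_sub[OF B.prime_ideal[OF P(1)[OF this]]] show ?thesis by (rule vimage_psubset[OF P(2)[OF that]])
    qed
  qed
qed

text \<open>Nilpotent elements lie in every prime, so every prime of \<open>A\<close> contains the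
  kernel, and chains can be pushed forward without collapsing.\<close>

lemma krull_dim_nil_kernel:
  assumes "\<And>a. a \<in> carrier A \<Longrightarrow> h a = \<zero>\<^bsub>B\<^esub> \<Longrightarrow> \<exists>n::nat. a [^]\<^bsub>A\<^esub> n = \<zero>\<^bsub>A\<^esub>"
  shows "krull_dim B = krull_dim A"
proof (rule antisym[OF krull_dim_image], rule krull_dim_le)
  fix P n assume P: "\<And>i. i \<le> n \<Longrightarrow> primeideal (P i) A" "\<And>i. i < n \<Longrightarrow> P i \<subset> P (Suc i)"
  have ker: "a \<in> P i" if a: "a \<in> carrier A" "h a = \<zero>\<^bsub>B\<^esub>" and i: "i \<le> n" for a i
  proof -
    obtain m :: nat where "a [^]\<^bsub>A\<^esub> m = \<zero>\<^bsub>A\<^esub>" using assms[OF a] by blast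
    then show ?thesis using A.prime_pow[OF P(1)[OF i] a(1), of m] A.ideal_zero[OF A.prime_ideal[OF P(1)[OF i]]] by simp
  qed
  show "enat n \<le> krull_dim B"
  proof (rule krull_dim_ge[of n "\<lambda>i. h ` P i"])
    show "primeideal (h ` P i) B" if "i \<le> n" for i by (rule image_prime[OF P(1)[OF that] ker[OF _ _ that]])
    show "h ` P i \<subset> h ` P (Suc i)" if "i < n" for i
    proof -
      have "Suc i \<le> n" and i: "i \<le> n" using that by simp_all
      note sub = A.ideal_sub[OF A.prime_ideal[OF P(1)[OF this(1)]]]
      show ?thesis by (rule image_psubset[OF P(1)[OF i] _ P(2)[OF that] sub]) (rule ker[OF _ _ i])
    qed
  qed
qed

end

lemma (in cring) krull_dim_quotient_nil:
  assumes I: "ideal I R" and nil: "\<And>a. a \<in> I \<Longrightarrow> \<exists>n::nat. a [^] n = \<zero>"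
  shows "krull_dim (R Quot I) = krull_dim R"
proof -
  interpret I: ideal I R by fact
  interpret surj_hom R "R Quot I" "(+>) I"
  proof (rule surj_hom.intro[OF is_cring I.quotient_is_cring[OF is_cring]], unfold_locales)
    show "(+>) I \<in> ring_hom R (R Quot I)" by (rule I.rcos_ring_hom)
    show "(+>) I ` carrier R = carrier (R Quot I)" by (auto simp: FactRing_def A_RCOSETS_def')
  qed
  show ?thesis
  proof (rule krull_dim_nil_kernel)
    fix a assume "a \<in> carrier R" "I +> a = \<zero>\<^bsub>R Quot I\<^esub>"
    then have "a \<in> I" using I.a_rcos_self by (force simp: FactRing_def)
    then show "\<exists>n::nat. a [^] n = \<zero>" by (rule nil)
  qed
qed

section \<open>The extended Rees algebra\<close>

text \<open>The recursion follows \<open>submod_power\<close>, with which it agrees over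
  \<open>even_ring R\<close>: there the zeroth power is \<open>even_part R\<close>.\<close>

primrec ipow :: "('a, 'b) ring_scheme \<Rightarrow> 'a set \<Rightarrow> nat \<Rightarrow> 'a set" where
  "ipow A J 0 = carrier A"
| "ipow A J (Suc k) = ipow A J k \<cdot>\<^bsub>A\<^esub> J"

context cring
begin

lemma ipow_ideal: "ideal J R \<Longrightarrow> ideal (ipow R J k) R"
  by (induction k) (auto intro: oneideal ideal_prod_is_ideal)

lemma ipow_1: "ideal J R \<Longrightarrow> ipow R J (Suc 0) = J"
  using ideal_prod_one by (simp add: ideal_prod_commute[OF oneideal])

lemma ipow_add: "ideal J R \<Longrightarrow> ipow R J (k + l) = ipow R J k \<cdot>\<^bsub>R\<^esub> ipow R J l"
proof (induction l)
  case 0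
  then show ?case using ideal_prod_one[OF ipow_ideal[OF 0, of k]] by simp
next
  case (Suc l)
  then show ?case using ideal_prod_assoc[of "ipow R J k" "ipow R J l" J] ipow_ideal by simp
qed

lemma ipow_mult: "ideal J R \<Longrightarrow> a \<in> ipow R J k \<Longrightarrow> b \<in> ipow R J l \<Longrightarrow> a \<otimes> b \<in> ipow R J (k + l)"
  using ipow_add ideal_prod.prod by metis

lemma ipow_antimono:
  assumes "ideal J R" "k \<le> l" shows "ipow R J l \<subseteq> ipow R J k"
  using assms(2)
proof (induction l rule: dec_induct)
  case (step l)
  then show ?case using ideal_prod_inter[OF ipow_ideal[OF assms(1), of l] assms(1)] by auto
qed simp

lemma ideal_subgroup: "ideal I R \<Longrightarrow> additive_subgroup I R" by (simp add: ideal.axioms(1))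

text \<open>\<open>nat\<close> sends negative degrees to \<open>0\<close>, where the power is the
  whole ring. So T^-1 belongs to the algebra, which makes it the extended Rees algebra.\<close>

definition rees :: "'a set \<Rightarrow> (int \<Rightarrow> 'a) set"
  where "rees J = graded_subring (\<lambda>k. ipow R J (nat k))"

lemma rees_subring: assumes "ideal J R" shows "subring (rees J) gring"
  unfolding rees_def
proof (rule graded_subring)
  show "\<And>i::int. additive_subgroup (ipow R J (nat i)) R" using ideal_subgroup[OF ipow_ideal[OF assms]] .
  fix i j :: int and a b assume "a \<in> ipow R J (nat i)" "b \<in> ipow R J (nat j)"
  then have "a \<otimes> b \<in> ipow R J (nat i + nat j)" by (rule ipow_mult[OF assms])
  moreover have "nat (i + j) \<le> nat i + nat j" by simp
  ultimately show "a \<otimes> b \<in> ipow R J (nat (i + j))" using ipow_antimono[OF assms] by blast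
qed simp

lemma gmon_rees: "a \<in> ipow R J (nat k) \<Longrightarrow> ideal J R \<Longrightarrow> gmon R k a \<in> rees J"
proof -
  assume a: "a \<in> ipow R J (nat k)" and J: "ideal J R"
  have "a \<in> carrier R" using a ideal.Icarr[OF ipow_ideal[OF J]] by blast
  then show ?thesis using a ideal_zero[OF ipow_ideal[OF J]]
    by (auto simp: rees_def graded_subring_def gmon_closed) (auto simp: gmon_def)
qed

lemma rees_mem: "f \<in> rees J \<Longrightarrow> f \<in> carrier gring" "f \<in> rees J \<Longrightarrow> f k \<in> ipow R J (nat k)"
  by (auto simp: rees_def graded_subring_def)

lemma subring_prime:
  assumes W: "subring W R" and Q: "primeideal Q R" shows "primeideal {a \<in> W. a \<in> Q} (R\<lparr>carrier := W\<rparr>)"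
proof -
  interpret S: cring "R\<lparr>carrier := W\<rparr>" using subring_cring[OF W] .
  note Qi = prime_ideal[OF Q]
  note w = subringE[OF W]
  show ?thesis
  proof (rule S.primeideal_of)
    show "ideal {a \<in> W. a \<in> Q} (R\<lparr>carrier := W\<rparr>)"
      using w(1) by (intro S.ideal_of_closed) (auto simp: ideal_zero[OF Qi] ideal_add[OF Qi] ideal_mult[OF Qi] subset_iff w(2,6,7))
    show "\<one>\<^bsub>R\<lparr>carrier := W\<rparr>\<^esub> \<notin> {a \<in> W. a \<in> Q}" using prime_one[OF Q] by simp
    fix a b assume ab: "a \<in> carrier (R\<lparr>carrier := W\<rparr>)" "b \<in> carrier (R\<lparr>carrier := W\<rparr>)"
      "a \<otimes>\<^bsub>R\<lparr>carrier := W\<rparr>\<^esub> b \<in> {a \<in> W. a \<in> Q}"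
    then have "a \<in> Q \<or> b \<in> Q" using prime_mult[OF Q, of a b] w(1) by auto
    then show "a \<in> {a \<in> W. a \<in> Q} \<or> b \<in> {a \<in> W. a \<in> Q}" using ab by auto
  qed
qed

lemma adjoin_minimal:
  assumes W: "subring W R" "S \<subseteq> W" "z \<in> W" shows "adjoin S z \<subseteq> W"
proof -
  note w = subringE[OF W(1)]
  have pw: "z [^] n \<in> W" for n :: nat by (induction n) (use w W in auto)
  have "polys S z n \<subseteq> W" for n
  proof (induction n)
    case (Suc n)
    show ?case
    proof
      fix u assume "u \<in> polys S z (Suc n)"
      then obtain s v where "s \<in> S" "v \<in> polys S z n" "u = s \<otimes> z [^] n \<oplus> v" by auto
      then show "u \<in> W" using w(6,7) pw W(2) Suc by (metis subsetD)
    qed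
  qed (use w in simp)
  then show ?thesis by (auto simp: adjoin_def)
qed

text \<open>Hilbert's basis theorem is iterated along the list. Minimality of \<open>S'\<close> is
  recorded in order to identify it with the extended Rees algebra.\<close>

lemma adjoin_list:
  assumes "subring S R" "noetherian_ring (R\<lparr>carrier := S\<rparr>)" "set zs \<subseteq> carrier R"
  shows "\<exists>S'. subring S' R \<and> noetherian_ring (R\<lparr>carrier := S'\<rparr>) \<and> S \<subseteq> S' \<and> set zs \<subseteq> S' \<and>
    (\<forall>W. subring W R \<longrightarrow> S \<subseteq> W \<longrightarrow> set zs \<subseteq> W \<longrightarrow> S' \<subseteq> W)"
  using assms
proof (induction zs arbitrary: S)
  case Nil then show ?case by (intro exI[of _ S]) auto
next
  case (Cons z zs)
  then have z: "z \<in> carrier R" and zs: "set zs \<subseteq> carrier R" by auto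
  obtain S' where S': "subring S' R" "noetherian_ring (R\<lparr>carrier := S'\<rparr>)" "adjoin S z \<subseteq> S'" "set zs \<subseteq> S'"
    "\<And>W. subring W R \<Longrightarrow> adjoin S z \<subseteq> W \<Longrightarrow> set zs \<subseteq> W \<Longrightarrow> S' \<subseteq> W"
    using Cons.IH[OF adjoin_subring[OF Cons(2) z] adjoin_noetherian[OF Cons(2) z Cons(3)] zs] by blast
  have "S \<subseteq> S'" "z \<in> S'" using S'(3) adjoin_incl[OF Cons(2) z] adjoin_gen[OF Cons(2) z] by auto
  moreover have "S' \<subseteq> W" if "subring W R" "S \<subseteq> W" "set (z # zs) \<subseteq> W" for W
    using S'(5)[OF that(1) adjoin_minimal[OF that(1,2)]] that(3) by simp
  ultimately show ?case using S' by (intro exI[of _ S']) simp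
qed

lemma gmon_zero: "gmon R k \<zero> = \<zero>\<^bsub>gring\<^esub>" by (simp add: gmon_def gring_zero)

text \<open>The algebra is generated over the constants by T^-1 and the elements \<open>g\<close> T,
  for \<open>g\<close> in a finite generating set of \<open>J\<close>.\<close>

lemma rees_noetherian:
  assumes R: "noetherian_ring R" and J: "ideal J R"
  shows "noetherian_ring ((gring :: (int \<Rightarrow> 'a) ring)\<lparr>carrier := rees J\<rparr>)"
proof -
  interpret N: noetherian_ring R by fact
  interpret L: cring "gring :: (int \<Rightarrow> 'a) ring" by (rule gring_cring)
  define S :: "(int \<Rightarrow> 'a) set" where "S = gmon R 0 ` carrier R"
  have S: "subring S gring"
  proof (rule L.subringI)
    show "S \<subseteq> carrier gring" by (auto simp: S_def gmon_closed)
    show "\<one>\<^bsub>gring\<^esub> \<in> S" by (simp add: S_def gring_one)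
    fix f assume "f \<in> S"
    then obtain a where a: "a \<in> carrier R" "f = gmon R 0 a" by (auto simp: S_def)
    have "gmon R 0 (\<ominus> a) \<oplus>\<^bsub>gring\<^esub> f = \<zero>\<^bsub>gring\<^esub>"
      using a by (simp add: gmon_add l_neg gmon_zero)
    then have "\<ominus>\<^bsub>gring\<^esub> f = gmon R 0 (\<ominus> a)" using a by (intro L.minus_equality) (auto simp: gmon_closed)
    then show "\<ominus>\<^bsub>gring\<^esub> f \<in> S" using a by (simp add: S_def)
  next
    fix f g assume "f \<in> S" "g \<in> S"
    then obtain a b where ab: "a \<in> carrier R" "f = gmon R 0 a" "b \<in> carrier R" "g = gmon R 0 b" by (auto simp: S_def)
    then show "f \<otimes>\<^bsub>gring\<^esub> g \<in> S" "f \<oplus>\<^bsub>gring\<^esub> g \<in> S"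
      using gmon_mult[of a b "0::int" 0] by (simp_all add: S_def gmon_add)
  qed
  have SN: "noetherian_ring (gring\<lparr>carrier := S\<rparr>)"
  proof -
    interpret SC: cring "gring\<lparr>carrier := S\<rparr>" using L.subring_cring[OF S] .
    interpret surj_hom R "gring\<lparr>carrier := S\<rparr>" "gmon R 0"
    proof unfold_locales
      show "gmon R 0 \<in> ring_hom R (gring\<lparr>carrier := S\<rparr>)"
        by (rule ring_hom_memI) (auto simp: S_def gmon_mult gmon_add gring_one)
      show "gmon R 0 ` carrier R = carrier (gring\<lparr>carrier := S\<rparr>)" by (simp add: S_def)
    qed
    show ?thesis by (rule image_noetherian[OF R])
  qed
  obtain A where A: "A \<subseteq> carrier R" "finite A" "J = Idl A" using N.finetely_gen[OF J] by blast
  obtain gs where gs: "set gs = A" using finite_list[OF A(2)] by blast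
  have AJ: "A \<subseteq> J" using A genideal_self by simp
  define u :: "int \<Rightarrow> 'a" where "u = gmon R (- 1) \<one>"
  define zs where "zs = u # map (gmon R (1::int)) gs"
  have zsc: "set zs \<subseteq> carrier gring" using A gs by (auto simp: zs_def u_def gmon_closed)
  obtain S' where S': "subring S' gring" "noetherian_ring (gring\<lparr>carrier := S'\<rparr>)" "S \<subseteq> S'" "set zs \<subseteq> S'"
     and min: "\<And>W. subring W gring \<Longrightarrow> S \<subseteq> W \<Longrightarrow> set zs \<subseteq> W \<Longrightarrow> S' \<subseteq> W"
    using L.adjoin_list[OF S SN zsc] by blast
  note cl = subringE[OF S'(1)]
  have uS: "u \<in> S'" and gS: "\<And>g. g \<in> A \<Longrightarrow> gmon R 1 g \<in> S'" and aS: "\<And>a. a \<in> carrier R \<Longrightarrow> gmon R 0 a \<in> S'"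
    using S' gs by (auto simp: zs_def S_def)
  have neg: "gmon R (- int j) a \<in> S'" if a: "a \<in> carrier R" for j a
  proof (induction j)
    case 0 then show ?case using aS[OF a] by simp
  next
    case (Suc j)
    have "u \<otimes>\<^bsub>gring\<^esub> gmon R (- int j) a = gmon R (- int (Suc j)) a"
      using a by (simp add: u_def gmon_mult algebra_simps)
    then show ?case using cl(6)[OF uS Suc] by simp
  qed
  have ic: "ideal (ipow R J k) R" for k using ipow_ideal[OF J] .
  have pos: "gmon R (int k) a \<in> S'" if "a \<in> ipow R J k" for k a
    using that
  proof (induction k arbitrary: a)
    case 0 then show ?case using aS by simp
  next
    case (Suc k)
    \<comment> \<open>The next power consists of sums of products \<open>b \<otimes> c\<close> with
      \<open>c\<close> in \<open>J\<close>. Those \<open>c\<close> that work for all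
      \<open>b\<close> form an ideal, so it is enough to treat generators of
      \<open>J\<close>.\<close>
    let ?C = "{c \<in> carrier R. \<forall>b \<in> ipow R J k. gmon R (int (Suc k)) (b \<otimes> c) \<in> S'}"
    have "ideal ?C R"
    proof (rule ideal_of_closed)
      show "\<zero> \<in> ?C" using ideal.Icarr[OF ic] cl(2) by (simp add: gmon_zero)
    next
      fix c c' assume c: "c \<in> ?C" "c' \<in> ?C"
      have "gmon R (int (Suc k)) (b \<otimes> (c \<oplus> c')) \<in> S'" if b: "b \<in> ipow R J k" for b
      proof -
        have bc: "b \<in> carrier R" using b ideal.Icarr[OF ic] by simp
        have "gmon R (int (Suc k)) (b \<otimes> (c \<oplus> c')) = gmon R (int (Suc k)) (b \<otimes> c) \<oplus>\<^bsub>gring\<^esub> gmon R (int (Suc k)) (b \<otimes> c')"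
          using c bc by (simp add: gmon_add r_distr)
        then show ?thesis using cl(7) c b by auto
      qed
      then show "c \<oplus> c' \<in> ?C" using c by auto
    next
      fix r c assume r: "r \<in> carrier R" and c: "c \<in> ?C"
      have "gmon R (int (Suc k)) (b \<otimes> (r \<otimes> c)) \<in> S'" if b: "b \<in> ipow R J k" for b
      proof -
        have bc: "b \<in> carrier R" using b ideal.Icarr[OF ic] by simp
        have "b \<otimes> r \<in> ipow R J k" using ideal.I_r_closed[OF ic b r] .
        then have "gmon R (int (Suc k)) ((b \<otimes> r) \<otimes> c) \<in> S'" using c by blast
        then show ?thesis using bc r c by (simp add: m_assoc)
      qed
      then show "r \<otimes> c \<in> ?C" using r c by auto
    qed auto
    moreover have "A \<subseteq> ?C"
    proof
      fix g assume g: "g \<in> A"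
      then have gc: "g \<in> carrier R" using A by auto
      have "gmon R (int (Suc k)) (b \<otimes> g) \<in> S'" if b: "b \<in> ipow R J k" for b
      proof -
        have bc: "b \<in> carrier R" using b ideal.Icarr[OF ic] by simp
        have "gmon R (int k) b \<otimes>\<^bsub>gring\<^esub> gmon R 1 g = gmon R (int (Suc k)) (b \<otimes> g)"
          using bc gc by (simp add: gmon_mult add.commute)
        then show ?thesis using cl(6)[OF Suc.IH[OF b] gS[OF g]] by simp
      qed
      then show "g \<in> ?C" using gc by simp
    qed
    ultimately have JC: "J \<subseteq> ?C" unfolding A(3) by (rule genideal_minimal)
    have "a \<in> ipow R J k \<cdot>\<^bsub>R\<^esub> J" using Suc(2) by simp
    then show ?case
    proof induction
      case (prod b c) then show ?case using JC by blast
    next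
      case (sum s t)
      have "s \<in> carrier R" "t \<in> carrier R"
        using sum(1,2) ideal.Icarr[OF ideal_prod_is_ideal[OF ic J]] by auto
      then show ?case using cl(7)[OF sum(3,4)] by (simp add: gmon_add)
    qed
  qed
  have "rees J \<subseteq> S'"
  proof
    fix f assume f: "f \<in> rees J"
    show "f \<in> S'"
    proof (rule gring_gmon_span[OF rees_mem(1)[OF f] cl(2)])
      show "g \<oplus>\<^bsub>gring\<^esub> h \<in> S'" if "g \<in> S'" "h \<in> S'" for g h using cl(7) that .
      fix k :: int
      show "gmon R k (f k) \<in> S'"
      proof (cases "0 \<le> k")
        case True
        then show ?thesis using pos[of "f k" "nat k"] rees_mem(2)[OF f, of k] by simp
      next
        case False
        then show ?thesis using neg[of "f k" "nat (- k)"] gring_memD(1)[OF rees_mem(1)[OF f]] by simp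
      qed
    qed
  qed
  moreover have "S' \<subseteq> rees J"
  proof (rule min[OF rees_subring[OF J]])
    show "S \<subseteq> rees J" using gmon_rees[OF _ J, of _ 0] by (auto simp: S_def)
    have "gmon R 1 g \<in> rees J" if "g \<in> A" for g
      using gmon_rees[OF _ J, of g 1] ipow_1[OF J] AJ that by auto
    moreover have "u \<in> rees J" unfolding u_def using gmon_rees[OF _ J, of "\<one>" "- 1"] by simp
    ultimately show "set zs \<subseteq> rees J" using gs by (auto simp: zs_def)
  qed
  ultimately have "rees J = S'" by simp
  then show ?thesis using S'(2) by simp
qed

text \<open>
  The lifts of the \<open>P\<^sub>i\<close> to the extended Rees algebra form a chain that is extended by the maximal
  ideal lying over \<open>M\<close>, which contains \<open>T\<^sup>-\<^sup>1\<close>. Krull's principal ideal theorem turns it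
  into a chain that is shorter by one, but lies entirely above \<open>T\<^sup>-\<^sup>1\<close>.
\<close>
lemma rees_prime_chain:
  assumes R: "noetherian_ring R" and J: "ideal J R" and M: "primeideal M R" "J \<subseteq> M"
    and P: "\<And>i. i \<le> n \<Longrightarrow> primeideal (P i) R" "\<And>i. i < n \<Longrightarrow> P i \<subset> P (Suc i)" and PM: "P n \<subseteq> M"
  shows "\<exists>T. (\<forall>i\<le>n. primeideal (T i) ((gring :: (int \<Rightarrow> 'a) ring)\<lparr>carrier := rees J\<rparr>) \<and> gmon R (- 1) \<one> \<in> T i) \<and>
    (\<forall>i<n. T i \<subset> T (Suc i))"
proof -
  let ?W = "(gring :: (int \<Rightarrow> 'a) ring)\<lparr>carrier := rees J\<rparr>"
  interpret L: cring "gring :: (int \<Rightarrow> 'a) ring" by (rule gring_cring)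
  interpret WC: cring ?W by (rule L.subring_cring[OF rees_subring[OF J]])
  interpret W: noetherian_cring ?W
    by (intro noetherian_cring.intro rees_noetherian R J WC.is_cring)
  note w = subringE[OF rees_subring[OF J]]
  note Mi = prime_ideal[OF M(1)]
  \<comment> \<open>The prime \<open>P i\<close> is extended to all Laurent polynomials and
    contracted to the Rees algebra.\<close>
  define Q where "Q i = {f \<in> rees J. f \<in> {f \<in> carrier gring. \<forall>k. f k \<in> P i}}" for i
  have Q: "primeideal (Q i) ?W" if "i \<le> n" for i
    unfolding Q_def by (rule L.subring_prime[OF rees_subring[OF J] gring_prime[OF P(1)[OF that]]])
  have Qinc: "Q i \<subset> Q (Suc i)" if i: "i < n" for i
  proof -
    obtain a where a: "a \<in> P (Suc i)" "a \<notin> P i" using P(2)[OF i] by blast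
    have Si: "Suc i \<le> n" using i by simp
    have ac: "a \<in> carrier R" using ideal.Icarr[OF prime_ideal[OF P(1)[OF Si]] a(1)] .
    have "gmon R 0 a \<in> rees J" using gmon_rees[OF _ J, of a 0] ac by simp
    then have "gmon R 0 a \<in> Q (Suc i)" using a ideal_zero[OF prime_ideal[OF P(1)[OF Si]]] gmon_closed[OF ac]
      by (auto simp: Q_def gmon_def)
    moreover have "gmon R 0 a \<notin> Q i" using a by (auto simp: Q_def gmon_def)
    moreover have "Q i \<subseteq> Q (Suc i)" using P(2)[OF i] by (auto simp: Q_def)
    ultimately show ?thesis by blast
  qed
  \<comment> \<open>Only the constant coefficient is restricted. This still gives a prime ideal,
    because a product of coefficients in opposite nonzero degrees has a factor in \<open>J\<close>,
    which lies in \<open>M\<close>; so taking the constant coefficient is multiplicative modulo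
    \<open>M\<close>.\<close>
  define N where "N = {f \<in> rees J. f 0 \<in> M}"
  have JM: "f k \<in> M" if f: "f \<in> rees J" and k: "0 < k" for f k
  proof -
    have "f k \<in> ipow R J (nat k)" using rees_mem(2)[OF f] .
    also have "\<dots> \<subseteq> ipow R J (Suc 0)" using k by (intro ipow_antimono[OF J]) simp
    finally show ?thesis using ipow_1[OF J] M(2) by auto
  qed
  have mult0: "\<exists>m \<in> M. (f \<otimes>\<^bsub>gring\<^esub> g) 0 = f 0 \<otimes> g 0 \<oplus> m" if f: "f \<in> rees J" and g: "g \<in> rees J" for f g
  proof -
    note fc = gring_memD[OF rees_mem(1)[OF f]] and gc = gring_memD[OF rees_mem(1)[OF g]]
    let ?S = "{i. f i \<noteq> \<zero>}" and ?t = "\<lambda>i. f i \<otimes> g (0 - i)"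
    have "(f \<otimes>\<^bsub>gring\<^esub> g) 0 = finsum R ?t (insert 0 (?S - {0}))"
      by (rule gring_mult[OF rees_mem(1)[OF f] rees_mem(1)[OF g]]) (use fc(2) in auto)
    also have "\<dots> = ?t 0 \<oplus> finsum R ?t (?S - {0})"
      using fc gc by (intro finsum_insert) auto
    finally have eq: "(f \<otimes>\<^bsub>gring\<^esub> g) 0 = f 0 \<otimes> g 0 \<oplus> finsum R ?t (?S - {0})" by simp
    have "?t i \<in> M" if "i \<noteq> 0" for i
    proof (cases "0 < i")
      case True
      then show ?thesis using JM[OF f True] ideal.I_r_closed[OF Mi] gc(1) by simp
    next
      case False
      then have "0 < - i" using that by simp
      from JM[OF g this] show ?thesis using ideal_mult[OF Mi] fc(1) by simp
    qed
    then have "finsum R ?t (?S - {0}) \<in> M"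
      by (intro finsum_in[OF ideal_zero[OF Mi] ideal_add[OF Mi] ideal_sub[OF Mi]]) auto
    then show ?thesis using eq by blast
  qed
  have c0: "f 0 \<in> carrier R" if "f \<in> rees J" for f using gring_memD(1)[OF rees_mem(1)[OF that]] .
  have N: "primeideal N ?W"
  proof (rule WC.primeideal_of)
    show "ideal N ?W"
    proof (rule WC.ideal_of_closed)
      fix r f assume "r \<in> carrier ?W" "f \<in> N"
      then have r: "r \<in> rees J" "f \<in> rees J" "f 0 \<in> M" by (auto simp: N_def)
      obtain m where "m \<in> M" "(r \<otimes>\<^bsub>gring\<^esub> f) 0 = r 0 \<otimes> f 0 \<oplus> m" using mult0[OF r(1,2)] by blast
      then have "(r \<otimes>\<^bsub>gring\<^esub> f) 0 \<in> M" using ideal_add[OF Mi ideal_mult[OF Mi r(3) c0[OF r(1)]]] by simp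
      then show "r \<otimes>\<^bsub>?W\<^esub> f \<in> N" using w(6)[OF r(1,2)] by (simp add: N_def)
    next
      show "\<zero>\<^bsub>?W\<^esub> \<in> N" using w(2) ideal_zero[OF Mi] by (simp add: N_def gring_zero)
      fix f g assume "f \<in> N" "g \<in> N"
      then show "f \<oplus>\<^bsub>?W\<^esub> g \<in> N" using w(7) ideal_add[OF Mi] by (simp add: N_def gring_add)
    qed (auto simp: N_def)
    show "\<one>\<^bsub>?W\<^esub> \<notin> N" using prime_one[OF M(1)] by (simp add: N_def gring_one gmon_def)
  next
    fix f g assume fg': "f \<in> carrier ?W" "g \<in> carrier ?W" "f \<otimes>\<^bsub>?W\<^esub> g \<in> N"
    then have fg: "f \<in> rees J" "g \<in> rees J" "(f \<otimes>\<^bsub>gring\<^esub> g) 0 \<in> M" by (auto simp: N_def)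
    obtain m where m: "m \<in> M" "(f \<otimes>\<^bsub>gring\<^esub> g) 0 = f 0 \<otimes> g 0 \<oplus> m" using mult0[OF fg(1,2)] by blast
    have "f 0 \<otimes> g 0 = (f \<otimes>\<^bsub>gring\<^esub> g) 0 \<ominus> m"
      unfolding m(2) using c0[OF fg(1)] c0[OF fg(2)] ideal.Icarr[OF Mi m(1)] by (simp add: a_minus_def a_assoc r_neg)
    then have "f 0 \<otimes> g 0 \<in> M" using ideal_minus[OF Mi fg(3) m(1)] by simp
    then have "f 0 \<in> M \<or> g 0 \<in> M" using prime_mult[OF M(1) c0[OF fg(1)] c0[OF fg(2)]] by blast
    then show "f \<in> N \<or> g \<in> N" using fg by (simp add: N_def)
  qed
  have u: "gmon R (- 1) \<one> \<in> rees J" using gmon_rees[OF _ J, of "\<one>" "- 1"] by simp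
  then have uN: "gmon R (- 1) \<one> \<in> N" using ideal_zero[OF Mi] by (simp add: N_def gmon_def)
  \<comment> \<open>The coefficient \<one> of T^-1 is not in \<open>P n\<close>, so the last
    inclusion is strict even if \<open>P n = M\<close>.\<close>
  have "gmon R (- 1) \<one> \<notin> Q n" using prime_one[OF P(1)[OF order_refl]] by (auto simp: Q_def gmon_def)
  moreover have "Q n \<subseteq> N" using PM by (auto simp: Q_def N_def)
  ultimately have "Q n \<subset> N" using uN by blast
  from W.prime_chain_through_element[OF Q Qinc N this uN] show ?thesis by blast
qed

end

section \<open>Products of additive subsets\<close>

context ring
begin

lemma ideal_prod_subset:
  assumes "\<And>a b. a \<in> A \<Longrightarrow> b \<in> B \<Longrightarrow> a \<otimes> b \<in> C" "\<And>a b. a \<in> C \<Longrightarrow> b \<in> C \<Longrightarrow> a \<oplus> b \<in> C"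
  shows "A \<cdot> B \<subseteq> C"
proof
  fix x assume "x \<in> A \<cdot> B" then show "x \<in> C" by induction (use assms in auto)
qed

lemma ideal_prod_carrier: "A \<subseteq> carrier R \<Longrightarrow> B \<subseteq> carrier R \<Longrightarrow> A \<cdot> B \<subseteq> carrier R"
  by (rule ideal_prod_subset) auto

lemma ideal_prod_mono: "A \<subseteq> A' \<Longrightarrow> B \<subseteq> B' \<Longrightarrow> A \<cdot> B \<subseteq> A' \<cdot> B'"
  by (rule ideal_prod_subset) (auto intro: ideal_prod.intros)

text \<open>The factors will be additive subsets such as \<open>N \<inter> odd_part R\<close>, not
  ideals. Associativity follows from the distributive laws by induction over sums of
  products.\<close>

lemma ideal_prod_set_assoc:
  assumes c: "A \<subseteq> carrier R" "B \<subseteq> carrier R" "C \<subseteq> carrier R"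
  shows "(A \<cdot> B) \<cdot> C = A \<cdot> (B \<cdot> C)"
proof
  note p = ideal_prod_carrier
  show "(A \<cdot> B) \<cdot> C \<subseteq> A \<cdot> (B \<cdot> C)"
  proof (rule ideal_prod_subset)
    fix x z assume x: "x \<in> A \<cdot> B" and z: "z \<in> C"
    from x show "x \<otimes> z \<in> A \<cdot> (B \<cdot> C)"
    proof induction
      case (prod a b)
      have "a \<otimes> (b \<otimes> z) \<in> A \<cdot> (B \<cdot> C)" using prod z by (intro ideal_prod.prod)
      then show ?case using prod z c by (simp add: m_assoc subset_iff)
    next
      case (sum x y)
      then have "x \<in> carrier R" "y \<in> carrier R" using p[OF c(1,2)] by auto
      then show ?case using sum z c by (simp add: l_distr subset_iff ideal_prod.sum)
    qed
  qed (rule ideal_prod.sum)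
  show "A \<cdot> (B \<cdot> C) \<subseteq> (A \<cdot> B) \<cdot> C"
  proof (rule ideal_prod_subset)
    fix z x assume z: "z \<in> A" and x: "x \<in> B \<cdot> C"
    from x show "z \<otimes> x \<in> (A \<cdot> B) \<cdot> C"
    proof induction
      case (prod a b)
      have "(z \<otimes> a) \<otimes> b \<in> (A \<cdot> B) \<cdot> C" using prod z by (intro ideal_prod.prod)
      then show ?case using prod z c by (simp add: m_assoc subset_iff)
    next
      case (sum x y)
      then have "x \<in> carrier R" "y \<in> carrier R" using p[OF c(2,3)] by auto
      then show ?case using sum z c by (simp add: r_distr subset_iff ideal_prod.sum)
    qed
  qed (rule ideal_prod.sum)
qed

text \<open>Signs can be moved into the second factor, and a product with its zero gives zero, so
  the first factor may be any nonempty set.\<close>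

lemma ideal_prod_subgroup:
  assumes A: "A \<subseteq> carrier R" "A \<noteq> {}" and B: "additive_subgroup B R"
  shows "additive_subgroup (A \<cdot> B) R"
proof -
  interpret B: additive_subgroup B R by fact
  note c = ideal_prod_carrier[OF A(1) B.a_subset]
  have neg: "\<ominus> x \<in> A \<cdot> B" if "x \<in> A \<cdot> B" for x
    using that
  proof induction
    case (prod a b)
    have "a \<otimes> (\<ominus> b) \<in> A \<cdot> B" using prod by (intro ideal_prod.prod) auto
    then show ?case using prod A B.a_subset by (simp add: r_minus subset_iff)
  next
    case (sum x y)
    then have "x \<in> carrier R" "y \<in> carrier R" using c by auto
    then show ?case using sum ideal_prod.sum by (simp add: minus_add)
  qed
  obtain a where a: "a \<in> A" using A(2) by blast
  have "a \<otimes> \<zero> \<in> A \<cdot> B" using a B.zero_closed by (rule ideal_prod.prod)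
  then have "\<zero> \<in> A \<cdot> B" using a A by auto
  then have "subgroup (A \<cdot> B) (add_monoid R)"
    using c neg by (intro add.subgroupI) (auto simp: a_inv_def intro: ideal_prod.sum)
  then show ?thesis by (rule additive_subgroupI)
qed

end

text \<open>Modulo \<open>a\<close> the powers of \<open>a \<oplus> b\<close> are those of
  \<open>b\<close>. Hence the n-th power is a multiple of \<open>a\<close>, and the m-th power of
  that vanishes.\<close>

lemma (in cring) nilpotent_add:
  fixes m n :: nat
  assumes a: "a \<in> carrier R" "a [^] m = \<zero>" and b: "b \<in> carrier R" "b [^] n = \<zero>"
  shows "(a \<oplus> b) [^] (n * m) = \<zero>"
proof -
  have "\<exists>c \<in> carrier R. (a \<oplus> b) [^] k = b [^] k \<oplus> a \<otimes> c" for k :: nat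
  proof (induction k)
    case 0 show ?case using a by (intro bexI[of _ \<zero>]) auto
  next
    case (Suc k)
    then obtain c where c: "c \<in> carrier R" "(a \<oplus> b) [^] k = b [^] k \<oplus> a \<otimes> c" by blast
    have "(a \<oplus> b) [^] Suc k = b [^] Suc k \<oplus> a \<otimes> (b [^] k \<oplus> c \<otimes> (a \<oplus> b))"
      unfolding nat_pow_Suc c(2) using a(1) b(1) c(1) nat_pow_closed[OF b(1), of k] by algebra
    then show ?case using a b c by blast
  qed
  then obtain c where c: "c \<in> carrier R" "(a \<oplus> b) [^] n = b [^] n \<oplus> a \<otimes> c" by blast
  then have "(a \<oplus> b) [^] n = a \<otimes> c" using a b by simp
  then have "(a \<oplus> b) [^] (n * m) = (a \<otimes> c) [^] m" using a b by (simp add: nat_pow_pow[symmetric])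
  also have "\<dots> = \<zero>" using a c by (simp add: nat_pow_distrib)
  finally show ?thesis .
qed

section \<open>The even part of a super-ring\<close>

context superring
begin

abbreviation "R0 \<equiv> even_part R"
abbreviation "R1 \<equiv> odd_part R"
abbreviation "E \<equiv> even_ring R"

lemmas even_simps = additive_subgroup.a_closed[OF even_additive] additive_subgroup.zero_closed[OF even_additive]
  additive_subgroup.a_inv_closed[OF even_additive]
lemmas odd_simps = additive_subgroup.a_closed[OF odd_additive] additive_subgroup.zero_closed[OF odd_additive]
  additive_subgroup.a_inv_closed[OF odd_additive]

lemma even_carrier: "a \<in> R0 \<Longrightarrow> a \<in> carrier R" using additive_subgroup.a_subset[OF even_additive] by auto
lemma odd_carrier: "a \<in> R1 \<Longrightarrow> a \<in> carrier R" using additive_subgroup.a_subset[OF odd_additive] by auto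

lemma decomp: assumes "r \<in> carrier R" obtains a b where "a \<in> R0" "b \<in> R1" "r = a \<oplus> b"
proof -
  have "r \<in> R0 <+>\<^bsub>R\<^esub> R1" using assms even_plus_odd by simp
  then show ?thesis using that by (auto simp: set_add_def')
qed

lemma even_odd_zero: "a \<in> R0 \<Longrightarrow> a \<in> R1 \<Longrightarrow> a = \<zero>" using even_Int_odd by blast

lemma decomp_unique:
  assumes "a \<in> R0" "a' \<in> R0" "b \<in> R1" "b' \<in> R1" "a \<oplus> b = a' \<oplus> b'"
  shows "a = a'" "b = b'"
proof -
  note c = even_carrier[OF assms(1)] even_carrier[OF assms(2)] odd_carrier[OF assms(3)] odd_carrier[OF assms(4)]
  have "a \<ominus> a' = (a \<oplus> b) \<ominus> a' \<ominus> b" using c by algebra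
  also have "\<dots> = (a' \<oplus> b') \<ominus> a' \<ominus> b" using assms(5) by simp
  also have "\<dots> = b' \<ominus> b" using c by algebra
  finally have eq: "a \<ominus> a' = b' \<ominus> b" .
  have "a \<ominus> a' \<in> R0" using assms even_simps by (simp add: a_minus_def)
  moreover have "b' \<ominus> b \<in> R1" using assms odd_simps by (simp add: a_minus_def)
  ultimately have z: "a \<ominus> a' = \<zero>" using eq even_odd_zero by simp
  then show "a = a'" using c by (simp add: r_right_minus_eq)
  show "b = b'" using z eq c by (simp add: r_right_minus_eq)
qed

lemma even_part_eq: "a \<in> R0 \<Longrightarrow> b \<in> R1 \<Longrightarrow> a \<oplus> b \<in> R0 \<Longrightarrow> b = \<zero>"
  using decomp_unique(2)[of a "a \<oplus> b" b \<zero>] odd_simps even_carrier by simp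

text \<open>Comparing components shows that the even component \<open>e\<close> of
  \<open>\<one> = e \<oplus> u\<close> acts as the identity on both homogeneous parts. Therefore
  \<open>e = e \<otimes> (e \<oplus> u) = e \<oplus> u\<close>.\<close>

lemma one_even: "\<one> \<in> R0"
proof -
  obtain e u where eu: "e \<in> R0" "u \<in> R1" "\<one> = e \<oplus> u" using decomp[OF one_closed] .
  note c = even_carrier[OF eu(1)] odd_carrier[OF eu(2)]
  have ea: "e \<otimes> a = a" if a: "a \<in> R0" for a
  proof -
    have "\<one> \<otimes> a = e \<otimes> a \<oplus> u \<otimes> a" unfolding eu(3) using c even_carrier[OF a] by (simp add: l_distr)
    then have "a \<oplus> \<zero> = e \<otimes> a \<oplus> u \<otimes> a" using even_carrier[OF a] by simp
    from decomp_unique(1)[OF a even_even[OF eu(1) a] odd_simps(2) odd_even[OF eu(2) a] this] show ?thesis by simp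
  qed
  have eb: "e \<otimes> b = b" if b: "b \<in> R1" for b
  proof -
    have "\<one> \<otimes> b = u \<otimes> b \<oplus> e \<otimes> b" unfolding eu(3) using c odd_carrier[OF b] by (simp add: l_distr a_comm)
    then have "\<zero> \<oplus> b = u \<otimes> b \<oplus> e \<otimes> b" using odd_carrier[OF b] by simp
    from decomp_unique(2)[OF even_simps(2) odd_odd[OF eu(2) b] b even_odd[OF eu(1) b] this] show ?thesis by simp
  qed
  have "e = e \<otimes> (e \<oplus> u)" using c eu(3)[symmetric] by simp
  also have "\<dots> = e \<oplus> u" using ea[OF eu(1)] eb[OF eu(2)] c by (simp add: r_distr)
  finally show ?thesis using eu by simp
qed

lemma even_central: "a \<in> R0 \<Longrightarrow> r \<in> carrier R \<Longrightarrow> a \<otimes> r = r \<otimes> a"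
proof -
  assume a: "a \<in> R0" and r: "r \<in> carrier R"
  obtain b c where bc: "b \<in> R0" "c \<in> R1" "r = b \<oplus> c" using decomp[OF r] .
  then show ?thesis
    using comm_even_even[OF a bc(1)] comm_even_odd[OF a bc(2)] even_carrier odd_carrier a
    by (simp add: l_distr r_distr)
qed

lemma even_subring: "subring R0 R"
  by (rule subringI) (auto simp: even_carrier one_even even_simps even_even)

lemma E_simps [simp]: "carrier E = R0" "a \<otimes>\<^bsub>E\<^esub> b = a \<otimes> b" "a \<oplus>\<^bsub>E\<^esub> b = a \<oplus> b" "\<one>\<^bsub>E\<^esub> = \<one>" "\<zero>\<^bsub>E\<^esub> = \<zero>"
  by (simp_all add: even_ring_def)

lemma E_cring: "cring E"
proof -
  have "subcring R0 R" using even_subring comm_even_even by (rule subcringI)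
  then show ?thesis unfolding even_ring_def using subcring_iff[of R0] even_carrier by blast
qed

lemma ideal_prod_E: "A \<cdot>\<^bsub>E\<^esub> B = A \<cdot> B"
proof (intro equalityI subsetI)
  fix x assume "x \<in> A \<cdot>\<^bsub>E\<^esub> B"
  then show "x \<in> A \<cdot> B" by induction (auto intro: ideal_prod.intros)
next
  fix x assume "x \<in> A \<cdot> B"
  then show "x \<in> A \<cdot>\<^bsub>E\<^esub> B"
  proof induction
    case (prod a b) then show ?case using ideal_prod.prod[of a A b B E] by simp
  next
    case (sum a b) then show ?case using ideal_prod.sum[of a E A B b] by simp
  qed
qed

lemma E_minus: "a \<in> R0 \<Longrightarrow> \<ominus>\<^bsub>E\<^esub> a = \<ominus> a"
proof -
  interpret E: cring E by (rule E_cring)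
  assume a: "a \<in> R0"
  then show ?thesis using E.minus_equality[of "\<ominus> a" a] even_simps even_carrier by (simp add: l_neg)
qed

lemma E_subgroup: "additive_subgroup A R \<Longrightarrow> additive_subgroup (A \<inter> R0) E"
proof -
  interpret E: cring E by (rule E_cring)
  assume "additive_subgroup A R"
  then interpret A: additive_subgroup A R .
  have neg: "\<ominus>\<^bsub>E\<^esub> a \<in> A \<inter> R0" if "a \<in> A \<inter> R0" for a
    using that E_minus[of a] A.a_inv_closed even_simps by simp
  have "A \<inter> R0 \<noteq> {}" using A.zero_closed even_simps by blast
  then have "subgroup (A \<inter> R0) (add_monoid E)"
    using neg A.a_closed even_simps by (intro E.add.subgroupI) (auto simp: a_inv_def)
  then show ?thesis by (rule additive_subgroupI)
qed

abbreviation "Rsq \<equiv> odd_square_ideal R"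

lemma Rsq_subgroup: "additive_subgroup Rsq R"
  unfolding odd_square_ideal_def using odd_carrier odd_simps(2) by (intro ideal_prod_subgroup odd_additive) blast+

lemma Rsq_even: "Rsq \<subseteq> R0"
  unfolding odd_square_ideal_def by (rule ideal_prod_subset) (auto simp: odd_odd even_simps)

lemma Rsq_mult: "a \<in> Rsq \<Longrightarrow> r \<in> R0 \<Longrightarrow> r \<otimes> a \<in> Rsq"
  unfolding odd_square_ideal_def
proof (induction rule: ideal_prod.induct)
  case (prod u v)
  have "(r \<otimes> u) \<otimes> v \<in> R1 \<cdot> R1" using prod even_odd by (intro ideal_prod.prod) auto
  then show ?case using prod by (simp add: m_assoc even_carrier odd_carrier)
next
  case (sum a b)
  moreover have "R1 \<cdot> R1 \<subseteq> carrier R" using odd_carrier by (intro ideal_prod_carrier) auto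
  ultimately show ?case using even_carrier by (simp add: r_distr ideal_prod.sum subset_iff)
qed

lemma Rsq_ideal: "ideal Rsq E"
proof -
  interpret E: cring E by (rule E_cring)
  interpret S: additive_subgroup Rsq R by (rule Rsq_subgroup)
  show ?thesis using Rsq_even Rsq_mult by (intro E.ideal_of_closed) auto
qed

text \<open>A product of two odd elements has square \<zero>, since reordering its factors gives
  minus the product of two odd squares. Sums of nilpotents are nilpotent in the commutative ring
  \<open>E\<close>.\<close>

lemma Rsq_nilpotent: "a \<in> Rsq \<Longrightarrow> \<exists>n::nat. a [^]\<^bsub>E\<^esub> n = \<zero>"
  unfolding odd_square_ideal_def
proof (induction rule: ideal_prod.induct)
  case (prod u v)
  interpret E: cring E by (rule E_cring)
  note c = odd_carrier[OF prod(1)] odd_carrier[OF prod(2)]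
  have "(u \<otimes> v) \<otimes> (u \<otimes> v) = u \<otimes> (v \<otimes> u) \<otimes> v" using c by (simp add: m_assoc)
  also have "\<dots> = \<ominus> ((u \<otimes> u) \<otimes> (v \<otimes> v))" using c anticomm_odd_odd[OF prod(2,1)] by (simp add: m_assoc l_minus r_minus)
  also have "\<dots> = \<zero>" using odd_square[OF prod(1)] odd_square[OF prod(2)] by simp
  finally have "(u \<otimes> v) [^]\<^bsub>E\<^esub> Suc (Suc 0) = \<zero>" using odd_odd[OF prod] one_even even_carrier by simp
  then show ?case by blast
next
  case (sum a b)
  interpret E: cring E by (rule E_cring)
  have ab: "a \<in> R0" "b \<in> R0" using sum(1,2) Rsq_even by (auto simp: odd_square_ideal_def)
  obtain n m :: nat where "a [^]\<^bsub>E\<^esub> n = \<zero>" "b [^]\<^bsub>E\<^esub> m = \<zero>" using sum(3,4) by blast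
  then have "(a \<oplus>\<^bsub>E\<^esub> b) [^]\<^bsub>E\<^esub> (m * n) = \<zero>" using E.nilpotent_add[of a n b m] ab by simp
  then show ?case by auto
qed

text \<open>The two-sided ideal generated by \<open>odd_part R\<close>. Its even elements are those
  of \<open>Rsq\<close>.\<close>

definition "Todd = {e \<oplus> b | e b. e \<in> Rsq \<and> b \<in> R1}"

lemma ToddI: "e \<in> Rsq \<Longrightarrow> b \<in> R1 \<Longrightarrow> e \<oplus> b \<in> Todd" by (auto simp: Todd_def)

lemma Todd_add: "s \<in> Todd \<Longrightarrow> t \<in> Todd \<Longrightarrow> s \<oplus> t \<in> Todd"
proof -
  assume "s \<in> Todd" "t \<in> Todd"
  then obtain e b e' b' where *: "e \<in> Rsq" "b \<in> R1" "s = e \<oplus> b" "e' \<in> Rsq" "b' \<in> R1" "t = e' \<oplus> b'" by (auto simp: Todd_def)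
  then have c: "e \<in> carrier R" "e' \<in> carrier R" "b \<in> carrier R" "b' \<in> carrier R" using Rsq_even even_carrier odd_carrier by auto
  have "s \<oplus> t = (e \<oplus> e') \<oplus> (b \<oplus> b')" unfolding *(3,6) using c by algebra
  then show ?thesis using ToddI[OF additive_subgroup.a_closed[OF Rsq_subgroup *(1,4)] odd_simps(1)[OF *(2,5)]] by simp
qed

lemma Todd_mult: "s \<in> Todd \<Longrightarrow> r \<in> carrier R \<Longrightarrow> s \<otimes> r \<in> Todd \<and> r \<otimes> s \<in> Todd"
proof -
  assume "s \<in> Todd" and r: "r \<in> carrier R"
  then obtain e b where *: "e \<in> Rsq" "b \<in> R1" "s = e \<oplus> b" by (auto simp: Todd_def)
  obtain x y where xy: "x \<in> R0" "y \<in> R1" "r = x \<oplus> y" using decomp[OF r] .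
  have e: "e \<in> R0" using * Rsq_even by auto
  have c: "e \<in> carrier R" "b \<in> carrier R" "x \<in> carrier R" "y \<in> carrier R" using e * xy even_carrier odd_carrier by auto
  have oo: "u \<otimes> v \<in> Rsq" if "u \<in> R1" "v \<in> R1" for u v unfolding odd_square_ideal_def using that by (rule ideal_prod.prod)
  note ad = additive_subgroup.a_closed[OF Rsq_subgroup]
  have "s \<otimes> r = (e \<otimes> x \<oplus> b \<otimes> y) \<oplus> (e \<otimes> y \<oplus> b \<otimes> x)" unfolding *(3) xy(3) using c by algebra
  moreover have "e \<otimes> x = x \<otimes> e" using even_central[OF e c(3)] .
  moreover have "r \<otimes> s = (x \<otimes> e \<oplus> y \<otimes> b) \<oplus> (y \<otimes> e \<oplus> x \<otimes> b)" unfolding *(3) xy(3) using c by algebra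
  ultimately show ?thesis
    using ToddI[OF ad[OF Rsq_mult[OF *(1) xy(1)] oo[OF *(2) xy(2)]] odd_simps(1)[OF even_odd[OF e xy(2)] odd_even[OF *(2) xy(1)]]]
      ToddI[OF ad[OF Rsq_mult[OF *(1) xy(1)] oo[OF xy(2) *(2)]] odd_simps(1)[OF odd_even[OF xy(2) e] even_odd[OF xy(1) *(2)]]]
    by simp
qed

lemma Todd_even: "s \<in> Todd \<Longrightarrow> s \<in> R0 \<Longrightarrow> s \<in> Rsq"
proof -
  assume "s \<in> Todd" and s: "s \<in> R0"
  then obtain e b where *: "e \<in> Rsq" "b \<in> R1" "s = e \<oplus> b" by (auto simp: Todd_def)
  have e: "e \<in> R0" using * Rsq_even by auto
  have "b = \<zero>" using even_part_eq[OF e *(2)] s * by simp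
  then show ?thesis using * even_carrier[OF e] by simp
qed

text \<open>An ideal \<open>J\<close> of \<open>E\<close> is the even part of the superideal
  \<open>J + J R_1\<close>, because \<open>J R_1 R_1\<close> falls back into \<open>J\<close>. So an
  ascending chain in \<open>E\<close> can be read off from a chain of superideals.\<close>

lemma E_noetherian:
  assumes "noetherian_superring R" shows "noetherian_ring E"
proof -
  interpret E: cring E by (rule E_cring)
  define ext where "ext J = {a \<oplus> b | a b. a \<in> J \<and> b \<in> J \<cdot> R1}" for J
  have extI: "a \<in> J \<Longrightarrow> b \<in> J \<cdot> R1 \<Longrightarrow> a \<oplus> b \<in> ext J" for a b J by (auto simp: ext_def)
  show ?thesis
  proof (rule E.noetherian_ring_of_acc)
    fix I :: "nat \<Rightarrow> 'a set" assume I: "\<And>n. ideal (I n) E" and inc: "\<And>n. I n \<subseteq> I (Suc n)"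
    have Ie: "I n \<subseteq> R0" for n using E.ideal_sub[OF I[of n]] by simp
    have Iadd: "a \<in> I n \<Longrightarrow> b \<in> I n \<Longrightarrow> a \<oplus> b \<in> I n" for a b n using E.ideal_add[OF I, of a n b] by simp
    have Imul: "a \<in> I n \<Longrightarrow> r \<in> R0 \<Longrightarrow> r \<otimes> a \<in> I n" for a r n using E.ideal_mult[OF I, of a n r] by simp
    have Izero: "\<zero> \<in> I n" for n using E.ideal_zero[OF I, of n] by simp
    have Ineg: "a \<in> I n \<Longrightarrow> \<ominus> a \<in> I n" for a n
      using additive_subgroup.a_inv_closed[OF E.ideal_subgroup[OF I], of a n] E_minus[of a] Ie[of n] by auto
    have O: "additive_subgroup (I n \<cdot> R1) R" for n
      using Ie[of n] even_carrier Izero[of n] by (intro ideal_prod_subgroup odd_additive) auto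
    have Oodd: "I n \<cdot> R1 \<subseteq> R1" for n
      using Ie[of n] by (intro ideal_prod_subset) (auto intro: even_odd odd_simps)
    have Ic: "a \<in> I n \<Longrightarrow> a \<in> carrier R" and Oc: "b \<in> I n \<cdot> R1 \<Longrightarrow> b \<in> carrier R" for a b n
      using Ie[of n] Oodd[of n] even_carrier odd_carrier by auto
    have O1: "b \<otimes> r \<in> I n \<cdot> R1 \<and> r \<otimes> b \<in> I n \<cdot> R1" if "b \<in> I n \<cdot> R1" "r \<in> R0" for b r n
      using that(1)
    proof induction
      case (prod u v)
      have "u \<in> R0" using prod Ie by auto
      note c = even_carrier[OF this] even_carrier[OF that(2)] odd_carrier[OF prod(2)]
      have "u \<otimes> (v \<otimes> r) \<in> I n \<cdot> R1" by (rule ideal_prod.prod[OF prod(1) odd_even[OF prod(2) that(2)]])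
      moreover have "(r \<otimes> u) \<otimes> v \<in> I n \<cdot> R1" by (rule ideal_prod.prod[OF Imul[OF prod(1) that(2)] prod(2)])
      ultimately show ?case using c by (simp add: m_assoc)
    next
      case (sum a b)
      have "a \<in> carrier R" "b \<in> carrier R" using sum(1,2) Oodd odd_carrier by auto
      then show ?case using sum even_carrier[OF that(2)] by (auto simp: l_distr r_distr intro: ideal_prod.sum)
    qed
    have O2: "b \<otimes> r \<in> I n \<and> r \<otimes> b \<in> I n" if "b \<in> I n \<cdot> R1" "r \<in> R1" for b r n
      using that(1)
    proof induction
      case (prod u v)
      have u: "u \<in> R0" using prod Ie by auto
      note c = even_carrier[OF u] odd_carrier[OF that(2)] odd_carrier[OF prod(2)]
      have "(v \<otimes> r) \<otimes> u \<in> I n" by (rule Imul[OF prod(1) odd_odd[OF prod(2) that(2)]])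
      moreover have "(v \<otimes> r) \<otimes> u = (u \<otimes> v) \<otimes> r" using even_central[OF u, of "v \<otimes> r"] c by (simp add: m_assoc)
      moreover have "(r \<otimes> v) \<otimes> u \<in> I n" by (rule Imul[OF prod(1) odd_odd[OF that(2) prod(2)]])
      moreover have "(r \<otimes> v) \<otimes> u = r \<otimes> (u \<otimes> v)" using even_central[OF u, of v] c by (simp add: m_assoc)
      ultimately show ?case by simp
    next
      case (sum a b)
      have "a \<in> carrier R" "b \<in> carrier R" using sum(1,2) Oodd odd_carrier by auto
      then show ?case using sum odd_carrier[OF that(2)] Iadd by (auto simp: l_distr r_distr)
    qed
    have ext_even: "ext (I n) \<inter> R0 = I n" for n
    proof (intro equalityI subsetI)
      fix s assume "s \<in> ext (I n) \<inter> R0"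
      then obtain a b where ab: "a \<in> I n" "b \<in> I n \<cdot> R1" "s = a \<oplus> b" "s \<in> R0" by (auto simp: ext_def)
      have "a \<in> R0" "b \<in> R1" using ab Ie Oodd by auto
      then show "s \<in> I n" using even_part_eq[of a b] ab even_carrier by simp
    next
      fix a assume a: "a \<in> I n"
      then have "a \<in> R0" using Ie by auto
      then show "a \<in> ext (I n) \<inter> R0" using extI[OF a additive_subgroup.zero_closed[OF O]] even_carrier by simp
    qed
    have "superideal (ext (I n)) R" for n
    proof -
      have ec: "s \<in> carrier R" if "s \<in> ext (I n)" for s
        using that Ie[of n] Oodd[of n] even_carrier odd_carrier by (auto simp: ext_def subset_iff)
      have neg: "\<ominus> s \<in> ext (I n)" if s: "s \<in> ext (I n)" for s
      proof -
        obtain a b where ab: "a \<in> I n" "b \<in> I n \<cdot> R1" "s = a \<oplus> b" using s by (auto simp: ext_def)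
        have "\<ominus> s = \<ominus> a \<oplus> \<ominus> b" unfolding ab(3) using Ic[OF ab(1)] Oc[OF ab(2)] by (simp add: minus_add)
        then show ?thesis using extI[OF Ineg[OF ab(1)] additive_subgroup.a_inv_closed[OF O ab(2)]] by simp
      qed
      have add: "s \<oplus> t \<in> ext (I n)" if s: "s \<in> ext (I n)" and t: "t \<in> ext (I n)" for s t
      proof -
        obtain a b where ab: "a \<in> I n" "b \<in> I n \<cdot> R1" "s = a \<oplus> b" using s by (auto simp: ext_def)
        obtain a' b' where ab': "a' \<in> I n" "b' \<in> I n \<cdot> R1" "t = a' \<oplus> b'" using t by (auto simp: ext_def)
        have "s \<oplus> t = (a \<oplus> a') \<oplus> (b \<oplus> b')" unfolding ab(3) ab'(3)
          using Ic[OF ab(1)] Oc[OF ab(2)] Ic[OF ab'(1)] Oc[OF ab'(2)] by algebra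
        then show ?thesis using extI[OF Iadd[OF ab(1) ab'(1)] ideal_prod.sum[OF ab(2) ab'(2)]] by simp
      qed
      have "ext (I n) \<noteq> {}" using extI[OF Izero additive_subgroup.zero_closed[OF O]] by blast
      then have sub: "subgroup (ext (I n)) (add_monoid R)"
        using ec neg add by (intro add.subgroupI) (auto simp: a_inv_def)
      have mult: "s \<otimes> r \<in> ext (I n) \<and> r \<otimes> s \<in> ext (I n)" if s: "s \<in> ext (I n)" and r: "r \<in> carrier R" for s r
      proof -
        obtain a b where ab: "a \<in> I n" "b \<in> I n \<cdot> R1" "s = a \<oplus> b" using s by (auto simp: ext_def)
        obtain x y where xy: "x \<in> R0" "y \<in> R1" "r = x \<oplus> y" using decomp[OF r] .
        have a0: "a \<in> R0" using ab Ie by auto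
        have c: "a \<in> carrier R" "b \<in> carrier R" "x \<in> carrier R" "y \<in> carrier R"
          using Ic[OF ab(1)] Oc[OF ab(2)] even_carrier[OF xy(1)] odd_carrier[OF xy(2)] .
        have ay: "a \<otimes> y \<in> I n \<cdot> R1" by (rule ideal_prod.prod[OF ab(1) xy(2)])
        have "s \<otimes> r = (x \<otimes> a \<oplus> b \<otimes> y) \<oplus> (a \<otimes> y \<oplus> b \<otimes> x)"
          unfolding ab(3) xy(3) even_central[OF xy(1) c(1)] using c by algebra
        moreover have "r \<otimes> s = (x \<otimes> a \<oplus> y \<otimes> b) \<oplus> (a \<otimes> y \<oplus> x \<otimes> b)"
          unfolding ab(3) xy(3) even_central[OF a0 c(4)] using c by algebra
        ultimately show ?thesis
          using extI[OF Iadd[OF Imul[OF ab(1) xy(1)]] ideal_prod.sum[OF ay]] O1[OF ab(2) xy(1)] O2[OF ab(2) xy(2)] by simp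
      qed
      have "ideal (ext (I n)) R" using sub mult ring_axioms by (intro idealI) auto
      moreover have "ext (I n) = (ext (I n) \<inter> R0) <+>\<^bsub>R\<^esub> (ext (I n) \<inter> R1)"
      proof (intro equalityI subsetI)
        fix s assume "s \<in> ext (I n)"
        then obtain a b where ab: "a \<in> I n" "b \<in> I n \<cdot> R1" "s = a \<oplus> b" by (auto simp: ext_def)
        have "b \<in> ext (I n)" using extI[OF Izero ab(2)] Oodd ab(2) odd_carrier by (metis l_zero subsetD)
        then show "s \<in> (ext (I n) \<inter> R0) <+>\<^bsub>R\<^esub> (ext (I n) \<inter> R1)"
          using ab ext_even[of n] Oodd[of n] by (auto simp: set_add_def')
      next
        fix s assume "s \<in> (ext (I n) \<inter> R0) <+>\<^bsub>R\<^esub> (ext (I n) \<inter> R1)"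
        then show "s \<in> ext (I n)" by (auto simp: set_add_def' intro: add)
      qed
      ultimately show ?thesis unfolding superideal_def by blast
    qed
    then have sup: "\<forall>n. superideal (ext (I n)) R" by blast
    have mono: "\<forall>n. ext (I n) \<subseteq> ext (I (Suc n))"
      using ideal_prod_mono[OF inc order_refl, of _ R1] inc by (fastforce simp: ext_def)
    have "\<forall>J :: nat \<Rightarrow> 'a set. (\<forall>n. superideal (J n) R) \<and> (\<forall>n. J n \<subseteq> J (Suc n)) \<longrightarrow> (\<exists>n. \<forall>m \<ge> n. J m = J n)"
      using assms unfolding noetherian_superring_def by (rule conjunct2)
    from mp[OF spec[OF this, of "\<lambda>n. ext (I n)"] conjI[OF sup mono]]
    obtain n where n: "\<And>m. m \<ge> n \<Longrightarrow> ext (I m) = ext (I n)" by blast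
    have "I m = I n" if "m \<ge> n" for m using arg_cong[OF n[OF that], of "\<lambda>S. S \<inter> R0"] unfolding ext_even .
    then show "\<exists>n. \<forall>m\<ge>n. I m = I n" by blast
  qed
qed

end

section \<open>The ideals defining the bigraded ring\<close>

locale superring_superideal = superring +
  fixes N assumes N: "superideal N R"
begin

abbreviation "N0 \<equiv> N \<inter> R0"
abbreviation "N1 \<equiv> N \<inter> R1"
abbreviation "np \<equiv> submod_power R N0"
abbreviation "op \<equiv> submod_power R N1"
abbreviation "I \<equiv> bigr_ideal R N"
abbreviation "nx \<equiv> bigr_next R N"
abbreviation "C \<equiv> carrier R"

lemma N_ideal: "ideal N R" using N by (simp add: superideal_def)

lemma N0_ideal: "ideal N0 E"
proof -
  interpret E: cring E by (rule E_cring)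
  interpret N: ideal N R by (rule N_ideal)
  show ?thesis
    using even_simps even_even even_carrier N.I_l_closed by (intro E.ideal_of_closed) auto
qed

lemma np_ipow: "np k = ipow E N0 k"
  by (induction k) (simp_all add: ideal_prod_E)

lemma np_ideal: "ideal (np k) E"
  unfolding np_ipow by (rule cring.ipow_ideal[OF E_cring N0_ideal])

lemma np_even: "np k \<subseteq> R0" using cring.ideal_sub[OF E_cring np_ideal[of k]] by simp

lemma np_zero: "\<zero> \<in> np k" using cring.ideal_zero[OF E_cring np_ideal[of k]] by simp

lemma np_add: "np k \<cdot> np l = np (k + l)"
  using cring.ipow_add[OF E_cring N0_ideal, of k l] by (simp add: np_ipow ideal_prod_E)

lemma np_1: "np (Suc 0) = N0" using cring.ipow_1[OF E_cring N0_ideal] by (simp only: np_ipow)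

lemma np_antimono: "k \<le> l \<Longrightarrow> np l \<subseteq> np k"
  unfolding np_ipow by (rule cring.ipow_antimono[OF E_cring N0_ideal])

lemma np_carrier: "np k \<subseteq> C" using np_even even_carrier by auto

lemma R0_sub: "R0 \<subseteq> C" using even_carrier by auto
lemma N1_sub: "N1 \<subseteq> C" using odd_carrier by auto

lemma op_carrier: "op l \<subseteq> C"
  by (induction l) (simp_all add: R0_sub ideal_prod_carrier[OF _ N1_sub])

lemma op_zero: "\<zero> \<in> op l"
proof (induction l)
  case (Suc l)
  have "\<zero> \<in> N1" using odd_simps(2) additive_subgroup.zero_closed[OF ideal.axioms(1)[OF N_ideal]] by simp
  from ideal_prod.prod[OF Suc this, of R] show ?case by simp
qed (simp add: even_simps)

lemma N1_even: "N1 \<cdot> R0 \<subseteq> N1"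
  using ideal.I_r_closed[OF N_ideal] odd_even even_carrier additive_subgroup.a_closed[OF ideal.axioms(1)[OF N_ideal]] odd_simps(1)
  by (intro ideal_prod_subset) auto

lemma op_even: "op l \<cdot> R0 \<subseteq> op l"
proof (cases l)
  case 0
  have "R0 \<cdot> R0 \<subseteq> R0" by (rule ideal_prod_subset) (auto simp: even_even even_simps(1))
  then show ?thesis using 0 by simp
next
  case (Suc m)
  have "(op m \<cdot> N1) \<cdot> R0 = op m \<cdot> (N1 \<cdot> R0)" by (rule ideal_prod_set_assoc[OF op_carrier N1_sub R0_sub])
  also have "\<dots> \<subseteq> op m \<cdot> N1" by (rule ideal_prod_mono[OF order_refl N1_even])
  finally show ?thesis using Suc by simp
qed

lemma op_add: "op l \<cdot> op m \<subseteq> op (l + m)"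
proof (induction m)
  case 0 then show ?case using op_even by simp
next
  case (Suc m)
  have "op l \<cdot> (op m \<cdot> N1) = (op l \<cdot> op m) \<cdot> N1" by (rule ideal_prod_set_assoc[OF op_carrier op_carrier N1_sub, symmetric])
  also have "\<dots> \<subseteq> op (l + m) \<cdot> N1" by (rule ideal_prod_mono[OF Suc order_refl])
  finally show ?case by simp
qed

lemma even_prod_commute: "A \<subseteq> R0 \<Longrightarrow> B \<subseteq> C \<Longrightarrow> B \<cdot> A \<subseteq> A \<cdot> B"
proof (rule ideal_prod_subset)
  fix b a assume *: "A \<subseteq> R0" "B \<subseteq> C" "b \<in> B" "a \<in> A"
  then have "a \<in> R0" "b \<in> C" by blast+
  then have "b \<otimes> a = a \<otimes> b" by (rule even_central[symmetric])
  then show "b \<otimes> a \<in> A \<cdot> B" using ideal_prod.prod[of a A b B R] * by simp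
qed (rule ideal_prod.sum)

text \<open>Moving \<open>v\<close> past \<open>r = a \<oplus> b\<close> reverses the sign of the
  odd component and turns \<open>r\<close> into \<open>a \<ominus> b\<close>.\<close>

lemma C_N1: "C \<cdot> N1 \<subseteq> N1 \<cdot> C"
proof (rule ideal_prod_subset)
  fix r v assume r: "r \<in> C" and v: "v \<in> N1"
  obtain a b where ab: "a \<in> R0" "b \<in> R1" "r = a \<oplus> b" using decomp[OF r] .
  have c: "a \<in> C" "b \<in> C" "v \<in> C" using ab v even_carrier odd_carrier by auto
  have vR: "v \<in> R1" using v by simp
  have "r \<otimes> v = a \<otimes> v \<oplus> b \<otimes> v" unfolding ab(3) using c by (simp add: l_distr)
  also have "\<dots> = v \<otimes> a \<oplus> \<ominus> (v \<otimes> b)" using even_central[OF ab(1) c(3)] anticomm_odd_odd[OF ab(2) vR] by simp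
  also have "\<dots> = v \<otimes> (a \<ominus> b)" using c by (simp add: a_minus_def r_distr r_minus)
  finally show "r \<otimes> v \<in> N1 \<cdot> C" using ideal_prod.prod[OF v, of "a \<ominus> b" C R] c by simp
qed (rule ideal_prod.sum)

lemma C_C: "C \<cdot> C \<subseteq> C" by (rule ideal_prod_subset) auto

lemma C_op: "C \<cdot> op l \<subseteq> op l \<cdot> C"
proof (induction l)
  case 0 then show ?case using even_prod_commute[OF order_refl order_refl] by simp
next
  case (Suc l)
  have "C \<cdot> (op l \<cdot> N1) = (C \<cdot> op l) \<cdot> N1" by (rule ideal_prod_set_assoc[OF order_refl op_carrier N1_sub, symmetric])
  also have "\<dots> \<subseteq> (op l \<cdot> C) \<cdot> N1" by (rule ideal_prod_mono[OF Suc order_refl])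
  also have "\<dots> = op l \<cdot> (C \<cdot> N1)" by (rule ideal_prod_set_assoc[OF op_carrier order_refl N1_sub])
  also have "\<dots> \<subseteq> op l \<cdot> (N1 \<cdot> C)" by (rule ideal_prod_mono[OF order_refl C_N1])
  also have "\<dots> = (op l \<cdot> N1) \<cdot> C" by (rule ideal_prod_set_assoc[OF op_carrier N1_sub order_refl, symmetric])
  finally show ?case by simp
qed

text \<open>\<open>bigr_ideal\<close> is \<open>G k l\<close> times the whole ring. Multiplicativity
  is shown for \<open>G\<close> first; then \<open>C_G\<close> allows the ring factor to be moved to
  the right.\<close>

definition "G k l = np k \<cdot> op l"

lemma I_eq: "I (k, l) = G k l \<cdot> C" by (simp add: bigr_ideal_def G_def)

lemma G_carrier: "G k l \<subseteq> C" unfolding G_def by (rule ideal_prod_carrier[OF np_carrier op_carrier])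

lemma C_G: "C \<cdot> G k l \<subseteq> G k l \<cdot> C"
proof -
  have "C \<cdot> (np k \<cdot> op l) = (C \<cdot> np k) \<cdot> op l" by (rule ideal_prod_set_assoc[OF order_refl np_carrier op_carrier, symmetric])
  also have "\<dots> \<subseteq> (np k \<cdot> C) \<cdot> op l" by (rule ideal_prod_mono[OF even_prod_commute[OF np_even order_refl] order_refl])
  also have "\<dots> = np k \<cdot> (C \<cdot> op l)" by (rule ideal_prod_set_assoc[OF np_carrier order_refl op_carrier])
  also have "\<dots> \<subseteq> np k \<cdot> (op l \<cdot> C)" by (rule ideal_prod_mono[OF order_refl C_op])
  also have "\<dots> = (np k \<cdot> op l) \<cdot> C" by (rule ideal_prod_set_assoc[OF np_carrier op_carrier order_refl, symmetric])
  finally show ?thesis by (simp add: G_def)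
qed

lemma G_G: "G k l \<cdot> G k' l' \<subseteq> G (k + k') (l + l')"
proof -
  note a = ideal_prod_set_assoc
  have "(np k \<cdot> op l) \<cdot> (np k' \<cdot> op l') = np k \<cdot> (op l \<cdot> (np k' \<cdot> op l'))"
    by (rule a[OF np_carrier op_carrier ideal_prod_carrier[OF np_carrier op_carrier]])
  also have "op l \<cdot> (np k' \<cdot> op l') = (op l \<cdot> np k') \<cdot> op l'" by (rule a[OF op_carrier np_carrier op_carrier, symmetric])
  also have "np k \<cdot> \<dots> \<subseteq> np k \<cdot> ((np k' \<cdot> op l) \<cdot> op l')"
    by (intro ideal_prod_mono order_refl even_prod_commute np_even op_carrier)
  also have "(np k' \<cdot> op l) \<cdot> op l' = np k' \<cdot> (op l \<cdot> op l')" by (rule a[OF np_carrier op_carrier op_carrier])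
  also have "np k \<cdot> \<dots> = (np k \<cdot> np k') \<cdot> (op l \<cdot> op l')"
    by (rule a[OF np_carrier np_carrier ideal_prod_carrier[OF op_carrier op_carrier], symmetric])
  also have "\<dots> \<subseteq> np (k + k') \<cdot> op (l + l')"
    by (rule ideal_prod_mono[OF _ op_add]) (simp only: np_add order_refl)
  finally show ?thesis by (simp add: G_def)
qed

lemma I_carrier: "I p \<subseteq> C" by (cases p) (simp add: I_eq ideal_prod_carrier[OF G_carrier])

lemma I_subgroup: "additive_subgroup (I p) R"
proof (cases p)
  case (Pair k l)
  have "\<zero> \<otimes> \<zero> \<in> G k l" unfolding G_def by (rule ideal_prod.prod[OF np_zero op_zero])
  moreover have "additive_subgroup C R" using oneideal ideal.axioms(1) by blast
  ultimately show ?thesis unfolding Pair I_eq by (intro ideal_prod_subgroup G_carrier) auto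
qed

lemma I_mult: "a \<in> I (k, l) \<Longrightarrow> b \<in> I (k', l') \<Longrightarrow> a \<otimes> b \<in> I (k + k', l + l')"
proof -
  note a = ideal_prod_set_assoc and m = ideal_prod_mono and c = ideal_prod_carrier
  have "(G k l \<cdot> C) \<cdot> (G k' l' \<cdot> C) = G k l \<cdot> (C \<cdot> (G k' l' \<cdot> C))"
    by (rule a[OF G_carrier order_refl c[OF G_carrier order_refl]])
  also have "C \<cdot> (G k' l' \<cdot> C) = (C \<cdot> G k' l') \<cdot> C" by (rule a[OF order_refl G_carrier order_refl, symmetric])
  also have "G k l \<cdot> \<dots> \<subseteq> G k l \<cdot> ((G k' l' \<cdot> C) \<cdot> C)" by (intro m order_refl C_G)
  also have "(G k' l' \<cdot> C) \<cdot> C = G k' l' \<cdot> (C \<cdot> C)" by (rule a[OF G_carrier order_refl order_refl])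
  also have "G k l \<cdot> \<dots> = (G k l \<cdot> G k' l') \<cdot> (C \<cdot> C)" by (rule a[OF G_carrier G_carrier c[OF order_refl order_refl], symmetric])
  also have "\<dots> \<subseteq> G (k + k') (l + l') \<cdot> C" by (rule m[OF G_G C_C])
  finally have "I (k, l) \<cdot> I (k', l') \<subseteq> I (k + k', l + l')" by (simp add: I_eq)
  moreover assume "a \<in> I (k, l)" "b \<in> I (k', l')"
  ultimately show ?thesis using ideal_prod.prod[of a "I (k, l)" b "I (k', l')" R] by blast
qed

lemma I_antimono: "k \<le> k' \<Longrightarrow> l \<le> l' \<Longrightarrow> I (k', l') \<subseteq> I (k, l)"
proof -
  have "I (k, Suc l) \<subseteq> I (k, l)" for k l
  proof -
    have "G k (Suc l) = G k l \<cdot> N1" unfolding G_def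
      using ideal_prod_set_assoc[OF np_carrier[of k] op_carrier[of l] N1_sub] by simp
    then have "I (k, Suc l) = G k l \<cdot> (N1 \<cdot> C)" unfolding I_eq
      using ideal_prod_set_assoc[OF G_carrier[of k l] N1_sub order_refl] by simp
    also have "\<dots> \<subseteq> G k l \<cdot> C" by (rule ideal_prod_mono[OF order_refl ideal_prod_carrier[OF N1_sub order_refl]])
    finally show ?thesis by (simp add: I_eq)
  qed
  then have 1: "l \<le> l' \<Longrightarrow> I (k, l') \<subseteq> I (k, l)" for k l l' by (rule lift_Suc_antimono_le)
  assume "k \<le> k'" "l \<le> l'"
  have "I (k', l') \<subseteq> I (k', l)" by (rule 1[OF \<open>l \<le> l'\<close>])
  also have "\<dots> \<subseteq> I (k, l)" unfolding I_eq G_def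
    by (rule ideal_prod_mono[OF ideal_prod_mono[OF np_antimono[OF \<open>k \<le> k'\<close>] order_refl] order_refl])
  finally show ?thesis .
qed

lemma np_I: "np k \<subseteq> I (k, 0)"
proof
  fix a assume a: "a \<in> np k"
  then have ac: "a \<in> C" using np_carrier by auto
  have "a \<otimes> \<one> \<in> G k 0" unfolding G_def by (rule ideal_prod.prod[OF a]) (simp add: one_even)
  then have "(a \<otimes> \<one>) \<otimes> \<one> \<in> G k 0 \<cdot> C" by (rule ideal_prod.prod) simp
  then show "a \<in> I (k, 0)" using ac by (simp add: I_eq)
qed

text \<open>\<open>I (k, 0)\<close> is \<open>np k\<close> times the whole ring. Multiplying by an
  even element stays in \<open>np k\<close>, and multiplying by an odd one gives an odd
  element.\<close>

lemma I_decomp: "s \<in> I (k, 0) \<Longrightarrow> \<exists>e \<in> np k. \<exists>b \<in> R1. s = e \<oplus> b"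
proof -
  have G0: "G k 0 \<subseteq> np k"
    using np_add[of k 0] by (simp add: G_def)
  let ?D = "{e \<oplus> b | e b. e \<in> np k \<and> b \<in> R1}"
  have "G k 0 \<cdot> C \<subseteq> ?D"
  proof (rule ideal_prod_subset)
    fix u r assume "u \<in> G k 0" and r: "r \<in> C"
    then have u: "u \<in> np k" "u \<in> R0" using G0 np_even by auto
    obtain a b where ab: "a \<in> R0" "b \<in> R1" "r = a \<oplus> b" using decomp[OF r] .
    have "u \<otimes> r = u \<otimes> a \<oplus> u \<otimes> b" unfolding ab(3) using u ab even_carrier odd_carrier by (simp add: r_distr)
    moreover have "u \<otimes> a \<in> np k" using ideal.I_r_closed[OF np_ideal u(1), of a] ab by simp
    moreover have "u \<otimes> b \<in> R1" using even_odd u ab by simp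
    ultimately show "u \<otimes> r \<in> ?D" by blast
  next
    fix s t assume "s \<in> ?D" "t \<in> ?D"
    then obtain e b e' b' where *: "e \<in> np k" "b \<in> R1" "s = e \<oplus> b" "e' \<in> np k" "b' \<in> R1" "t = e' \<oplus> b'" by blast
    have c: "e \<in> C" "b \<in> C" "e' \<in> C" "b' \<in> C" using * np_carrier odd_carrier by auto
    have "s \<oplus> t = (e \<oplus> e') \<oplus> (b \<oplus> b')" unfolding *(3,6) using c by algebra
    moreover have "e \<oplus> e' \<in> np k" using cring.ideal_add[OF E_cring np_ideal *(1,4)] by simp
    ultimately show "s \<oplus> t \<in> ?D" using odd_simps(1)[OF *(2,5)] by blast
  qed
  moreover assume "s \<in> I (k, 0)"
  ultimately show ?thesis unfolding I_eq by blast
qed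

lemma I_even: "a \<in> I (k, 0) \<Longrightarrow> a \<in> R0 \<Longrightarrow> a \<in> np k"
proof -
  assume "a \<in> I (k, 0)" and a: "a \<in> R0"
  then obtain e b where *: "e \<in> np k" "b \<in> R1" "a = e \<oplus> b" using I_decomp by blast
  have e: "e \<in> R0" using * np_even by auto
  then have "b = \<zero>" using even_part_eq[OF e *(2)] a * by simp
  then show ?thesis using * even_carrier[OF e] by simp
qed

text \<open>In positive second degree each product contains a factor from \<open>N1\<close>, which
  lies in the ideal \<open>Todd\<close>. The even elements of these degrees are therefore in
  \<open>Rsq\<close> and nilpotent.\<close>

lemma I_Todd: "I (k, Suc l) \<subseteq> Todd"
proof -
  have N1T: "N1 \<subseteq> Todd"
  proof
    fix v assume "v \<in> N1"
    then have "\<zero> \<oplus> v \<in> Todd" by (intro ToddI additive_subgroup.zero_closed[OF Rsq_subgroup]) auto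
    then show "v \<in> Todd" using \<open>v \<in> N1\<close> odd_carrier by simp
  qed
  have "op l \<cdot> N1 \<subseteq> Todd" using Todd_mult N1T op_carrier by (intro ideal_prod_subset Todd_add) blast+
  then have "op (Suc l) \<subseteq> Todd" by simp
  then have "G k (Suc l) \<subseteq> Todd" unfolding G_def
    using Todd_mult np_carrier by (intro ideal_prod_subset Todd_add) blast+
  then show ?thesis unfolding I_eq using Todd_mult by (intro ideal_prod_subset Todd_add) blast+
qed

lemma I_Rsq: "a \<in> I (k, Suc l) \<Longrightarrow> a \<in> R0 \<Longrightarrow> a \<in> Rsq"
  using I_Todd Todd_even by blast

lemma nx_eq: "nx (k, l) = I (Suc k, l) <+>\<^bsub>R\<^esub> I (k, Suc l)" by (simp add: bigr_next_def)

lemma nx_subgroup: "additive_subgroup (nx p) R"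
  by (cases p) (simp add: nx_eq add_additive_subgroups I_subgroup)

lemma nx_upper: "I (Suc k, l) \<subseteq> nx (k, l)" "I (k, Suc l) \<subseteq> nx (k, l)"
proof -
  note z = additive_subgroup.zero_closed[OF I_subgroup]
  show "I (Suc k, l) \<subseteq> nx (k, l)"
  proof
    fix a assume a: "a \<in> I (Suc k, l)"
    then have "a \<in> C" using I_carrier by auto
    then show "a \<in> nx (k, l)" unfolding nx_eq set_add_def' using a z[of "(k, Suc l)"] by force
  qed
  show "I (k, Suc l) \<subseteq> nx (k, l)"
  proof
    fix a assume a: "a \<in> I (k, Suc l)"
    then have "a \<in> C" using I_carrier by auto
    then show "a \<in> nx (k, l)" unfolding nx_eq set_add_def' using a z[of "(Suc k, l)"] by force
  qed
qed

lemma nx_I: "nx p \<subseteq> I p"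
proof (cases p)
  case (Pair k l)
  show ?thesis
  proof
    fix s assume "s \<in> nx p"
    then obtain a b where ab: "a \<in> I (Suc k, l)" "b \<in> I (k, Suc l)" "s = a \<oplus> b"
      unfolding Pair nx_eq set_add_def' by blast
    have "a \<in> I p" "b \<in> I p" using ab I_antimono[of k "Suc k" l l] I_antimono[of k k l "Suc l"] Pair by auto
    then show "s \<in> I p" using ab additive_subgroup.a_closed[OF I_subgroup] by simp
  qed
qed

lemma nx_mult:
  assumes "a \<in> I (k, l)" "b \<in> nx (k', l')"
  shows "a \<otimes> b \<in> nx (k + k', l + l')" "b \<otimes> a \<in> nx (k + k', l + l')"
proof -
  obtain c d where cd: "c \<in> I (Suc k', l')" "d \<in> I (k', Suc l')" "b = c \<oplus> d"
    using assms(2) unfolding nx_eq set_add_def' by blast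
  have cc: "a \<in> C" "c \<in> C" "d \<in> C" using cd assms I_carrier by blast+
  note m = additive_subgroup.a_closed[OF nx_subgroup, of _ "(k + k', l + l')"]
  have "a \<otimes> c \<in> nx (k + k', l + l')" "c \<otimes> a \<in> nx (k + k', l + l')"
    using I_mult[OF assms(1) cd(1)] I_mult[OF cd(1) assms(1)] nx_upper(1)[of "k + k'" "l + l'"] by (auto simp: add.commute)
  moreover have "a \<otimes> d \<in> nx (k + k', l + l')" "d \<otimes> a \<in> nx (k + k', l + l')"
    using I_mult[OF assms(1) cd(2)] I_mult[OF cd(2) assms(1)] nx_upper(2)[of "k + k'" "l + l'"] by (auto simp: add.commute)
  moreover have "a \<otimes> b = a \<otimes> c \<oplus> a \<otimes> d" "b \<otimes> a = c \<otimes> a \<oplus> d \<otimes> a" unfolding cd(3) using cc by algebra+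
  ultimately show "a \<otimes> b \<in> nx (k + k', l + l')" "b \<otimes> a \<in> nx (k + k', l + l')" using m by simp_all
qed

text \<open>The odd components of the two summands must cancel, and the even ones lie in
  \<open>np (Suc k)\<close> and in \<open>Rsq\<close>. So up to nilpotents the even part in degree
  \<open>(k, 0)\<close> is n^k modulo n^(k+1).\<close>

lemma nx_even: "a \<in> nx (k, 0) \<Longrightarrow> a \<in> R0 \<Longrightarrow> \<exists>e \<in> np (Suc k). \<exists>b \<in> Rsq. a = e \<oplus> b"
proof -
  assume "a \<in> nx (k, 0)" and a: "a \<in> R0"
  then obtain s t where st: "s \<in> I (Suc k, 0)" "t \<in> I (k, Suc 0)" "a = s \<oplus> t"
    unfolding nx_eq set_add_def' by blast
  obtain e b where e: "e \<in> np (Suc k)" "b \<in> R1" "s = e \<oplus> b" using I_decomp[OF st(1)] by blast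
  obtain e' b' where e': "e' \<in> Rsq" "b' \<in> R1" "t = e' \<oplus> b'" using subsetD[OF I_Todd st(2)] by (auto simp: Todd_def)
  have ee: "e \<in> R0" "e' \<in> R0" using subsetD[OF np_even e(1)] subsetD[OF Rsq_even e'(1)] .
  have c: "e \<in> C" "e' \<in> C" "b \<in> C" "b' \<in> C" using ee e e' even_carrier odd_carrier by auto
  have eq: "a = (e \<oplus> e') \<oplus> (b \<oplus> b')" unfolding st(3) e(3) e'(3) using c by algebra
  have "b \<oplus> b' = \<zero>" using even_part_eq[OF even_simps(1)[OF ee] odd_simps(1)[OF e(2) e'(2)]] a eq by simp
  then show ?thesis using eq e(1) e'(1) c by auto
qed

lemma I_0: "I (0, 0) = C"
proof -
  have "\<one> \<in> I (0, 0)" using np_I[of 0] one_even by auto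
  then have "r \<in> I (0, 0)" if "r \<in> C" for r
  proof -
    have "\<one> \<otimes> \<one> \<in> G 0 0" unfolding G_def by (rule ideal_prod.prod) (auto simp: one_even)
    from ideal_prod.prod[OF this that, of R] show ?thesis using that by (simp add: I_eq)
  qed
  then show ?thesis using I_carrier by blast
qed

end

section \<open>The bigraded ring as a quotient of a subring of a group ring\<close>

context superring_superideal
begin

abbreviation "piece \<equiv> bigr_piece R N"

definition ncoset :: "nat \<times> nat \<Rightarrow> 'a \<Rightarrow> 'a set" where "ncoset p a = nx p +> a"

lemma nx_abelian: "abelian_subgroup (nx p) R"
  by (rule abelian_subgroupI3[OF nx_subgroup is_abelian_group])

lemma ncoset_self: "a \<in> C \<Longrightarrow> a \<in> ncoset p a"
  unfolding ncoset_def by (rule abelian_subgroup.a_rcos_self[OF nx_abelian])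

lemma ncoset_eq_iff: "a \<in> C \<Longrightarrow> b \<in> C \<Longrightarrow> ncoset p a = ncoset p b \<longleftrightarrow> a \<ominus> b \<in> nx p"
proof -
  assume ab: "a \<in> C" "b \<in> C"
  interpret A: abelian_subgroup "nx p" R by (rule nx_abelian)
  have "ncoset p a = ncoset p b \<longleftrightarrow> a \<in> nx p +> b"
    using A.a_repr_independence'[of a b] ncoset_self[OF ab(1), of p] ab unfolding ncoset_def by metis
  also have "\<dots> \<longleftrightarrow> a \<ominus> b \<in> nx p" using A.a_rcos_module_minus[OF ring_axioms ab(2,1)] .
  finally show ?thesis .
qed

lemma ncoset_nx: "a \<in> nx p \<Longrightarrow> ncoset p a = nx p"
  unfolding ncoset_def by (rule abelian_subgroup.a_rcos_const[OF nx_abelian])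

lemma ncoset_zero: "ncoset p \<zero> = nx p"
  by (rule ncoset_nx[OF additive_subgroup.zero_closed[OF nx_subgroup]])

lemma ncoset_nx_iff: "a \<in> C \<Longrightarrow> ncoset p a = nx p \<longleftrightarrow> a \<in> nx p"
  using ncoset_self[of a p] ncoset_nx by blast

lemma ncoset_add: "a \<in> C \<Longrightarrow> b \<in> C \<Longrightarrow> ncoset p a <+>\<^bsub>R\<^esub> ncoset p b = ncoset p (a \<oplus> b)"
  unfolding ncoset_def by (rule abelian_subgroup.a_rcos_sum[OF nx_abelian])

lemma ncoset_mem: "x \<in> ncoset p a \<Longrightarrow> \<exists>h \<in> nx p. x = h \<oplus> a"
  by (auto simp: ncoset_def a_r_coset_def')

text \<open>\<open>rcoset_mult\<close> is the union of the cosets of all products of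
  representatives. It is a single coset because by \<open>nx_mult\<close> another choice of
  representatives changes the product only by an element of \<open>nx\<close>.\<close>

lemma rcoset_mult_ncoset:
  assumes a: "a \<in> I (k, l)" and b: "b \<in> I (k', l')"
  shows "rcoset_mult R (nx (k + k', l + l')) (ncoset (k, l) a) (ncoset (k', l') b) = ncoset (k + k', l + l') (a \<otimes> b)"
proof -
  let ?p = "(k + k', l + l')"
  have ac: "a \<in> C" and bc: "b \<in> C" using a b I_carrier by auto
  have "ncoset ?p (u \<otimes> v) = ncoset ?p (a \<otimes> b)" if uv: "u \<in> ncoset (k, l) a" "v \<in> ncoset (k', l') b" for u v
  proof -
    obtain h g where hg: "h \<in> nx (k, l)" "u = h \<oplus> a" "g \<in> nx (k', l')" "v = g \<oplus> b" using ncoset_mem uv by metis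
    have hI: "h \<in> I (k, l)" "g \<in> I (k', l')" using hg nx_I by auto
    have c: "h \<in> C" "g \<in> C" using hI I_carrier by auto
    have "u \<otimes> v \<ominus> a \<otimes> b = h \<otimes> g \<oplus> a \<otimes> g \<oplus> h \<otimes> b" unfolding hg(2,4) using c ac bc by algebra
    also have "\<dots> \<in> nx ?p"
      using nx_mult(1)[OF hI(1) hg(3)] nx_mult(1)[OF a hg(3)] nx_mult(2)[OF b hg(1)] 
      by (simp add: additive_subgroup.a_closed[OF nx_subgroup] add.commute)
    finally show ?thesis using ncoset_eq_iff[of "u \<otimes> v" "a \<otimes> b" ?p] c ac bc hg by simp
  qed
  then have "(\<Union>u\<in>ncoset (k, l) a. \<Union>v\<in>ncoset (k', l') b. ncoset ?p (u \<otimes> v)) = ncoset ?p (a \<otimes> b)"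
    using ncoset_self[OF ac, of "(k, l)"] ncoset_self[OF bc, of "(k', l')"] by blast
  then show ?thesis by (simp only: rcoset_mult_def ncoset_def)
qed

lemma piece_simps: "carrier (piece p) = ncoset p ` I p" "A \<otimes>\<^bsub>piece p\<^esub> B = A <+>\<^bsub>R\<^esub> B" "\<one>\<^bsub>piece p\<^esub> = nx p"
  by (auto simp: bigr_piece_def A_FactGroup_def' A_RCOSETS_def' a_r_coset_def' set_add_def' ncoset_def)

lemma piece_comm_group: "comm_group (piece p)"
proof (rule comm_groupI)
  note add = additive_subgroup.a_closed[OF I_subgroup]
  note Ic = subsetD[OF I_carrier]
  fix A B D
  assume A: "A \<in> carrier (piece p)" then obtain a where a: "a \<in> I p" "A = ncoset p a" by (auto simp: piece_simps)
  have "\<ominus> a \<in> I p" using a additive_subgroup.a_inv_closed[OF I_subgroup] by blast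
  moreover have "ncoset p (\<ominus> a) <+>\<^bsub>R\<^esub> A = nx p" using Ic[OF a(1)] a(2) by (simp add: ncoset_add l_neg ncoset_zero)
  ultimately show "\<exists>B\<in>carrier (piece p). B \<otimes>\<^bsub>piece p\<^esub> A = \<one>\<^bsub>piece p\<^esub>" by (auto simp: piece_simps)
  show "\<one>\<^bsub>piece p\<^esub> \<otimes>\<^bsub>piece p\<^esub> A = A"
    using ncoset_add[of \<zero> a p] Ic[OF a(1)] a(2) by (simp add: piece_simps ncoset_zero)
  assume "B \<in> carrier (piece p)" then obtain b where b: "b \<in> I p" "B = ncoset p b" by (auto simp: piece_simps)
  show "A \<otimes>\<^bsub>piece p\<^esub> B \<in> carrier (piece p)"
    using Ic[OF a(1)] Ic[OF b(1)] a b add by (auto simp: piece_simps ncoset_add)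
  show "A \<otimes>\<^bsub>piece p\<^esub> B = B \<otimes>\<^bsub>piece p\<^esub> A"
    using Ic[OF a(1)] Ic[OF b(1)] a b by (simp add: piece_simps ncoset_add a_comm)
  assume "D \<in> carrier (piece p)" then obtain d where d: "d \<in> I p" "D = ncoset p d" by (auto simp: piece_simps)
  show "A \<otimes>\<^bsub>piece p\<^esub> B \<otimes>\<^bsub>piece p\<^esub> D = A \<otimes>\<^bsub>piece p\<^esub> (B \<otimes>\<^bsub>piece p\<^esub> D)"
    using Ic[OF a(1)] Ic[OF b(1)] Ic[OF d(1)] a b d by (simp add: piece_simps ncoset_add a_assoc)
next
  have "\<zero> \<in> I p" by (rule additive_subgroup.zero_closed[OF I_subgroup])
  then show "\<one>\<^bsub>piece p\<^esub> \<in> carrier (piece p)" by (auto simp: piece_simps ncoset_zero[symmetric])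
qed

lemma finprod_piece:
  assumes "finite S" "\<And>x. x \<in> S \<Longrightarrow> c x \<in> I p"
  shows "finprod (piece p) (\<lambda>x. ncoset p (c x)) S = ncoset p (finsum R c S)"
  using assms
proof (induction S)
  case empty
  interpret P: comm_group "piece p" by (rule piece_comm_group)
  show ?case by (simp add: piece_simps ncoset_zero)
next
  case (insert x S)
  interpret P: comm_group "piece p" by (rule piece_comm_group)
  have c: "c x \<in> C" "c \<in> S \<rightarrow> C" using insert.prems by (auto intro!: subsetD[OF I_carrier[of p]])
  have "finprod (piece p) (\<lambda>x. ncoset p (c x)) (insert x S)
      = ncoset p (c x) \<otimes>\<^bsub>piece p\<^esub> finprod (piece p) (\<lambda>x. ncoset p (c x)) S"
    using insert by (intro P.finprod_insert) (auto simp: piece_simps)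
  also have "\<dots> = ncoset p (c x \<oplus> finsum R c S)" using insert c by (simp add: piece_simps ncoset_add)
  finally show ?case using insert c by (simp add: finsum_insert)
qed

lemma carrier_sum_piece:
  "carrier (sum_group UNIV piece) = {f. (\<forall>p. f p \<in> ncoset p ` I p) \<and> finite {p. f p \<noteq> nx p}}"
  by (subst carrier_sum_group) (simp_all add: piece_simps comm_group.axioms(2)[OF piece_comm_group] PiE_UNIV_domain Pi_iff)

lemma even_bgr:
  "carrier (even_ring (bgr R N)) = {f. (\<forall>p. \<exists>a \<in> I p \<inter> R0. f p = ncoset p a) \<and> finite {p. f p \<noteq> nx p}}"
  "\<one>\<^bsub>even_ring (bgr R N)\<^esub> = (\<lambda>p. if p = (0, 0) then ncoset p \<one> else nx p)"
  "\<zero>\<^bsub>even_ring (bgr R N)\<^esub> = nx"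
  "f \<oplus>\<^bsub>even_ring (bgr R N)\<^esub> g = (\<lambda>p. f p <+>\<^bsub>R\<^esub> g p)"
  "f \<otimes>\<^bsub>even_ring (bgr R N)\<^esub> g = (\<lambda>(k, l). finprod (piece (k, l))
         (\<lambda>(i, j). rcoset_mult R (nx (k, l)) (f (i, j)) (g (k - i, l - j))) ({..k} \<times> {..l}))"
proof -
  have "carrier (even_ring (bgr R N)) = {f \<in> carrier (sum_group UNIV piece). \<forall>p. \<exists>a \<in> I p \<inter> R0. f p = ncoset p a}"
    by (simp add: even_ring_def bgr_def ncoset_def)
  also have "\<dots> = {f. (\<forall>p. \<exists>a \<in> I p \<inter> R0. f p = ncoset p a) \<and> finite {p. f p \<noteq> nx p}}"
    unfolding carrier_sum_piece by blast
  finally show "carrier (even_ring (bgr R N)) = \<dots>" .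
qed (auto simp: even_ring_def bgr_def piece_simps ncoset_def fun_eq_iff)

text \<open>
  The group ring over \<open>\<int> \<times> \<int>\<close> is used because group rings are simpler than monoid rings. The negative
  first degrees also make it map onto the extended Rees algebra.
\<close>
definition F :: "int \<times> int \<Rightarrow> 'a set"
  where "F = (\<lambda>(k, l). if l < 0 then {\<zero>} else I (nat k, nat l) \<inter> R0)"

definition W :: "(int \<times> int \<Rightarrow> 'a) set"
  where "W = cring.graded_subring E F"

abbreviation WR :: "(int \<times> int \<Rightarrow> 'a) ring" where "WR \<equiv> (group_ring E)\<lparr>carrier := W\<rparr>"

interpretation E: cring E by (rule E_cring)

lemma F_zero: "\<zero> \<in> F p"
  using additive_subgroup.zero_closed[OF I_subgroup] even_simps by (auto simp: F_def split: prod.split)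

lemma F_even: "F p \<subseteq> R0" using even_simps by (auto simp: F_def split: prod.splits)

lemma F_neg: "l < 0 \<Longrightarrow> F (k, l) = {\<zero>}" by (simp add: F_def)

lemma F_nonneg: "0 \<le> l \<Longrightarrow> F (k, l) = I (nat k, nat l) \<inter> R0" by (simp add: F_def)

lemma F_subgroup: "additive_subgroup (F p) E"
proof (cases p)
  case (Pair k l)
  show ?thesis
  proof (cases "l < 0")
    case True
    then show ?thesis using Pair E.zeroideal E.ideal_subgroup by (simp add: F_neg)
  next
    case False
    then show ?thesis using Pair E_subgroup[OF I_subgroup] by (simp add: F_nonneg)
  qed
qed

lemma F_mult: assumes "a \<in> F p" "b \<in> F q" shows "a \<otimes> b \<in> F (p + q)"
proof -
  obtain k l k' l' where pq: "p = (k, l)" "q = (k', l')" by (cases p, cases q)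
  have ab: "a \<in> R0" "b \<in> R0" using subsetD[OF F_even assms(1)] subsetD[OF F_even assms(2)] .
  show ?thesis
  proof (cases "l < 0 \<or> l' < 0")
    case True
    then have "a = \<zero> \<or> b = \<zero>" using assms pq F_neg by auto
    then have "a \<otimes> b = \<zero>" using ab even_carrier by auto
    then show ?thesis using F_zero by simp
  next
    case False
    then have "a \<otimes> b \<in> I (nat k + nat k', nat l + nat l')" using assms pq I_mult by (simp add: F_nonneg)
    also have "\<dots> \<subseteq> I (nat (k + k'), nat (l + l'))" by (rule I_antimono) simp_all
    finally show ?thesis using False pq even_even[OF ab] by (simp add: F_nonneg)
  qed
qed

lemma W_subring: "subring W (group_ring E)"
  unfolding W_def
proof (rule E.graded_subring)
  show "\<one>\<^bsub>E\<^esub> \<in> F 0" using I_0 one_even by (simp add: zero_prod_def F_nonneg)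
qed (use F_subgroup F_mult in auto)

lemma WR_cring: "cring WR"
  by (rule cring.subring_cring[OF E.gring_cring W_subring])

lemma W_mem: "f \<in> W \<longleftrightarrow> f \<in> carrier (group_ring E) \<and> (\<forall>p. f p \<in> F p)"
  by (simp add: W_def E.graded_subring_def)

lemma W_memD: "f \<in> W \<Longrightarrow> f \<in> carrier (group_ring E)" "f \<in> W \<Longrightarrow> f p \<in> F p" "f \<in> W \<Longrightarrow> f p \<in> R0" "f \<in> W \<Longrightarrow> f p \<in> C"
proof -
  show 1: "f \<in> W \<Longrightarrow> f \<in> carrier (group_ring E)" and 2: "f \<in> W \<Longrightarrow> f p \<in> F p" unfolding W_mem by blast+
  show 3: "f \<in> W \<Longrightarrow> f p \<in> R0" using subsetD[OF F_even 2] .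
  show "f \<in> W \<Longrightarrow> f p \<in> C" using even_carrier[OF 3] .
qed

lemma gmon_W: "a \<in> F p \<Longrightarrow> gmon E p a \<in> W"
proof -
  assume a: "a \<in> F p"
  then have "a \<in> R0" by (rule subsetD[OF F_even])
  then show ?thesis using a F_zero E.gmon_closed[of a p] by (auto simp: W_mem gmon_def)
qed

text \<open>Coefficients with negative first degree are discarded. Products that involve them land
  in \<open>nx\<close>, so the map is still multiplicative.\<close>

definition \<phi> :: "(int \<times> int \<Rightarrow> 'a) \<Rightarrow> nat \<times> nat \<Rightarrow> 'a set"
  where "\<phi> f = (\<lambda>(k, l). ncoset (k, l) (f (int k, int l)))"

lemma finsum_E: "finite S \<Longrightarrow> (\<And>x. x \<in> S \<Longrightarrow> c x \<in> R0) \<Longrightarrow> finsum E c S = finsum R c S"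
proof (induction S rule: finite_induct)
  case (insert x S)
  then have "c \<in> S \<rightarrow> C" "c x \<in> C" using even_carrier by auto
  then show ?case using insert by (simp add: finsum_insert E.finsum_insert Pi_def)
qed simp

lemma \<phi>_closed: assumes f: "f \<in> W" shows "\<phi> f \<in> carrier (even_ring (bgr R N))"
proof -
  let ?e = "\<lambda>(k, l). (int k, int l)"
  have "finite (?e -` {p. f p \<noteq> \<zero>})"
    using E.gring_memD(2)[OF W_memD(1)[OF f]] by (intro finite_vimageI) (auto simp: inj_def)
  moreover have "{p. \<phi> f p \<noteq> nx p} \<subseteq> ?e -` {p. f p \<noteq> \<zero>}" by (auto simp: \<phi>_def ncoset_zero)
  ultimately have "finite {p. \<phi> f p \<noteq> nx p}" using finite_subset by blast
  moreover have "\<exists>a \<in> I p \<inter> R0. \<phi> f p = ncoset p a" for p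
  proof (cases p)
    case (Pair k l)
    then show ?thesis using W_memD(2)[OF f, of "(int k, int l)"]
      by (intro bexI[of _ "f (int k, int l)"]) (auto simp: \<phi>_def F_nonneg)
  qed
  ultimately show ?thesis by (simp add: even_bgr)
qed

lemma \<phi>_add: assumes "f \<in> W" "g \<in> W" shows "\<phi> (f \<oplus>\<^bsub>group_ring E\<^esub> g) = \<phi> f \<oplus>\<^bsub>even_ring (bgr R N)\<^esub> \<phi> g"
  using W_memD(4)[OF assms(1)] W_memD(4)[OF assms(2)]
  by (auto simp: even_bgr \<phi>_def E.gring_add ncoset_add fun_eq_iff)

lemma \<phi>_one: "\<phi> \<one>\<^bsub>group_ring E\<^esub> = \<one>\<^bsub>even_ring (bgr R N)\<^esub>"
  by (auto simp: even_bgr \<phi>_def E.gring_one gmon_def ncoset_zero fun_eq_iff zero_prod_def)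

lemma \<phi>_mult: assumes f: "f \<in> W" and g: "g \<in> W"
  shows "\<phi> (f \<otimes>\<^bsub>group_ring E\<^esub> g) = \<phi> f \<otimes>\<^bsub>even_ring (bgr R N)\<^esub> \<phi> g"
proof (rule ext, clarify)
  fix k l :: nat
  let ?e = "\<lambda>(i, j). (int i, int j)" and ?S = "{p. f p \<noteq> \<zero>}" and ?B = "{..k} \<times> {..l}"
  let ?T = "?S \<union> ?e ` ?B" and ?t = "\<lambda>q. f q \<otimes> g ((int k, int l) - q)"
  note f0 = W_memD(3)[OF f] and g0 = W_memD(3)[OF g]
  have fin: "finite ?S" "finite ?T" using E.gring_memD(2)[OF W_memD(1)[OF f]] by simp_all
  have t0: "?t q \<in> R0" for q using f0 g0 even_even by blast
  have tc: "?t q \<in> C" for q using t0 even_carrier by blast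
  have "(f \<otimes>\<^bsub>group_ring E\<^esub> g) (int k, int l) = finsum E ?t ?T"
    using E.gring_mult[OF W_memD(1)[OF f] W_memD(1)[OF g] fin(2), of "(int k, int l)"] by simp
  also have "\<dots> = finsum R ?t ?T" by (rule finsum_E[OF fin(2) t0])
  also have "?T = ?e ` ?B \<union> (?S - ?e ` ?B)" by blast
  also have "finsum R ?t \<dots> = finsum R ?t (?e ` ?B) \<oplus> finsum R ?t (?S - ?e ` ?B)"
    using fin tc by (intro finsum_Un_disjoint) auto
  finally have eq: "(f \<otimes>\<^bsub>group_ring E\<^esub> g) (int k, int l) = finsum R ?t (?e ` ?B) \<oplus> finsum R ?t (?S - ?e ` ?B)" .
  \<comment> \<open>The convolution over pairs of integers also has terms outside the box
    \<open>?B\<close>. If the second degree is outside \<open>0..l\<close>, a factor is \<zero>. If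
    only the first degree is outside \<open>0..k\<close>, then
    \<open>nat i + nat (int k - i)\<close> exceeds \<open>k\<close>, and the term lies in
    \<open>I (Suc k, l)\<close>.\<close>
  have rest: "?t q \<in> nx (k, l)" if q: "q \<notin> ?e ` ?B" for q
  proof -
    obtain i j where ij: "q = (i, j)" by (cases q)
    have tq: "?t q = f (i, j) \<otimes> g (int k - i, int l - j)" by (simp add: ij)
    have zero: "\<zero> \<in> nx (k, l)" by (rule additive_subgroup.zero_closed[OF nx_subgroup])
    consider "j < 0" | "int l < j" | "0 \<le> j" "j \<le> int l" by linarith
    then show ?thesis
    proof cases
      case 1
      then have "f (i, j) = \<zero>" using W_memD(2)[OF f, of "(i, j)"] F_neg by simp
      then show ?thesis using tq zero W_memD(4)[OF g] by simp
    next
      case 2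
      then have "g (int k - i, int l - j) = \<zero>" using W_memD(2)[OF g, of "(int k - i, int l - j)"] F_neg by simp
      then show ?thesis using tq zero W_memD(4)[OF f] by simp
    next
      case 3
      have fI: "f (i, j) \<in> I (nat i, nat j)" using W_memD(2)[OF f, of "(i, j)"] 3 by (simp add: F_nonneg)
      have gI: "g (int k - i, int l - j) \<in> I (nat (int k - i), nat (int l - j))"
        using W_memD(2)[OF g, of "(int k - i, int l - j)"] 3 by (simp add: F_nonneg)
      have out: "i < 0 \<or> int k < i"
      proof (rule ccontr)
        assume "\<not> ?thesis"
        then have "q = ?e (nat i, nat j)" "(nat i, nat j) \<in> ?B" using 3 ij by auto
        then show False using q by blast
      qed
      have l: "l \<le> nat j + nat (int l - j)" using 3 by linarith
      have k: "Suc k \<le> nat i + nat (int k - i)" using out by linarith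
      have "?t q \<in> I (nat i + nat (int k - i), nat j + nat (int l - j))" unfolding tq by (rule I_mult[OF fI gI])
      also have "\<dots> \<subseteq> I (Suc k, l)" by (rule I_antimono[OF k l])
      also have "\<dots> \<subseteq> nx (k, l)" by (rule nx_upper)
      finally show ?thesis .
    qed
  qed
  have r: "finsum R ?t (?S - ?e ` ?B) \<in> nx (k, l)"
    by (rule finsum_in) (use rest additive_subgroup.zero_closed[OF nx_subgroup] additive_subgroup.a_closed[OF nx_subgroup]
      additive_subgroup.a_subset[OF nx_subgroup] in auto)
  have inj: "inj_on ?e ?B" by (auto simp: inj_on_def)
  have s: "finsum R ?t (?e ` ?B) = finsum R (\<lambda>b. ?t (?e b)) ?B"
    using inj tc by (intro finsum_reindex) auto
  have subring_carrier: "finsum R (\<lambda>b. ?t (?e b)) ?B \<in> C" using tc by (intro finsum_closed) auto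
  have cancel: "(u \<oplus> v) \<ominus> u = v" if "u \<in> C" "v \<in> C" for u v using that by algebra
  have rc: "finsum R ?t (?S - ?e ` ?B) \<in> C" using tc by (intro finsum_closed) auto
  have "(f \<otimes>\<^bsub>group_ring E\<^esub> g) (int k, int l) \<ominus> finsum R (\<lambda>b. ?t (?e b)) ?B \<in> nx (k, l)"
    unfolding eq s cancel[OF subring_carrier rc] by (rule r)
  then have main: "\<phi> (f \<otimes>\<^bsub>group_ring E\<^esub> g) (k, l) = ncoset (k, l) (finsum R (\<lambda>b. ?t (?e b)) ?B)"
    using ncoset_eq_iff[of "(f \<otimes>\<^bsub>group_ring E\<^esub> g) (int k, int l)" _ "(k, l)"] subring_carrier eq s rc by (simp add: \<phi>_def)
  have summand: "?t (?e b) \<in> I (k, l) \<and> (case b of (i, j) \<Rightarrow> rcoset_mult R (nx (k, l)) (\<phi> f (i, j)) (\<phi> g (k - i, l - j)))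
      = ncoset (k, l) (?t (?e b))" if b: "b \<in> ?B" for b
  proof -
    obtain i j where ij: "b = (i, j)" "i \<le> k" "j \<le> l" using b by auto
    have fI: "f (int i, int j) \<in> I (i, j)" using W_memD(2)[OF f, of "(int i, int j)"] by (simp add: F_nonneg)
    have gI: "g (int (k - i), int (l - j)) \<in> I (k - i, l - j)"
      using W_memD(2)[OF g, of "(int (k - i), int (l - j))"] by (simp add: F_nonneg)
    have t: "?t (?e b) = f (int i, int j) \<otimes> g (int (k - i), int (l - j))" using ij by (simp add: of_nat_diff)
    show ?thesis using I_mult[OF fI gI] rcoset_mult_ncoset[OF fI gI] ij t by (simp add: \<phi>_def)
  qed
  interpret P: comm_group "piece (k, l)" by (rule piece_comm_group)
  have "finprod (piece (k, l)) (\<lambda>(i, j). rcoset_mult R (nx (k, l)) (\<phi> f (i, j)) (\<phi> g (k - i, l - j))) ?B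
      = finprod (piece (k, l)) (\<lambda>b. ncoset (k, l) (?t (?e b))) ?B"
    using summand by (intro P.finprod_cong') (auto simp: piece_simps)
  also have "\<dots> = ncoset (k, l) (finsum R (\<lambda>b. ?t (?e b)) ?B)" using summand by (intro finprod_piece) auto
  finally show "\<phi> (f \<otimes>\<^bsub>group_ring E\<^esub> g) (k, l) = (\<phi> f \<otimes>\<^bsub>even_ring (bgr R N)\<^esub> \<phi> g) (k, l)"
    using main by (simp add: even_bgr)
qed

lemma \<phi>_surj: assumes h: "h \<in> carrier (even_ring (bgr R N))" shows "\<exists>f \<in> W. \<phi> f = h"
proof -
  \<comment> \<open>Trivial cosets get the representative \<zero>, so that the chosen family has
    finite support.\<close>
  have "\<exists>a. a \<in> I p \<inter> R0 \<and> h p = ncoset p a \<and> (h p = nx p \<longrightarrow> a = \<zero>)" for p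
  proof (cases "h p = nx p")
    case True
    then show ?thesis using additive_subgroup.zero_closed[OF I_subgroup] even_simps ncoset_zero by (intro exI[of _ \<zero>]) simp
  next
    case False
    have "\<exists>a \<in> I p \<inter> R0. h p = ncoset p a" using h unfolding even_bgr by blast
    then show ?thesis using False by blast
  qed
  then obtain a where a: "\<And>p. a p \<in> I p \<inter> R0" "\<And>p. h p = ncoset p (a p)" "\<And>p. h p = nx p \<Longrightarrow> a p = \<zero>" by metis
  define f where "f = (\<lambda>(k :: int, l :: int). if 0 \<le> k \<and> 0 \<le> l then a (nat k, nat l) else \<zero>)"
  have "{p. f p \<noteq> \<zero>} \<subseteq> (\<lambda>(k, l). (int k, int l)) ` {p. h p \<noteq> nx p}"
  proof
    fix p assume p: "p \<in> {p. f p \<noteq> \<zero>}"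
    obtain k l where kl: "p = (k, l)" by (cases p)
    have nn: "0 \<le> k" "0 \<le> l" and "a (nat k, nat l) \<noteq> \<zero>" using p kl by (auto simp: f_def split: if_splits)
    then have "h (nat k, nat l) \<noteq> nx (nat k, nat l)" using a(3) by blast
    then show "p \<in> (\<lambda>(k, l). (int k, int l)) ` {p. h p \<noteq> nx p}"
      using nn kl by (intro image_eqI[of _ _ "(nat k, nat l)"]) auto
  qed
  then have fin: "finite {p. f p \<noteq> \<zero>}" by (rule finite_subset) (use h in \<open>simp add: even_bgr\<close>)
  have fF: "f p \<in> F p" for p
  proof (cases p)
    case (Pair k l)
    then show ?thesis using a(1) F_zero[of p] by (auto simp: f_def F_nonneg)
  qed
  then have "f p \<in> R0" for p using F_even by blast
  then have "f \<in> W" using fin fF by (simp add: W_mem E.gring_carrier)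
  moreover have "\<phi> f = h" using a(2) by (auto simp: \<phi>_def f_def fun_eq_iff)
  ultimately show ?thesis by blast
qed

lemma \<phi>_hom: "\<phi> \<in> ring_hom WR (even_ring (bgr R N))"
  by (rule ring_hom_memI) (simp_all add: \<phi>_closed \<phi>_mult \<phi>_add \<phi>_one)

lemma \<phi>_image: "\<phi> ` carrier WR = carrier (even_ring (bgr R N))"
  using \<phi>_closed \<phi>_surj by (auto simp: image_iff)

lemma \<phi>_zero_iff: "f \<in> W \<Longrightarrow> \<phi> f = \<zero>\<^bsub>even_ring (bgr R N)\<^esub> \<longleftrightarrow> (\<forall>k l. f (int k, int l) \<in> nx (k, l))"
  using W_memD(4) by (auto simp: \<phi>_def even_bgr fun_eq_iff ncoset_nx_iff)

text \<open>The ring laws are inherited from \<open>WR\<close>, as \<open>\<phi>\<close> is onto and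
  respects the operations.\<close>

lemma even_bgr_cring: "cring (even_ring (bgr R N))"
proof -
  interpret WR: cring WR by (rule WR_cring)
  let ?B = "even_ring (bgr R N)"
  have z: "\<phi> \<zero>\<^bsub>WR\<^esub> = \<zero>\<^bsub>?B\<^esub>" by (auto simp: \<phi>_def even_bgr E.gring_zero ncoset_zero fun_eq_iff)
  have "ring (?B\<lparr>carrier := \<phi> ` carrier WR, zero := \<phi> \<zero>\<^bsub>WR\<^esub>\<rparr>)"
    by (rule WR.ring_hom_imp_img_ring[OF \<phi>_hom])
  then have "ring ?B" unfolding \<phi>_image z by simp
  then interpret B: ring ?B .
  show ?thesis
  proof (rule cring.intro[OF B.ring_axioms], unfold_locales)
    fix f g assume "f \<in> carrier ?B" "g \<in> carrier ?B"
    then obtain u v where uv: "u \<in> W" "v \<in> W" "f = \<phi> u" "g = \<phi> v" using \<phi>_surj by metis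
    have "u \<otimes>\<^bsub>group_ring E\<^esub> v = v \<otimes>\<^bsub>group_ring E\<^esub> u" using E.gring_comm[OF W_memD(1)[OF uv(1)] W_memD(1)[OF uv(2)]] .
    then show "f \<otimes>\<^bsub>?B\<^esub> g = g \<otimes>\<^bsub>?B\<^esub> f" unfolding uv(3,4) \<phi>_mult[OF uv(1,2), symmetric] \<phi>_mult[OF uv(2,1), symmetric] by simp
  qed
qed

lemma \<phi>_surj_hom: "surj_hom WR (even_ring (bgr R N)) \<phi>"
  by (intro surj_hom.intro surj_hom_axioms.intro WR_cring even_bgr_cring \<phi>_hom \<phi>_image)

end

section \<open>Nilpotent monomials and units of local rings\<close>

context cring
begin

text \<open>The degree of the power does not matter for nilpotency and is left existential.\<close>

lemma gmon_pow:
  assumes S: "cring (gring\<lparr>carrier := S\<rparr>)" and b: "b \<in> carrier R"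
  shows "\<exists>j. gmon R p b [^]\<^bsub>gring\<lparr>carrier := S\<rparr>\<^esub> (n::nat) = gmon R j (b [^] n)"
proof -
  interpret S: cring "gring\<lparr>carrier := S\<rparr>" by (rule S)
  show ?thesis
  proof (induction n)
    case 0 show ?case by (intro exI[of _ 0]) (simp add: gring_one)
  next
    case (Suc n)
    then obtain j where "gmon R p b [^]\<^bsub>gring\<lparr>carrier := S\<rparr>\<^esub> n = gmon R j (b [^] n)" by blast
    then show ?case using b by (intro exI[of _ "j + p"]) (simp add: gmon_mult)
  qed
qed

lemma gmon_0_pow:
  assumes S: "cring (gring\<lparr>carrier := S\<rparr>)" and b: "b \<in> carrier R"
  shows "gmon R 0 b [^]\<^bsub>gring\<lparr>carrier := S\<rparr>\<^esub> (n::nat) = gmon R 0 (b [^] n)"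
proof -
  interpret S: cring "gring\<lparr>carrier := S\<rparr>" by (rule S)
  show ?thesis by (induction n) (use b in \<open>simp_all add: gring_one gmon_mult\<close>)
qed

lemma gmon_nilpotent_in_prime:
  assumes S: "cring (gring\<lparr>carrier := S\<rparr>)" and T: "primeideal T (gring\<lparr>carrier := S\<rparr>)"
    and b: "b \<in> carrier R" "gmon R p b \<in> S" "b [^] (n::nat) = \<zero>"
  shows "gmon R p b \<in> T"
proof -
  interpret S: cring "gring\<lparr>carrier := S\<rparr>" by (rule S)
  obtain j where "gmon R p b [^]\<^bsub>gring\<lparr>carrier := S\<rparr>\<^esub> n = gmon R j \<zero>" using gmon_pow[OF S b(1), of p n] b(3) by auto
  then have "gmon R p b [^]\<^bsub>gring\<lparr>carrier := S\<rparr>\<^esub> n \<in> T"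
    using S.ideal_zero[OF S.prime_ideal[OF T]] by (simp add: gmon_zero)
  then show ?thesis using S.prime_pow[OF T] b(2) by simp
qed

end

text \<open>A non-unit generates a proper ideal. This lies in a maximal ideal, which can only be
  \<open>M\<close>.\<close>

lemma (in noetherian_cring) local_ring_unit:
  assumes M: "local_ring R M" and c: "c \<in> carrier R" "c \<notin> M"
  shows "\<exists>c' \<in> carrier R. c' \<otimes> c = \<one>"
proof (rule ccontr)
  assume neg: "\<not> ?thesis"
  let ?F = "{J. ideal J R \<and> PIdl c \<subseteq> J \<and> \<one> \<notin> J}"
  note P = cgenideal_ideal[OF c(1)]
  have "\<one> \<notin> PIdl c" using neg by (auto simp: cgenideal_def)
  then have "?F \<noteq> {}" using P by blast
  then obtain M0 where M0: "M0 \<in> ?F" "\<And>J. J \<in> ?F \<Longrightarrow> M0 \<subseteq> J \<Longrightarrow> J = M0"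
    by (rule maximal_ideal_in_family) auto
  have "maximalideal M0 R"
  proof (rule maximalidealI)
    show "ideal M0 R" using M0 by simp
    show "carrier R \<noteq> M0" using M0 by auto
    fix J assume J: "ideal J R" "M0 \<subseteq> J" "J \<subseteq> carrier R"
    show "J = M0 \<or> J = carrier R"
    proof (cases "\<one> \<in> J")
      case True then show ?thesis using ideal.one_imp_carrier[OF J(1)] by simp
    next
      case False
      then have "J \<in> ?F" using J M0(1) by auto
      then show ?thesis using M0(2) J(2) by simp
    qed
  qed
  then have "M0 = M" using M by (simp add: local_ring_def)
  then show False using M0(1) cgenideal_self[OF c(1)] c(2) by auto
qed

lemma (in noetherian_cring) local_ring_prime_le:
  assumes M: "local_ring R M" and P: "primeideal P R" shows "P \<subseteq> M"
proof
  fix c assume c: "c \<in> P"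
  have cc: "c \<in> carrier R" using ideal.Icarr[OF prime_ideal[OF P] c] .
  show "c \<in> M"
  proof (rule ccontr)
    assume "c \<notin> M"
    then obtain c' where "c' \<in> carrier R" "c' \<otimes> c = \<one>" using local_ring_unit[OF M cc] by blast
    then show False using ideal_mult[OF prime_ideal[OF P] c, of c'] prime_one[OF P] by simp
  qed
qed

section \<open>Dimension of the bigraded ring\<close>

context superring_superideal
begin

interpretation E: cring E by (rule E_cring)

abbreviation WZ :: "(int \<Rightarrow> 'a) ring" where "WZ \<equiv> (group_ring E)\<lparr>carrier := E.rees N0\<rparr>"

lemma WZ_cring: "cring WZ"
  by (rule cring.subring_cring[OF E.gring_cring E.rees_subring[OF N0_ideal]])

definition \<rho> :: "(int \<times> int \<Rightarrow> 'a) \<Rightarrow> int \<Rightarrow> 'a" where "\<rho> f = (\<lambda>k. f (k, 0))"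

lemma F_0: "F (k, 0) = np (nat k)"
  using np_I np_even I_even by (auto simp: F_nonneg)

lemma \<rho>_closed: assumes f: "f \<in> W" shows "\<rho> f \<in> E.rees N0"
proof -
  have "finite ((\<lambda>k. (k, 0)) -` {p. f p \<noteq> \<zero>})"
    using E.gring_memD(2)[OF W_memD(1)[OF f]] by (intro finite_vimageI) (auto simp: inj_def)
  moreover have "{k. \<rho> f k \<noteq> \<zero>} = (\<lambda>k. (k, 0)) -` {p. f p \<noteq> \<zero>}" by (auto simp: \<rho>_def)
  ultimately have "finite {k. \<rho> f k \<noteq> \<zero>}" by (simp only:)
  moreover have "\<rho> f k \<in> np (nat k)" for k using W_memD(2)[OF f, of "(k, 0)"] F_0 by (simp add: \<rho>_def)
  moreover have "\<rho> f k \<in> R0" for k using W_memD(3)[OF f] by (simp add: \<rho>_def)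
  ultimately show ?thesis by (simp add: E.rees_def E.graded_subring_def E.gring_carrier np_ipow[symmetric])
qed

text \<open>Elements of \<open>W\<close> vanish in negative second degree, so in degree
  \<open>(k, 0)\<close> only products of two coefficients of second degree \<open>0\<close>
  survive.\<close>

lemma \<rho>_mult: assumes f: "f \<in> W" and g: "g \<in> W"
  shows "\<rho> (f \<otimes>\<^bsub>group_ring E\<^esub> g) = \<rho> f \<otimes>\<^bsub>group_ring E\<^esub> \<rho> g"
proof
  fix k
  let ?S = "{p. f p \<noteq> \<zero>}" and ?Z = "{i. \<rho> f i \<noteq> \<zero>}" and ?t = "\<lambda>q. f q \<otimes> g ((k, 0) - q)"
  note f0 = W_memD(3)[OF f] and g0 = W_memD(3)[OF g]
  have t0: "?t q \<in> R0" for q using even_even[OF f0 g0] .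
  have fin: "finite ?S" using E.gring_memD(2)[OF W_memD(1)[OF f]] by simp
  have sub: "(\<lambda>i. (i, 0)) ` ?Z \<subseteq> ?S" by (auto simp: \<rho>_def)
  have z: "?t q = \<zero>" if "q \<in> ?S - (\<lambda>i. (i, 0)) ` ?Z" for q
  proof -
    obtain i j where ij: "q = (i, j)" by (cases q)
    have "f (i, j) \<noteq> \<zero>" and "j \<noteq> 0" using that ij by (auto simp: \<rho>_def)
    then have "0 < j" using W_memD(2)[OF f, of "(i, j)"] F_neg[of j i] by (cases "j < 0") auto
    then have "g (k - i, 0 - j) = \<zero>" using W_memD(2)[OF g, of "(k - i, 0 - j)"] F_neg by simp
    then show ?thesis using ij W_memD(4)[OF f] by simp
  qed
  have "\<rho> (f \<otimes>\<^bsub>group_ring E\<^esub> g) k = finsum E ?t ?S"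
    using E.gring_mult[OF W_memD(1)[OF f] W_memD(1)[OF g] fin, of "(k, 0)"] by (simp add: \<rho>_def)
  also have "\<dots> = finsum E ?t ((\<lambda>i. (i, 0)) ` ?Z)"
    using fin sub t0 z by (intro E.finsum_superset) auto
  also have "\<dots> = finsum E (\<lambda>i. ?t (i, 0)) ?Z"
    using t0 by (intro E.finsum_reindex) (auto simp: inj_on_def)
  also have "\<dots> = (\<rho> f \<otimes>\<^bsub>group_ring E\<^esub> \<rho> g) k" by (simp add: group_ring_def \<rho>_def)
  finally show "\<rho> (f \<otimes>\<^bsub>group_ring E\<^esub> g) k = (\<rho> f \<otimes>\<^bsub>group_ring E\<^esub> \<rho> g) k" .
qed

lemma \<rho>_surj_hom: "surj_hom WR WZ \<rho>"
proof (intro surj_hom.intro surj_hom_axioms.intro WR_cring WZ_cring)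
  show "\<rho> \<in> ring_hom WR WZ"
    by (rule ring_hom_memI)
      (auto simp: \<rho>_closed \<rho>_mult E.gring_add E.gring_one gmon_def zero_prod_def, auto simp: \<rho>_def)
  show "\<rho> ` carrier WR = carrier WZ"
  proof (intro equalityI subsetI)
    fix w assume "w \<in> carrier WZ"
    then have w: "w \<in> E.rees N0" by simp
    define f where "f = (\<lambda>(k :: int, l :: int). if l = 0 then w k else \<zero>)"
    note wc = E.rees_mem(1)[OF w]
    have "{p. f p \<noteq> \<zero>} \<subseteq> (\<lambda>k. (k, 0)) ` {k. w k \<noteq> \<zero>}" by (auto simp: f_def split: if_splits)
    then have fin: "finite {p. f p \<noteq> \<zero>}" by (rule finite_subset) (use E.gring_memD(2)[OF wc] in simp)
    have "f (k, l) \<in> F (k, l)" for k l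
      using E.rees_mem(2)[OF w, of k] F_zero[of "(k, l)"] F_0[of k] by (auto simp: f_def np_ipow[symmetric])
    then have fF: "f p \<in> F p" for p by (cases p) simp
    then have "f p \<in> R0" for p using subsetD[OF F_even] by blast
    then have "f \<in> W" using fin fF by (simp add: W_mem E.gring_carrier)
    moreover have "\<rho> f = w" by (simp add: \<rho>_def f_def)
    ultimately show "w \<in> \<rho> ` carrier WR" by auto
  qed (auto simp: \<rho>_closed)
qed

text \<open>By \<open>nx_even\<close>, a coefficient of a kernel element in degree
  \<open>(k, 0)\<close> with \<open>0 \<le> k\<close> is the sum of some \<open>e\<close> in
  n^(k+1), for which \<open>e\<close> T^k is a multiple of T^-1, and a nilpotent element. For
  negative \<open>k\<close> every element of degree \<open>k\<close> is a multiple of T^-1.\<close>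

lemma kernel_in_prime:
  assumes T: "primeideal T WZ" and u: "gmon E (- 1) \<one> \<in> T" and f: "f \<in> W"
    and ker: "\<phi> f = \<zero>\<^bsub>even_ring (bgr R N)\<^esub>"
  shows "\<rho> f \<in> T"
proof -
  interpret WZ: cring WZ by (rule WZ_cring)
  note Ti = WZ.prime_ideal[OF T]
  have nx: "f (int k, int l) \<in> nx (k, l)" for k l using ker \<phi>_zero_iff[OF f] by simp
  \<comment> \<open>\<open>a\<close> T^k is T^-1 times \<open>a\<close> T^(k+1). For negative
    \<open>k\<close> the condition reads \<open>a \<in> np 0\<close>.\<close>
  have um: "gmon E k a \<in> T" if "a \<in> np (nat (k + 1))" for k a
  proof -
    have a: "a \<in> R0" using subsetD[OF np_even that] .
    have "gmon E (k + 1) a \<in> E.rees N0" using E.gmon_rees[OF _ N0_ideal, of a "k + 1"] that by (simp add: np_ipow)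
    then have "gmon E (k + 1) a \<otimes>\<^bsub>group_ring E\<^esub> gmon E (- 1) \<one> \<in> T" using WZ.ideal_mult[OF Ti u] by simp
    then show ?thesis using a by (simp add: E.gmon_mult one_even even_carrier)
  qed
  show ?thesis
  proof (rule E.gring_gmon_span[OF E.rees_mem(1)[OF \<rho>_closed[OF f]]])
    show "\<zero>\<^bsub>group_ring E\<^esub> \<in> T" using WZ.ideal_zero[OF Ti] by simp
    show "g \<oplus>\<^bsub>group_ring E\<^esub> h \<in> T" if "g \<in> T" "h \<in> T" for g h using WZ.ideal_add[OF Ti that] by simp
    fix k
    have f0: "\<rho> f k \<in> R0" using W_memD(3)[OF f] by (simp add: \<rho>_def)
    show "gmon E k (\<rho> f k) \<in> T"
    proof (cases "0 \<le> k")
      case False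
      then show ?thesis using f0 by (intro um) simp
    next
      case True
      then have "\<rho> f k \<in> nx (nat k, 0)" using nx[of "nat k" 0] by (simp add: \<rho>_def)
      then obtain e b where eb: "e \<in> np (Suc (nat k))" "b \<in> Rsq" "\<rho> f k = e \<oplus> b" using nx_even[OF _ f0] by blast
      have enp: "e \<in> np (nat k)" using np_antimono[of "nat k" "Suc (nat k)"] eb(1) by auto
      have fnp: "\<rho> f k \<in> np (nat k)" using W_memD(2)[OF f, of "(k, 0)"] F_0 by (simp add: \<rho>_def)
      have e0: "e \<in> R0" and b0: "b \<in> R0" using subsetD[OF np_even enp] subsetD[OF Rsq_even eb(2)] .
      \<comment> \<open>The monomial of \<open>b\<close> belongs to the Rees algebra only if
        \<open>b\<close> is in \<open>np (nat k)\<close>; this holds since \<open>b\<close> is the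
        difference of \<open>\<rho> f k\<close> and \<open>e\<close>.\<close>
      have "\<ominus> e \<in> np (nat k)"
        using additive_subgroup.a_inv_closed[OF E.ideal_subgroup[OF np_ideal] enp] E_minus[OF e0] by simp
      then have "\<ominus> e \<oplus> (e \<oplus> b) \<in> np (nat k)" using E.ideal_add[OF np_ideal _ fnp] eb(3) by simp
      then have bnp: "b \<in> np (nat k)" using even_carrier[OF e0] even_carrier[OF b0] by (simp add: r_neg1)
      obtain n :: nat where n: "b [^]\<^bsub>E\<^esub> n = \<zero>" using Rsq_nilpotent[OF eb(2)] by blast
      have "gmon E k b \<in> E.rees N0" using E.gmon_rees[OF _ N0_ideal, of b k] bnp by (simp add: np_ipow)
      then have "gmon E k b \<in> T" using E.gmon_nilpotent_in_prime[OF WZ_cring T, of b k n] b0 n by simp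
      moreover have "gmon E k e \<in> T" using um[of e k] eb(1) True by (simp add: nat_add_distrib)
      ultimately have "gmon E k e \<oplus>\<^bsub>group_ring E\<^esub> gmon E k b \<in> T" using WZ.ideal_add[OF Ti] by simp
      then show ?thesis using e0 b0 eb(3) by (simp add: E.gmon_add)
    qed
  qed
qed

text \<open>The chain above T^-1 from \<open>rees_prime_chain\<close> is pulled back along
  \<open>\<rho>\<close> and pushed forward along \<open>\<phi>\<close>. Inclusions stay strict, in
  the second step because by \<open>kernel_in_prime\<close> the primes contain the kernel of
  \<open>\<phi>\<close>.\<close>

theorem krull_dim_bgr_ge:
  assumes noeth: "noetherian_ring E" and M: "local_ring E M" and NM: "N0 \<subseteq> M"
    and n: "enat n \<le> krull_dim E"
  shows "enat n \<le> Ksdim0 (bgr R N)"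
proof -
  interpret EN: noetherian_cring E by (intro noetherian_cring.intro noeth E.is_cring)
  have Mp: "primeideal M E" using M E.maximalideal_prime by (simp add: local_ring_def)
  obtain P where P: "\<And>i. i \<le> n \<Longrightarrow> primeideal (P i) E" "\<And>i. i < n \<Longrightarrow> P i \<subset> P (Suc i)"
    using krull_dim_chain[OF n] Mp by blast
  have PM: "P n \<subseteq> M" by (rule EN.local_ring_prime_le[OF M P(1)[OF order_refl]])
  obtain T where T: "\<And>i. i \<le> n \<Longrightarrow> primeideal (T i) WZ" "\<And>i. i \<le> n \<Longrightarrow> gmon E (- 1) \<one> \<in> T i"
      "\<And>i. i < n \<Longrightarrow> T i \<subset> T (Suc i)"
    using E.rees_prime_chain[OF noeth N0_ideal Mp NM P PM] by auto
  interpret r: surj_hom WR WZ \<rho> by (rule \<rho>_surj_hom)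
  interpret p: surj_hom WR "even_ring (bgr R N)" \<phi> by (rule \<phi>_surj_hom)
  define Q where "Q i = {f \<in> carrier WR. \<rho> f \<in> T i}" for i
  have Q: "primeideal (Q i) WR" if "i \<le> n" for i unfolding Q_def by (rule r.vimage_prime[OF T(1)[OF that]])
  have ker: "f \<in> Q i" if "f \<in> carrier WR" "\<phi> f = \<zero>\<^bsub>even_ring (bgr R N)\<^esub>" "i \<le> n" for f i
    using kernel_in_prime[OF T(1,2)[OF that(3)]] that(1,2) by (simp add: Q_def)
  have inc: "Q i \<subset> Q (Suc i)" if "i < n" for i
  proof -
    have "Suc i \<le> n" using that by simp
    from r.B.ideal_sub[OF r.B.prime_ideal[OF T(1)[OF this]]]
    show ?thesis unfolding Q_def by (rule r.vimage_psubset[OF T(3)[OF that]])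
  qed
  show ?thesis unfolding Ksdim0_def
  proof (rule krull_dim_ge[of n "\<lambda>i. \<phi> ` Q i"])
    show "primeideal (\<phi> ` Q i) (even_ring (bgr R N))" if "i \<le> n" for i
      by (rule p.image_prime[OF Q[OF that]]) (rule ker[OF _ _ that])
    show "\<phi> ` Q i \<subset> \<phi> ` Q (Suc i)" if "i < n" for i
    proof -
      have i: "i \<le> n" using that by simp
      have "Q (Suc i) \<subseteq> carrier WR" by (auto simp: Q_def)
      note sub = this
      show ?thesis by (rule p.image_psubset[OF Q[OF i] _ inc[OF that] sub]) (rule ker[OF _ _ i])
    qed
  qed
qed

text \<open>The quotient of \<open>WR\<close> by the preimage of the smallest prime in the chain is
  a domain generated over a field by \<open>d\<close> elements: nilpotents disappear,
  \<open>M\<close> becomes zero, and \<open>gen\<close> expresses n through the \<open>x i\<close>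
  and elements of \<open>Rsq\<close>. So \<open>prime_chain_le_generators\<close> applies.\<close>

theorem krull_dim_bgr_le:
  assumes noeth: "noetherian_ring E" and M: "local_ring E M" and rad: "\<And>c. c \<in> M \<Longrightarrow> \<exists>r::nat. c [^]\<^bsub>E\<^esub> r \<in> N0"
    and x: "\<And>i. i \<in> {1..d} \<Longrightarrow> x i \<in> N0"
    and gen: "\<And>J. ideal J E \<Longrightarrow> x ` {1..d} \<subseteq> J \<Longrightarrow> Rsq \<inter> N0 \<subseteq> J \<Longrightarrow> N0 \<subseteq> J"
  shows "Ksdim0 (bgr R N) \<le> enat d"
  unfolding Ksdim0_def
proof (rule krull_dim_le)
  interpret EN: noetherian_cring E by (intro noetherian_cring.intro noeth E.is_cring)
  let ?B = "even_ring (bgr R N)"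
  fix Q :: "nat \<Rightarrow> (nat \<times> nat \<Rightarrow> 'a set) set" and n :: nat
  assume Q: "\<And>i. i \<le> n \<Longrightarrow> primeideal (Q i) ?B" "\<And>i. i < n \<Longrightarrow> Q i \<subset> Q (Suc i)"
  interpret p: surj_hom WR ?B \<phi> by (rule \<phi>_surj_hom)
  define P where "P i = {f \<in> carrier WR. \<phi> f \<in> Q i}" for i
  have P: "primeideal (P i) WR" if "i \<le> n" for i unfolding P_def by (rule p.vimage_prime[OF Q(1)[OF that]])
  have inc: "P i \<subset> P (Suc i)" if "i < n" for i
  proof -
    have "Suc i \<le> n" using that by simp
    from p.B.ideal_sub[OF p.B.prime_ideal[OF Q(1)[OF this]]]
    show ?thesis unfolding P_def by (rule p.vimage_psubset[OF Q(2)[OF that]])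
  qed
  have P0: "primeideal (P 0) WR" using P by simp
  note P0i = p.A.prime_ideal[OF P0]
  interpret P0: ideal "P 0" WR by (rule P0i)
  have kerP0: "f \<in> P 0" if "f \<in> W" "\<And>k l. f (int k, int l) \<in> nx (k, l)" for f
  proof -
    have "\<phi> f = \<zero>\<^bsub>?B\<^esub>" using \<phi>_zero_iff[OF that(1)] that(2) by simp
    then show ?thesis using that(1) p.B.ideal_zero[OF p.B.prime_ideal[OF Q(1)[of 0]]] by (simp add: P_def)
  qed
  define D where "D = WR Quot P 0"
  define \<pi> where "\<pi> f = P 0 +>\<^bsub>WR\<^esub> f" for f
  have D: "domain D" unfolding D_def by (rule primeideal.quotient_is_domain[OF P0])
  interpret D: "domain" D by (rule D)
  interpret q: surj_hom WR D \<pi>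
  proof (intro surj_hom.intro surj_hom_axioms.intro WR_cring D.is_cring)
    show "\<pi> \<in> ring_hom WR D" using P0.rcos_ring_hom by (simp add: \<pi>_def[abs_def] D_def)
    show "\<pi> ` carrier WR = carrier D" by (auto simp: D_def \<pi>_def FactRing_def A_RCOSETS_def')
  qed
  have \<pi>0: "\<pi> f = \<zero>\<^bsub>D\<^esub>" if "f \<in> P 0" for f
    using P0.a_rcos_const[OF that] by (simp add: \<pi>_def D_def FactRing_def)
  have \<pi>0D: "f \<in> P 0" if "f \<in> carrier WR" "\<pi> f = \<zero>\<^bsub>D\<^esub>" for f
    using P0.a_rcos_self[OF that(1)] that(2) by (simp add: \<pi>_def D_def FactRing_def)
  have monW: "gmon E (k, 0) a \<in> W" if "a \<in> np (nat k)" for k a using gmon_W[of a "(k, 0)"] that F_0 by simp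
  have monW': "gmon E (int k, 0) a \<in> W" if "a \<in> np k" for k a using monW[of a "int k"] that by simp
  have mon0W: "gmon E 0 a \<in> W" if "a \<in> R0" for a using monW[of a 0] that by (simp add: zero_prod_def)
  define \<kappa> where "\<kappa> a = \<pi> (gmon E 0 a)" for a
  have \<kappa>_hom: "ring_hom_ring E D \<kappa>"
  proof (rule ring_hom_ringI2[OF E.ring_axioms D.ring_axioms])
    show "\<kappa> \<in> ring_hom E D"
    proof (rule ring_hom_memI)
      fix a b assume ab: "a \<in> carrier E" "b \<in> carrier E"
      then have w: "gmon E 0 a \<in> carrier WR" "gmon E 0 b \<in> carrier WR" using mon0W by auto
      show "\<kappa> a \<in> carrier D" using q.h_simps(1)[OF w(1)] by (simp add: \<kappa>_def)
      have "gmon E 0 (a \<otimes>\<^bsub>E\<^esub> b) = gmon E 0 a \<otimes>\<^bsub>WR\<^esub> gmon E 0 b" using ab by (simp add: E.gmon_mult)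
      then show "\<kappa> (a \<otimes>\<^bsub>E\<^esub> b) = \<kappa> a \<otimes>\<^bsub>D\<^esub> \<kappa> b" unfolding \<kappa>_def using q.h_simps(3)[OF w] by simp
      have "gmon E 0 (a \<oplus>\<^bsub>E\<^esub> b) = gmon E 0 a \<oplus>\<^bsub>WR\<^esub> gmon E 0 b" using ab by (simp add: E.gmon_add)
      then show "\<kappa> (a \<oplus>\<^bsub>E\<^esub> b) = \<kappa> a \<oplus>\<^bsub>D\<^esub> \<kappa> b" unfolding \<kappa>_def using q.h_simps(2)[OF w] by simp
    next
      show "\<kappa> \<one>\<^bsub>E\<^esub> = \<one>\<^bsub>D\<^esub>" unfolding \<kappa>_def using q.h_simps(4) by (simp add: E.gring_one)
    qed
  qed
  interpret \<kappa>: ring_hom_ring E D \<kappa> by (rule \<kappa>_hom)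
  \<comment> \<open>Some power of \<open>c\<close> is in \<open>N0\<close>, hence in
    \<open>nx (0, 0)\<close>, so its constant monomial lies in \<open>P 0\<close>; as
    \<open>P 0\<close> is prime, so does that of \<open>c\<close>.\<close>
  have \<kappa>M: "\<kappa> c = \<zero>\<^bsub>D\<^esub>" if c: "c \<in> M" "c \<in> R0" for c
  proof -
    obtain r :: nat where r: "c [^]\<^bsub>E\<^esub> r \<in> N0" using rad[OF c(1)] by blast
    have r0: "c [^]\<^bsub>E\<^esub> r \<in> R0" using r by simp
    have "c [^]\<^bsub>E\<^esub> r \<in> nx (0, 0)" using r np_1 np_I[of "Suc 0"] nx_upper(1)[of 0 0] by blast
    then have "gmon E 0 (c [^]\<^bsub>E\<^esub> r) \<in> P 0"
      using additive_subgroup.zero_closed[OF nx_subgroup] mon0W[OF r0]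
      by (intro kerP0) (auto simp: gmon_def zero_prod_def)
    then have "gmon E 0 c [^]\<^bsub>WR\<^esub> r \<in> P 0" using E.gmon_0_pow[OF WR_cring, of c r] c by simp
    then have "gmon E 0 c \<in> P 0" using p.A.prime_pow[OF P0] mon0W[OF c(2)] by simp
    then show ?thesis using \<pi>0 by (simp add: \<kappa>_def)
  qed
  \<comment> \<open>This is a copy of the residue field of \<open>E\<close>: elements of
    \<open>M\<close> map to zero, and all others are units of \<open>E\<close>.\<close>
  let ?K = "\<kappa> ` R0"
  have K: "subfield ?K D"
  proof (rule D.subfieldI)
    have "subring (\<kappa> ` carrier E) D" by (rule \<kappa>.img_is_subring[OF E.carrier_is_subring])
    then have sr: "subring ?K D" by simp
    then show "subcring ?K D" by (rule D.subcringI')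
    note k = subringE[OF sr]
    show "Units (D\<lparr>carrier := ?K\<rparr>) = ?K - {\<zero>\<^bsub>D\<^esub>}"
    proof (intro equalityI subsetI)
      fix u assume "u \<in> Units (D\<lparr>carrier := ?K\<rparr>)"
      then obtain v where v: "u \<in> ?K" "v \<in> ?K" "v \<otimes>\<^bsub>D\<^esub> u = \<one>\<^bsub>D\<^esub>" by (auto simp: Units_def)
      have "v \<in> carrier D" using v k(1) by blast
      then have "u \<noteq> \<zero>\<^bsub>D\<^esub>" using v(3) by auto
      then show "u \<in> ?K - {\<zero>\<^bsub>D\<^esub>}" using v by simp
    next
      fix u assume u: "u \<in> ?K - {\<zero>\<^bsub>D\<^esub>}"
      then obtain c where c: "c \<in> R0" "u = \<kappa> c" by blast
      then have "c \<notin> M" using \<kappa>M u by auto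
      then obtain c' where c': "c' \<in> R0" "c' \<otimes> c = \<one>" using EN.local_ring_unit[OF M, of c] c by auto
      have "\<kappa> c' \<otimes>\<^bsub>D\<^esub> u = \<one>\<^bsub>D\<^esub>" using \<kappa>.hom_mult[of c' c] \<kappa>.hom_one c c' by simp
      moreover have "u \<otimes>\<^bsub>D\<^esub> \<kappa> c' = \<kappa> c' \<otimes>\<^bsub>D\<^esub> u" using D.m_comm \<kappa>.hom_closed c c' by simp
      ultimately show "u \<in> Units (D\<lparr>carrier := ?K\<rparr>)" using c' c by (auto simp: Units_def)
    qed
  qed
  define t where "t i = \<pi> (gmon E (1, 0) (x i))" for i
  define ts where "ts = map t [1..<Suc d]"
  have xnp: "x i \<in> np (nat 1)" if "i \<in> {1..d}" for i using x[OF that] np_1 by simp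
  have tW: "gmon E (1, 0) (x i) \<in> carrier WR" if "i \<in> {1..d}" for i using monW[OF xnp[OF that]] by simp
  have ts: "set ts = t ` {1..d}" by (auto simp: ts_def)
  have tsc: "set ts \<subseteq> carrier D" unfolding ts using q.h_simps(1)[OF tW] by (auto simp: t_def)
  have len: "length ts = d" by (simp add: ts_def)
  have "n \<le> length ts"
  proof (rule D.prime_chain_le_generators[OF K tsc, of n "\<lambda>i. \<pi> ` P i"])
    have ker: "f \<in> P i" if "f \<in> carrier WR" "\<pi> f = \<zero>\<^bsub>D\<^esub>" "i \<le> n" for f i
    proof -
      have "P 0 \<subseteq> P i" using that(3)
      proof (induction i)
        case (Suc i)
        then have "P 0 \<subseteq> P i" "i < n" by simp_all
        then show ?case using inc[of i] by blast
      qed simp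
      then show ?thesis using \<pi>0D[OF that(1,2)] by blast
    qed
    show "primeideal (\<pi> ` P i) D" if "i \<le> n" for i by (rule q.image_prime[OF P[OF that]]) (rule ker[OF _ _ that])
    show "\<pi> ` P i \<subset> \<pi> ` P (Suc i)" if "i < n" for i
    proof -
      have i: "i \<le> n" using that by simp
      have sub: "P (Suc i) \<subseteq> carrier WR" by (auto simp: P_def)
      show ?thesis by (rule q.image_psubset[OF P[OF i] _ inc[OF that] sub]) (rule ker[OF _ _ i])
    qed
  next
    fix Y assume KY: "?K \<subseteq> Y" and Yadd: "\<And>a b. a \<in> Y \<Longrightarrow> b \<in> Y \<Longrightarrow> a \<oplus>\<^bsub>D\<^esub> b \<in> Y"
      and Yt: "\<And>t a. t \<in> set ts \<Longrightarrow> a \<in> Y \<Longrightarrow> t \<otimes>\<^bsub>D\<^esub> a \<in> Y"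
    have Y0: "\<zero>\<^bsub>D\<^esub> \<in> Y" using KY subringE(2)[OF subfieldE(1)[OF K]] by blast
    have inP: "\<pi> f \<in> Y" if "f \<in> P 0" for f using \<pi>0[OF that] Y0 by simp
    \<comment> \<open>A monomial with coefficient in \<open>Rsq\<close> is nilpotent and therefore
      vanishes in the domain \<open>D\<close>.\<close>
    have nilP: "\<pi> (gmon E p a) \<in> Y" if a: "a \<in> Rsq" "gmon E p a \<in> W" for p a
    proof -
      obtain r :: nat where "a [^]\<^bsub>E\<^esub> r = \<zero>" using Rsq_nilpotent[OF a(1)] by blast
      then show ?thesis using E.gmon_nilpotent_in_prime[OF WR_cring P0, of a p r] a Rsq_even by (intro inP) auto
    qed
    have main: "\<pi> (gmon E (int k, 0) a) \<in> Y" if "a \<in> np k" for k a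
      using that
    proof (induction k arbitrary: a)
      case 0
      then have "\<kappa> a \<in> Y" using KY by auto
      then show ?case by (simp add: \<kappa>_def zero_prod_def)
    next
      case (Suc k)
      let ?g = "\<lambda>c. gmon E (int (Suc k), 0) c"
      have gW: "?g c \<in> carrier WR" if "c \<in> np (Suc k)" for c using monW'[OF that] by simp
      \<comment> \<open>The elements of \<open>N0\<close> whose products with \<open>np k\<close>,
        placed in degree \<open>(k + 1, 0)\<close>, map into \<open>Y\<close>. This ideal contains
        the \<open>x i\<close>, by multiplication with \<open>t i\<close>, and
        \<open>Rsq \<inter> N0\<close>, by nilpotency; so \<open>gen\<close> shows that it is all of
        \<open>N0\<close>.\<close>
      let ?J = "{c \<in> N0. \<forall>b \<in> np k. \<pi> (?g (b \<otimes> c)) \<in> Y}"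
      have bc: "b \<otimes> c \<in> np (Suc k)" if "b \<in> np k" "c \<in> N0" for b c using ideal_prod.prod[OF that, of R] by simp
      have ga: "\<pi> (?g (a \<oplus> b)) = \<pi> (?g a) \<oplus>\<^bsub>D\<^esub> \<pi> (?g b)" if "a \<in> np (Suc k)" "b \<in> np (Suc k)" for a b
      proof -
        have "a \<in> R0" "b \<in> R0" using subsetD[OF np_even that(1)] subsetD[OF np_even that(2)] .
        then have "?g (a \<oplus> b) = ?g a \<oplus>\<^bsub>WR\<^esub> ?g b" by (simp add: E.gmon_add)
        then show ?thesis using q.h_simps(2)[OF gW[OF that(1)] gW[OF that(2)]] by simp
      qed
      have "ideal ?J E"
      proof (rule E.ideal_of_closed)
        show "?J \<subseteq> carrier E" by auto
        have "\<pi> (?g (b \<otimes> \<zero>)) \<in> Y" if b: "b \<in> np k" for b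
        proof -
          have "\<zero> \<in> Rsq" by (rule additive_subgroup.zero_closed[OF Rsq_subgroup])
          moreover have "b \<otimes> \<zero> = \<zero>" using subsetD[OF np_carrier b] by simp
          ultimately show ?thesis using nilP[of \<zero>] gW[OF np_zero] by simp
        qed
        moreover have "\<zero> \<in> N0" using E.ideal_zero[OF N0_ideal] by simp
        ultimately show "\<zero>\<^bsub>E\<^esub> \<in> ?J" by simp
      next
        fix c c' assume c: "c \<in> ?J" "c' \<in> ?J"
        have "\<pi> (?g (b \<otimes> (c \<oplus> c'))) \<in> Y" if b: "b \<in> np k" for b
        proof -
          have cc: "c \<in> C" "c' \<in> C" "b \<in> C" using c even_carrier subsetD[OF np_carrier b] by auto
          have "b \<otimes> (c \<oplus> c') = b \<otimes> c \<oplus> b \<otimes> c'" using cc by (simp add: r_distr)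
          then show ?thesis using ga[OF bc[OF b, of c] bc[OF b, of c']] Yadd c b by auto
        qed
        moreover have "c \<oplus> c' \<in> N0" using E.ideal_add[OF N0_ideal, of c c'] c by simp
        ultimately show "c \<oplus>\<^bsub>E\<^esub> c' \<in> ?J" by simp
      next
        fix r c assume r: "r \<in> carrier E" and c: "c \<in> ?J"
        have "\<pi> (?g (b \<otimes> (r \<otimes> c))) \<in> Y" if b: "b \<in> np k" for b
        proof -
          have cc: "c \<in> C" "r \<in> C" "b \<in> C" using c r even_carrier subsetD[OF np_carrier b] by auto
          have "b \<otimes> r \<in> np k" using ideal.I_r_closed[OF np_ideal b r] by simp
          then have "\<pi> (?g ((b \<otimes> r) \<otimes> c)) \<in> Y" using c by blast
          then show ?thesis using cc by (simp add: m_assoc)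
        qed
        moreover have "r \<otimes> c \<in> N0" using E.ideal_mult[OF N0_ideal, of c r] c r by simp
        ultimately show "r \<otimes>\<^bsub>E\<^esub> c \<in> ?J" by simp
      qed
      moreover have "x ` {1..d} \<subseteq> ?J"
      proof
        fix y assume "y \<in> x ` {1..d}"
        then obtain i where i: "i \<in> {1..d}" "y = x i" by blast
        have y0: "y \<in> R0" using x[OF i(1)] i(2) by simp
        have "\<pi> (?g (b \<otimes> y)) \<in> Y" if b: "b \<in> np k" for b
        proof -
          have b0: "b \<in> R0" using subsetD[OF np_even b] .
          have bW: "gmon E (int k, 0) b \<in> carrier WR" using monW[of b "int k"] b by simp
          have "gmon E (1, 0) y \<otimes>\<^bsub>WR\<^esub> gmon E (int k, 0) b = ?g (y \<otimes> b)"
            using E.gmon_mult[of y b "(1, 0)" "(int k, 0)"] y0 b0 by (simp add: add.commute)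
          moreover have "y \<otimes> b = b \<otimes> y" by (rule comm_even_even[OF y0 b0])
          ultimately have "\<pi> (?g (b \<otimes> y)) = t i \<otimes>\<^bsub>D\<^esub> \<pi> (gmon E (int k, 0) b)"
            using q.h_simps(3)[OF tW[OF i(1)] bW] i(2) by (simp add: t_def)
          then show ?thesis using Yt[OF _ Suc.IH[OF b], of "t i"] ts i(1) by simp
        qed
        then show "y \<in> ?J" using x[OF i(1)] i(2) by simp
      qed
      moreover have "Rsq \<inter> N0 \<subseteq> ?J"
      proof
        fix c assume c: "c \<in> Rsq \<inter> N0"
        have "\<pi> (?g (b \<otimes> c)) \<in> Y" if b: "b \<in> np k" for b
          using nilP[OF Rsq_mult[of c b], of "(int (Suc k), 0)"] gW[OF bc[OF b, of c]] c subsetD[OF np_even b] by simp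
        then show "c \<in> ?J" using c by simp
      qed
      ultimately have NJ: "N0 \<subseteq> ?J" by (rule gen)
      have "a \<in> np k \<cdot> N0" using Suc(2) by simp
      then show ?case
      proof induction
        case (prod b c) then show ?case using NJ by blast
      next
        case (sum a b)
        then show ?case using ga[of a b] Yadd by simp
      qed
    qed
    have all: "\<pi> f \<in> Y" if f: "f \<in> W" for f
    proof -
      have "f \<in> {g \<in> W. \<pi> g \<in> Y}"
      proof (rule E.gring_gmon_span[OF W_memD(1)[OF f]])
        have "\<pi> \<zero>\<^bsub>WR\<^esub> \<in> Y" using q.h_zero Y0 by simp
        moreover have "\<zero>\<^bsub>WR\<^esub> \<in> carrier WR" by (rule p.A.zero_closed)
        ultimately show "\<zero>\<^bsub>group_ring E\<^esub> \<in> {g \<in> W. \<pi> g \<in> Y}" by simp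
      next
        fix g h assume gh: "g \<in> {g \<in> W. \<pi> g \<in> Y}" "h \<in> {g \<in> W. \<pi> g \<in> Y}"
        then have "\<pi> (g \<oplus>\<^bsub>WR\<^esub> h) \<in> Y" using q.h_simps(2)[of g h] Yadd by simp
        moreover have "g \<oplus>\<^bsub>WR\<^esub> h \<in> carrier WR" using gh p.A.add.m_closed[of g h] by simp
        ultimately show "g \<oplus>\<^bsub>group_ring E\<^esub> h \<in> {g \<in> W. \<pi> g \<in> Y}" by simp
      next
        fix q :: "int \<times> int"
        obtain k l where kl: "q = (k, l)" by (cases q)
        have aF: "f (k, l) \<in> F (k, l)" by (rule W_memD(2)[OF f])
        have aW: "gmon E (k, l) (f (k, l)) \<in> W" by (rule gmon_W[OF aF])
        have "\<pi> (gmon E (k, l) (f (k, l))) \<in> Y"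
        \<comment> \<open>Degrees \<open>(k, 0)\<close> with \<open>0 \<le> k\<close> are covered by
          \<open>main\<close>, and those with negative \<open>k\<close> lie in the kernel of
          \<open>\<phi>\<close>. In all other degrees the coefficient is in
          \<open>Rsq\<close>.\<close>
        proof (cases "l = 0")
          case True
          show ?thesis
          proof (cases "0 \<le> k")
            case kpos: True
            then show ?thesis using main[of "f (k, l)" "nat k"] aF True F_0 by simp
          next
            case False
            then have "gmon E (k, l) (f (k, l)) (int k', int l') \<in> nx (k', l')" for k' l'
              using additive_subgroup.zero_closed[OF nx_subgroup] by (simp add: gmon_def)
            then show ?thesis by (intro inP kerP0 aW)
          qed
        next
          case False
          have "f (k, l) \<in> Rsq"
          proof (cases "l < 0")
            case True
            then show ?thesis using aF F_neg additive_subgroup.zero_closed[OF Rsq_subgroup] by simp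
          next
            case nl: False
            then have "nat l = Suc (nat l - 1)" using False by simp
            then show ?thesis using aF nl I_Rsq[of "f (k, l)" "nat k" "nat l - 1"] by (simp add: F_nonneg)
          qed
          then show ?thesis by (rule nilP[OF _ aW])
        qed
        then show "gmon E q (f q) \<in> {g \<in> W. \<pi> g \<in> Y}" using aW kl by simp
      qed
      then show ?thesis by simp
    qed
    show "carrier D \<subseteq> Y"
    proof
      fix c assume "c \<in> carrier D"
      then obtain f where "f \<in> carrier WR" "c = \<pi> f" using q.surj by blast
      then show "c \<in> Y" using all by simp
    qed
  qed
  then show "enat n \<le> enat d" using len by simp
qed

end

section \<open>Reduction of the theorem to the two bounds for the bigraded ring\<close>

theorem lemma6p4:
  fixes R :: "('a, 'b) superring_scheme"
    and \<MM> \<NN> :: "'a set"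
    and x :: "nat \<Rightarrow> 'a"
    and d :: nat
  assumes "local_superring R \<MM>"
    and "noetherian_superring R"
    and "\<exists>K. subfield K R"
    and "primary_superideal R \<MM> \<NN>"
    and "x ` {1..d} \<subseteq> even_part R"
    and "system_of_parameters (bar_ring R) d (\<lambda>i. bar_class R (x i))"
    and "bar_class R ` ((\<NN> \<inter> even_part R) <+>\<^bsub>R\<^esub> odd_square_ideal R)
           = Idl\<^bsub>bar_ring R\<^esub> ((\<lambda>i. bar_class R (x i)) ` {1..d})"
  shows "enat d = Ksdim0 R \<and> Ksdim0 R = Ksdim0 (bgr R \<NN>)"
proof -
  interpret superring R using assms(2) by (simp add: noetherian_superring_def)
  interpret superring_superideal R \<NN>
    by unfold_locales (use assms(4) in \<open>simp add: primary_superideal_def\<close>)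
  interpret E: cring E by (rule E_cring)
  have noeth: "noetherian_ring E" by (rule E_noetherian[OF assms(2)])
  obtain M where M: "local_ring E M" "\<MM> = M <+>\<^bsub>R\<^esub> R1" using assms(1) by (auto simp: local_superring_def)
  have Mi: "ideal M E" using M(1) by (simp add: local_ring_def maximalideal.axioms(1))
  have M0: "M \<subseteq> R0" using E.ideal_sub[OF Mi] by simp
  have MM: "\<MM> \<inter> R0 = M"
  proof (intro equalityI subsetI)
    fix a assume "a \<in> \<MM> \<inter> R0"
    then obtain b c where bc: "b \<in> M" "c \<in> R1" "a = b \<oplus>\<^bsub>R\<^esub> c" "a \<in> R0" using M(2) by (auto simp: set_add_def')
    have b0: "b \<in> R0" using bc M0 by auto
    then have "c = \<zero>\<^bsub>R\<^esub>" using even_part_eq[OF b0 bc(2)] bc by simp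
    then show "a \<in> M" using bc even_carrier[OF b0] by simp
  next
    fix a assume a: "a \<in> M"
    then have "a \<oplus>\<^bsub>R\<^esub> \<zero>\<^bsub>R\<^esub> \<in> \<MM>" unfolding M(2) set_add_def' using odd_simps(2) by blast
    moreover have "a \<in> R0" using a M0 by auto
    ultimately show "a \<in> \<MM> \<inter> R0" using even_carrier by simp
  qed
  have rad: "ideal_radical E N0 = M" using assms(4) MM by (simp add: primary_superideal_def primary_to_def)
  have rad': "\<exists>r::nat. c [^]\<^bsub>E\<^esub> r \<in> N0" if "c \<in> M" for c using that rad by (auto simp: ideal_radical_def)
  have NM: "N0 \<subseteq> M"
  proof
    fix a assume a: "a \<in> N0"
    then have "a \<in> carrier E" "a [^]\<^bsub>E\<^esub> Suc 0 \<in> N0" using even_carrier by simp_all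
    then have "a \<in> ideal_radical E N0" unfolding ideal_radical_def by blast
    then show "a \<in> M" using rad by simp
  qed
  have bar: "bar_ring R = E Quot Rsq" "bar_class R a = Rsq +>\<^bsub>E\<^esub> a" for a by (simp_all add: bar_ring_def bar_class_def)
  interpret S: ideal Rsq E by (rule Rsq_ideal)
  \<comment> \<open>The number \<open>d\<close> enters as the dimension of
    \<open>bar_ring R\<close>, by the definition of a system of parameters; factoring out the nil
    ideal \<open>Rsq\<close> does not change the dimension.\<close>
  have "enat d = krull_dim (E Quot Rsq)" using assms(6) unfolding system_of_parameters_def bar(1) by blast
  also have "\<dots> = krull_dim E"
    by (rule E.krull_dim_quotient_nil[OF Rsq_ideal]) (use Rsq_nilpotent in simp)
  finally have dim: "enat d = krull_dim E" .
  have class_eq: "bar_class R a = bar_class R b \<longleftrightarrow> a \<ominus>\<^bsub>E\<^esub> b \<in> Rsq" if "a \<in> R0" "b \<in> R0" for a b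
    using E.quotient_eq_iff_same_a_r_cos[OF Rsq_ideal, of a b] that by (simp add: bar)
  interpret Q: ring "E Quot Rsq" by (rule S.quotient_is_ring)
  have xc: "(\<lambda>i. bar_class R (x i)) ` {1..d} \<subseteq> carrier (E Quot Rsq)"
    using assms(5) by (auto simp: bar FactRing_def A_RCOSETS_def')
  \<comment> \<open>The \<open>x i\<close> lie in \<open>N0\<close> only up to \<open>Rsq\<close>,
    whereas the upper bound asks for elements of \<open>N0\<close>. Representatives of the same
    classes are therefore chosen there.\<close>
  have "\<exists>y \<in> N0. bar_class R y = bar_class R (x i)" if i: "i \<in> {1..d}" for i
  proof -
    have "bar_class R (x i) \<in> Idl\<^bsub>bar_ring R\<^esub> ((\<lambda>i. bar_class R (x i)) ` {1..d})"
      using Q.genideal_self[OF xc] i by (auto simp: bar(1))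
    then obtain y s where ys: "y \<in> N0" "s \<in> Rsq" "bar_class R (x i) = bar_class R (y \<oplus>\<^bsub>R\<^esub> s)"
      unfolding assms(7)[symmetric] by (auto simp: set_add_def')
    have y0: "y \<in> R0" and s0: "s \<in> R0" using ys Rsq_even by auto
    have "(y \<oplus>\<^bsub>E\<^esub> s) \<ominus>\<^bsub>E\<^esub> y = s"
      using E.a_comm[of y s] E.a_assoc[of s y "\<ominus>\<^bsub>E\<^esub> y"] E.r_neg[of y] E.a_inv_closed[of y] y0 s0 by (simp add: a_minus_def even_carrier)
    then have "(y \<oplus>\<^bsub>R\<^esub> s) \<ominus>\<^bsub>E\<^esub> y \<in> Rsq" using ys(2) by simp
    then have "bar_class R (y \<oplus>\<^bsub>R\<^esub> s) = bar_class R y" using class_eq[of "y \<oplus>\<^bsub>R\<^esub> s" y] y0 s0 even_simps by simp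
    then show ?thesis using ys by auto
  qed
  then obtain y where y: "\<And>i. i \<in> {1..d} \<Longrightarrow> y i \<in> N0" "\<And>i. i \<in> {1..d} \<Longrightarrow> bar_class R (y i) = bar_class R (x i)"
    by metis
  \<comment> \<open>The class of \<open>c\<close> is in the ideal generated by the classes of the
    \<open>y i\<close>, hence in the image of \<open>J \<inter> N0\<close>. Intersecting with
    \<open>N0\<close> makes \<open>c\<close> and its counterpart \<open>j\<close> differ by an
    element of \<open>Rsq \<inter> N0\<close>, which \<open>J\<close> contains.\<close>
  have gen: "N0 \<subseteq> J" if J: "ideal J E" "y ` {1..d} \<subseteq> J" "Rsq \<inter> N0 \<subseteq> J" for J
  proof
    fix c assume c: "c \<in> N0"
    have JN: "ideal (J \<inter> N0) E" by (rule E.i_intersect[OF J(1) N0_ideal])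
    have "ideal ((+>\<^bsub>E\<^esub>) Rsq ` (J \<inter> N0)) (E Quot Rsq)" by (rule E.ring_ideal_imp_quot_ideal[OF Rsq_ideal JN])
    moreover have "(\<lambda>i. bar_class R (x i)) ` {1..d} \<subseteq> (+>\<^bsub>E\<^esub>) Rsq ` (J \<inter> N0)"
    proof
      fix z assume "z \<in> (\<lambda>i. bar_class R (x i)) ` {1..d}"
      then obtain i where i: "i \<in> {1..d}" "z = Rsq +>\<^bsub>E\<^esub> y i" using y(2) bar(2) by auto
      then show "z \<in> (+>\<^bsub>E\<^esub>) Rsq ` (J \<inter> N0)" using y(1) J(2) by blast
    qed
    ultimately have sub: "Idl\<^bsub>E Quot Rsq\<^esub> ((\<lambda>i. bar_class R (x i)) ` {1..d}) \<subseteq> (+>\<^bsub>E\<^esub>) Rsq ` (J \<inter> N0)"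
      by (rule Q.genideal_minimal)
    have "c \<oplus>\<^bsub>R\<^esub> \<zero>\<^bsub>R\<^esub> \<in> N0 <+>\<^bsub>R\<^esub> Rsq"
      unfolding set_add_def' using c additive_subgroup.zero_closed[OF Rsq_subgroup] by blast
    then have "bar_class R c \<in> bar_class R ` (N0 <+>\<^bsub>R\<^esub> Rsq)" using c even_carrier by auto
    then obtain j where j: "j \<in> J" "j \<in> N0" "bar_class R c = bar_class R j"
      using sub unfolding assms(7) bar by blast
    have c0: "c \<in> R0" and j0: "j \<in> R0" using c j by auto
    have diff: "c \<ominus>\<^bsub>E\<^esub> j \<in> Rsq \<inter> N0" using class_eq[OF c0 j0] j E.ideal_minus[OF N0_ideal c j(2)] by simp
    have "(c \<ominus>\<^bsub>E\<^esub> j) \<oplus>\<^bsub>E\<^esub> j \<in> J" using E.ideal_add[OF J(1) _ j(1)] diff J(3) by blast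
    moreover have "(c \<ominus>\<^bsub>E\<^esub> j) \<oplus>\<^bsub>E\<^esub> j = c"
      using E.a_assoc[of c "\<ominus>\<^bsub>E\<^esub> j" j] E.l_neg[of j] E.a_inv_closed[of j] c0 j0 by (simp add: a_minus_def even_carrier)
    ultimately show "c \<in> J" by simp
  qed
  have "enat d \<le> Ksdim0 (bgr R \<NN>)" using krull_dim_bgr_ge[OF noeth M(1) NM, of d] dim by simp
  moreover have "Ksdim0 (bgr R \<NN>) \<le> enat d" by (rule krull_dim_bgr_le[OF noeth M(1) rad' y(1) gen])
  ultimately show ?thesis using dim by (simp add: Ksdim0_def)
qed

end
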